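(* Consider the Cox proportional hazards model with right censoring, with baseline hazard $\lambda_0$, cumulative baseline hazard $\Lambda_0(t)=\int_0^t\lambda_0(u)\,du$, true regression parameter $\beta_0\in\mathbb{R}^d$, i.i.d. observations $(T_i,\Delta_i,Z_i)$, $i=1,\dots,n$, and Breslow estimator $\Lambda_n$, as described in the context. Assume that: (i) the end points $\tau_F$ and $\tau_G$ of the support of $F$ and $G$ satisfy $\tau_G<\tau_F\le\infty$ and $\mathbb{P}(T=\tau_G)>0$; (ii) there exists $\epsilon>0$ such that $\sup_{|\beta-\beta_0|\le\epsilon}\mathbb{E}\left[|Z|^2 e^{2\beta'Z}\right]<\infty$; (iii) for all $q\ge 1$, $\mathbb{E}\left[e^{q\beta_0'Z}\right]<\infty$; (iv) there exists $\epsilon>0$ such that, for all $q\ge 1$ and $k=1,\dots,d$, $\sup_{|\beta-\beta_0|\le\epsilon}\mathbb{E}\left[Z_k^{2q}e^{q\beta'Z}\right]<\infty$; (v) the baseline hazard $\lambda_0$ is continuous. Let $p\ge 1$. Then there exist events $A_n$ (for $n\geq 1$) with $\mathbb{P}(A_n)\to 1$ as $n\to\infty$, and a constant $K>0$, such that $$\limsup_{n\to\infty}\mathbb{E}\left[\mathbf{1}_{A_n}\,n^{p/2}\sup_{t\in[0,\tau_G)}|\Lambda_n(t)-\Lambda_0(t)|^p\right]\le K.$$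
   Context: Notation: $|\cdot|$ is the Euclidean norm (absolute value for scalars), $\beta'$ is the transpose of $\beta$, $Z_k$ is the $k$-th component of the vector $Z$, and $\mathbf{1}_A$ is the indicator of $A$. Model: $X\ge 0$ is the event time, $C\ge 0$ the censoring time, and $Z\in\mathbb{R}^d$ a covariate vector with distribution $F_Z$. Given $Z$, the variables $X$ and $C$ are independent. Conditionally on $Z=z$, $X$ has an absolutely continuous distribution function $F(x|z)$ with density $f(x|z)$, and $C$ has distribution function $G(x|z)$; the censoring mechanism is non-informative ($F$ and $G$ share no parameters). Here $\tau_F$ and $\tau_G$ are the right end points of the supports of the distributions of $X$ and $C$ respectively. The hazard function of $X$ at time $t$ given $Z=z$ is $$\lambda(t|z)=\lambda_0(t)e^{\beta_0'z},\qquad t\in\mathbb{R}^+,$$ where $\lambda_0\geq 0$ is the baseline hazard and $\beta_0\in\mathbb{R}^d$ is the vector of regression coefficients. Put $T=\min(X,C)$ and $\Delta=\mathbf{1}_{\{X\le C\}}$. One observes $n$ i.i.d. copies $(T_i,\Delta_i,Z_i)$, $i=1,\dots,n$, of $(T,\Delta,Z)$. Estimators: let $0<X_{(1)}<\cdots<X_{(m)}<\infty$ be the ordered observed event times (the ordered values of those $T_i$ with $\Delta_i=1$) and let $Z_{(i)}$ be the covariate vector of the subject whose event occurs at $X_{(i)}$. The maximum partial likelihood estimator $\hat\beta_n$ is the maximizer over $\beta\in\mathbb{R}^d$ of $$L(\beta)=\prod_{i=1}^m\frac{e^{\beta'Z_{(i)}}}{\sum_{j=1}^n\mathbf{1}_{\{T_j\ge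 X_{(i)}\}}e^{\beta'Z_j}}$$ (on the event where no maximizer exists, $\hat\beta_n$ may be defined arbitrarily). With $$\Phi_n(t;\beta)=\frac1n\sum_{i=1}^n\mathbf{1}_{\{T_i\ge t\}}e^{\beta'Z_i},$$ the Breslow estimator is $$\Lambda_n(t)=\frac1n\sum_{i=1}^n\frac{\Delta_i\mathbf{1}_{\{T_i\le t\}}}{\Phi_n(T_i;\hat\beta_n)}.$$ Standing nondegeneracy assumption (the usual regularity condition under which $n^{1/2}(\hat\beta_n-\beta_0)$ is asymptotically normal with positive definite covariance matrix): with $\Phi(u)=\mathbb{E}[\mathbf{1}_{\{T\ge u\}}e^{\beta_0'Z}]$, $D^1(u)=\mathbb{E}[\mathbf{1}_{\{T\ge u\}}Ze^{\beta_0'Z}]$ and $D^2(u)=\mathbb{E}[\mathbf{1}_{\{T\ge u\}}ZZ'e^{\beta_0'Z}]$, the matrix $$\int_0^{\tau_G}\left(\frac{D^2(u)}{\Phi(u)}-\frac{D^1(u)D^1(u)'}{\Phi(u)^2}\right)\Phi(u)\lambda_0(u)\,du$$ is positive definite. *)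

theory Defs
  imports "HOL-Probability.Probability"
begin

definition prob_given ::
    "'a measure \<Rightarrow> ('a \<Rightarrow> 'b::topological_space) \<Rightarrow> 'a set \<Rightarrow> 'a \<Rightarrow> real" where
  "prob_given M Z A = real_cond_exp M (vimage_algebra (space M) Z borel) (indicat_real A)"

definition cond_indep_given ::
    "'a measure \<Rightarrow> ('a \<Rightarrow> real) \<Rightarrow> ('a \<Rightarrow> real) \<Rightarrow> ('a \<Rightarrow> 'b::topological_space) \<Rightarrow> bool" where
  "cond_indep_given M X C Z \<longleftrightarrow>
     (\<forall>A\<in>sets borel. \<forall>B\<in>sets borel. AE \<omega> in M.
        prob_given M Z {\<omega>\<in>space M. X \<omega> \<in> A \<and> C \<omega> \<in> B} \<omega>
        = prob_given M Z {\<omega>\<in>space M. X \<omega> \<in> A} \<omega> * prob_given M Z {\<omega>\<in>space M. C \<omega> \<in> B} \<omega>)"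

text \<open>\<open>H t z\<close> is a regular version of the probability of \<open>Y \<le> t\<close> given \<open>Z = z\<close>.\<close>

definition cond_distribution_function ::
    "'a measure \<Rightarrow> ('a \<Rightarrow> real) \<Rightarrow> ('a \<Rightarrow> 'b::topological_space) \<Rightarrow> (real \<Rightarrow> 'b \<Rightarrow> real) \<Rightarrow> bool" where
  "cond_distribution_function M Y Z H \<longleftrightarrow>
     (\<forall>t. H t \<in> borel_measurable borel) \<and>
     (\<forall>z. \<exists>N. real_distribution N \<and> (\<forall>t. cdf N t = H t z)) \<and>
     (\<forall>t. AE \<omega> in M. prob_given M Z {\<omega>\<in>space M. Y \<omega> \<le> t} \<omega> = H t (Z \<omega>))"

definition measure_support :: "'a::topological_space measure \<Rightarrow> 'a set" where
  "measure_support N = {x. \<forall>U. open U \<and> x \<in> U \<longrightarrow> 0 < emeasure N U}"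

definition right_endpoint :: "'a measure \<Rightarrow> ('a \<Rightarrow> real) \<Rightarrow> ereal" where
  "right_endpoint M Y = (SUP x\<in>measure_support (distr M borel Y). ereal x)"

definition hazard :: "(real \<Rightarrow> 'b \<Rightarrow> real) \<Rightarrow> (real \<Rightarrow> 'b \<Rightarrow> real) \<Rightarrow> real \<Rightarrow> 'b \<Rightarrow> real" where
  "hazard f F t z = f t z / (1 - F t z)"

text \<open>
  The hazard identity is required strictly below the right end point of the support of \<open>X\<close>,
  beyond which the hazard is the meaningless quotient of 0 by 0.
\<close>

locale cox_model = prob_space M
  for M :: "'a measure" +
  fixes X C :: "'a \<Rightarrow> real"
    and Z :: "'a \<Rightarrow> (real ^ 'd::finite)"
    and F f G :: "real \<Rightarrow> real ^ 'd \<Rightarrow> real"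
    and lambda0 :: "real \<Rightarrow> real"
    and \<beta>\<^sub>0 :: "real ^ 'd"
  assumes X_rv: "random_variable borel X"
    and C_rv: "random_variable borel C"
    and Z_rv: "random_variable borel Z"
    and X_nonneg: "AE \<omega> in M. 0 \<le> X \<omega>"
    and C_nonneg: "AE \<omega> in M. 0 \<le> C \<omega>"
    and cond_indep: "cond_indep_given M X C Z"
    and F_cdf: "cond_distribution_function M X Z F"
    and f_measurable: "\<And>z. (\<lambda>t. f t z) \<in> borel_measurable borel"
    and f_nonneg: "\<And>t z. 0 \<le> f t z"
    and f_density: "\<And>t z. F t z = cdf (density lborel (\<lambda>u. ennreal (f u z))) t"
    and G_cdf: "cond_distribution_function M C Z G"
    and baseline_nonneg: "\<And>t. 0 \<le> t \<Longrightarrow> 0 \<le> lambda0 t"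
    and hazard_eq: "\<And>t z. 0 \<le> t \<Longrightarrow> ereal t < right_endpoint M X \<Longrightarrow>
                      hazard f F t z = lambda0 t * exp (\<beta>\<^sub>0 \<bullet> z)"

definition cum_hazard :: "(real \<Rightarrow> real) \<Rightarrow> real \<Rightarrow> real" where
  "cum_hazard h t = (LBINT u:{0..t}. h u)"

abbreviation obs_algebra :: "(real \<times> bool \<times> (real ^ 'd::finite)) measure" where
  "obs_algebra \<equiv> borel \<Otimes>\<^sub>M (count_space UNIV \<Otimes>\<^sub>M borel)"

definition iid_copies ::
    "'a measure \<Rightarrow> (nat \<Rightarrow> 'a \<Rightarrow> real \<times> bool \<times> (real ^ 'd::finite)) \<Rightarrow>
     ('a \<Rightarrow> real \<times> bool \<times> (real ^ 'd)) \<Rightarrow> bool" where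
  "iid_copies M W W0 \<longleftrightarrow>
     prob_space.indep_vars M (\<lambda>_. obs_algebra) W UNIV \<and>
     (\<forall>i. distr M obs_algebra (W i) = distr M obs_algebra W0)"

text \<open>
  Data of \<open>n\<close> subjects: follow-up times \<open>t i\<close>, event indicators \<open>\<delta> i\<close> and covariates \<open>z i\<close>,
  for \<open>i < n\<close>.
\<close>

definition event_times :: "nat \<Rightarrow> (nat \<Rightarrow> real) \<Rightarrow> (nat \<Rightarrow> bool) \<Rightarrow> real set" where
  "event_times n t \<delta> = t ` {i. i < n \<and> \<delta> i}"

text \<open>Since \<open>X\<close> has a density given \<open>Z\<close>, the subject below is almost surely unique.\<close>

definition event_subject :: "nat \<Rightarrow> (nat \<Rightarrow> real) \<Rightarrow> (nat \<Rightarrow> bool) \<Rightarrow> real \<Rightarrow> nat" where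
  "event_subject n t \<delta> s = (THE i. i < n \<and> \<delta> i \<and> t i = s)"

definition partial_likelihood ::
    "nat \<Rightarrow> (nat \<Rightarrow> real) \<Rightarrow> (nat \<Rightarrow> bool) \<Rightarrow> (nat \<Rightarrow> (real ^ 'd::finite)) \<Rightarrow> real ^ 'd \<Rightarrow> real" where
  "partial_likelihood n t \<delta> z \<beta> =
     (\<Prod>s\<in>event_times n t \<delta>. exp (\<beta> \<bullet> z (event_subject n t \<delta> s))
        / (\<Sum>j<n. of_bool (s \<le> t j) * exp (\<beta> \<bullet> z j)))"

definition is_maximizer :: "('b \<Rightarrow> real) \<Rightarrow> 'b \<Rightarrow> bool" where
  "is_maximizer L b \<longleftrightarrow> (\<forall>b'. L b' \<le> L b)"

text \<open>
  A measurable version of the maximum partial likelihood estimator based on the first \<open>n\<close>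
  observations, with arbitrary values where no maximizer exists.
\<close>

definition max_partial_likelihood_estimator ::
    "'a measure \<Rightarrow> nat \<Rightarrow> (nat \<Rightarrow> 'a \<Rightarrow> real) \<Rightarrow> (nat \<Rightarrow> 'a \<Rightarrow> bool) \<Rightarrow> (nat \<Rightarrow> 'a \<Rightarrow> (real ^ 'd::finite)) \<Rightarrow>
     ('a \<Rightarrow> real ^ 'd) \<Rightarrow> bool" where
  "max_partial_likelihood_estimator M n T \<Delta> Z b \<longleftrightarrow>
     b \<in> borel_measurable M \<and>
     (\<forall>\<omega>\<in>space M.
        let L = partial_likelihood n (\<lambda>i. T i \<omega>) (\<lambda>i. \<Delta> i \<omega>) (\<lambda>i. Z i \<omega>)
        in (\<exists>\<beta>. is_maximizer L \<beta>) \<longrightarrow> is_maximizer L (b \<omega>))"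

definition Phi_n ::
    "nat \<Rightarrow> (nat \<Rightarrow> real) \<Rightarrow> (nat \<Rightarrow> (real ^ 'd::finite)) \<Rightarrow> real \<Rightarrow> real ^ 'd \<Rightarrow> real" where
  "Phi_n n t z s \<beta> = (1 / real n) * (\<Sum>i<n. of_bool (s \<le> t i) * exp (\<beta> \<bullet> z i))"

definition breslow ::
    "nat \<Rightarrow> (nat \<Rightarrow> real) \<Rightarrow> (nat \<Rightarrow> bool) \<Rightarrow> (nat \<Rightarrow> (real ^ 'd::finite)) \<Rightarrow> real ^ 'd \<Rightarrow> real \<Rightarrow> real" where
  "breslow n t \<delta> z b s =
     (1 / real n) * (\<Sum>i<n. of_bool (\<delta> i) * of_bool (t i \<le> s) / Phi_n n t z (t i) b)"

definition outer :: "real ^ 'd \<Rightarrow> real ^ 'd \<Rightarrow> real ^ 'd ^ 'd::finite" where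
  "outer v w = (\<chi> i j. v $ i * w $ j)"

definition positive_definite :: "real ^ 'd ^ 'd::finite \<Rightarrow> bool" where
  "positive_definite A \<longleftrightarrow> transpose A = A \<and> (\<forall>v. v \<noteq> 0 \<longrightarrow> 0 < v \<bullet> (A *v v))"

definition Phi :: "'a measure \<Rightarrow> ('a \<Rightarrow> real) \<Rightarrow> ('a \<Rightarrow> (real ^ 'd::finite)) \<Rightarrow> real ^ 'd \<Rightarrow> real \<Rightarrow> real" where
  "Phi M T Z \<beta> u = (\<integral>\<omega>. of_bool (u \<le> T \<omega>) * exp (\<beta> \<bullet> Z \<omega>) \<partial>M)"

definition D1 ::
    "'a measure \<Rightarrow> ('a \<Rightarrow> real) \<Rightarrow> ('a \<Rightarrow> (real ^ 'd::finite)) \<Rightarrow> real ^ 'd \<Rightarrow> real \<Rightarrow> real ^ 'd" where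
  "D1 M T Z \<beta> u = (\<integral>\<omega>. (of_bool (u \<le> T \<omega>) * exp (\<beta> \<bullet> Z \<omega>)) *\<^sub>R Z \<omega> \<partial>M)"

definition D2 ::
    "'a measure \<Rightarrow> ('a \<Rightarrow> real) \<Rightarrow> ('a \<Rightarrow> (real ^ 'd::finite)) \<Rightarrow> real ^ 'd \<Rightarrow> real \<Rightarrow> real ^ 'd ^ 'd" where
  "D2 M T Z \<beta> u = (\<integral>\<omega>. (of_bool (u \<le> T \<omega>) * exp (\<beta> \<bullet> Z \<omega>)) *\<^sub>R outer (Z \<omega>) (Z \<omega>) \<partial>M)"

definition information_matrix ::
    "'a measure \<Rightarrow> ('a \<Rightarrow> real) \<Rightarrow> ('a \<Rightarrow> (real ^ 'd::finite)) \<Rightarrow> (real \<Rightarrow> real) \<Rightarrow> real ^ 'd \<Rightarrow>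
     ereal \<Rightarrow> real ^ 'd ^ 'd" where
  "information_matrix M T Z h \<beta> \<tau> =
     (LBINT u:{u. 0 \<le> u \<and> ereal u \<le> \<tau>}. (Phi M T Z \<beta> u * h u) *\<^sub>R
        ((1 / Phi M T Z \<beta> u) *\<^sub>R D2 M T Z \<beta> u
         - (1 / (Phi M T Z \<beta> u)\<^sup>2) *\<^sub>R outer (D1 M T Z \<beta> u) (D1 M T Z \<beta> u)))"

end

theory Submission
  imports Defs
begin

text \<open>
The Breslow estimator differs from the cumulative baseline hazard by a fixed multiple of finitely
many deviations between empirical averages and their means, and each of these deviations has all
moments of order \<open>n powr (- 1/2)\<close>.  No martingale theory is involved: only the rate
matters, not the limit law.

The averages are of the form \<open>(1/n) * (\<Sum>i<n. of_bool (u \<le> \<kappa> (W i)) * h (W i))\<close>,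
taken uniformly in the threshold \<open>u\<close>.  Their moments are bounded in \<open>dev_moment\<close>:
symmetrization turns the centred sum into a sum with random signs, and for fixed data, ordered by
\<open>\<kappa>\<close>, the supremum over thresholds is a maximum of partial sums of independent signs,
controlled by a Doob inequality (\<open>sign_sum_doob\<close>) and a Khintchine inequality
(\<open>khintchine_even\<close>).

The maximum partial likelihood estimator is controlled on a good event, on which all the deviations
are small.  There the log partial likelihood is dominated near \<open>\<beta>\<^sub>0\<close> by a quadratic whose linear
part is the score and whose curvature is bounded below, because the observed information is close to
the positive definite limit; concavity along rays excludes maximizers further away.  Hence a
maximizer exists and its distance to \<open>\<beta>\<^sub>0\<close> is at most a constant times the norm of the score
(\<open>estimator_near_truth\<close>), and the score is again bounded by the deviations.

The model enters through one identity, \<open>observed_event_law\<close>: events occur with intensity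
\<open>lambda0 u * exp (\<beta>\<^sub>0 \<bullet> Z)\<close> among the subjects at risk, so
the expectation of \<open>\<Delta> * k (T, Z)\<close> is the integral over \<open>u\<close> of \<open>lambda0 u\<close> times the expectation of
\<open>of_bool (u \<le> T) * exp (\<beta>\<^sub>0 \<bullet> Z) * k (u, Z)\<close>.
With \<open>k\<close> equal to \<open>1/\<Phi>\<close> it gives the mean of the leading term of the estimator, with \<open>k\<close> the
covariate minus its weighted mean it shows that the score is centred, and with \<open>k\<close> the weighted
covariance it identifies the limit of the observed information with the information matrix.  It also
transfers moments: the weight \<open>exp (\<beta>\<^sub>0 \<bullet> Z)\<close> makes powers of \<open>Z\<close> integrable under the assumptions,
and subjects with an observed event carry this weight.  The atom of \<open>T\<close> at the end point of the
censoring distribution keeps the proportion at risk bounded away from zero, so that all quotients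
are stable up to the end point.
\<close>

section \<open>Maximal inequality for sums with random signs\<close>

text \<open>
The sum of \<open>F\<close> over all assignments of signs to the indices in \<open>I\<close>.  It stands for an expectation
over independent random signs, but leaves out the factor \<open>1 / 2 ^ card I\<close>, so that it makes sense in any
commutative monoid, in particular for values in \<^typ>\<open>ennreal\<close>.
\<close>

definition sign_sum :: "'i set \<Rightarrow> (('i \<Rightarrow> real) \<Rightarrow> 'b::comm_monoid_add) \<Rightarrow> 'b" where
  "sign_sum I F = (\<Sum>A\<in>Pow I. F (\<lambda>i. if i \<in> A then 1 else - 1))"

lemma sign_sum_empty: "sign_sum {} F = F (\<lambda>_. - 1)"
  by (simp add: sign_sum_def)

lemma sign_sum_insert:
  assumes "finite I" "x \<notin> I"
  shows "sign_sum (insert x I) F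
    = sign_sum I (\<lambda>s. F (s(x := 1))) + sign_sum I (\<lambda>s. F (s(x := - 1)))"
proof -
  let ?s = "\<lambda>A i. if i \<in> A then 1 else - 1 :: real"
  have plus: "?s (insert x A) = (?s A)(x := 1)" for A
    by auto
  have minus: "?s A = (?s A)(x := - 1)" if "A \<in> Pow I" for A
    using that assms by (auto simp: fun_eq_iff)
  have "sign_sum (insert x I) F
      = (\<Sum>A\<in>Pow I. F (?s A)) + (\<Sum>A\<in>insert x ` Pow I. F (?s A))"
    unfolding sign_sum_def Pow_insert
    using assms by (intro sum.union_disjoint) auto
  also have "(\<Sum>A\<in>insert x ` Pow I. F (?s A)) = (\<Sum>A\<in>Pow I. F (?s (insert x A)))"
  proof -
    have "inj_on (insert x) (Pow I)"
      using assms by (intro inj_onI) (auto dest!: insert_ident[THEN iffD1, rotated 2])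
    then show ?thesis
      by (simp add: sum.reindex)
  qed
  also have "\<dots> = sign_sum I (\<lambda>s. F (s(x := 1)))"
    unfolding sign_sum_def plus ..
  also have "(\<Sum>A\<in>Pow I. F (?s A)) = sign_sum I (\<lambda>s. F (s(x := - 1)))"
    unfolding sign_sum_def using minus by (intro sum.cong refl) metis
  finally show ?thesis
    by (subst add.commute)
qed

lemma sign_sum_mono:
  fixes F G :: "('i \<Rightarrow> real) \<Rightarrow> 'b::ordered_comm_monoid_add"
  assumes "\<And>s. F s \<le> G s"
  shows "sign_sum I F \<le> sign_sum I G"
  unfolding sign_sum_def by (intro sum_mono assms)

lemma sign_sum_add: "sign_sum I (\<lambda>s. F s + G s) = sign_sum I F + sign_sum I G"
  by (simp add: sign_sum_def sum.distrib)

lemma sign_sum_cmult: "sign_sum I (\<lambda>s. c * F s) = c * sign_sum I F" for c :: "'b::semiring_0"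
  by (simp add: sign_sum_def sum_distrib_left)

lemma power_fact_ge: "2 ^ k * fact k \<le> (fact (2 * k) :: real)"
proof (induction k)
  case (Suc k)
  have "2 ^ Suc k * fact (Suc k) = (2 * (real k + 1)) * (2 ^ k * fact k)"
    by (simp add: algebra_simps)
  also have "\<dots> \<le> (2 * (real k + 1)) * fact (2 * k)"
    by (intro mult_left_mono Suc) auto
  also have "\<dots> \<le> (2 * (real k + 1)) * ((2 * real k + 1) * fact (2 * k))"
    by (intro mult_left_mono) (auto simp: mult_le_cancel_right1)
  also have "\<dots> = fact (2 * Suc k)"
    by (simp add: algebra_simps)
  finally show ?case .
qed simp

text \<open>Comparison of the power series of \<open>cosh\<close> and \<open>exp\<close>, term by term.\<close>
lemma exp_add_exp_minus_le: "exp y + exp (- y) \<le> 2 * exp (y\<^sup>2 / 2)" for y :: real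
proof -
  have "(\<lambda>k. if even k then y ^ k /\<^sub>R fact k else 0) sums cosh y"
    by (rule cosh_converges)
  then have A: "(\<lambda>k. y ^ (2 * k) /\<^sub>R fact (2 * k)) sums cosh y"
    by (subst (asm) sums_mono_reindex[of "\<lambda>k. 2 * k", symmetric])
       (auto simp: strict_mono_def elim!: evenE)
  have B: "(\<lambda>k. (y\<^sup>2 / 2) ^ k /\<^sub>R fact k) sums exp (y\<^sup>2 / 2)"
    by (rule exp_converges)
  have "cosh y \<le> exp (y\<^sup>2 / 2)"
  proof (rule sums_le[OF _ A B])
    fix k
    have "y ^ (2 * k) / fact (2 * k) \<le> y ^ (2 * k) / (2 ^ k * fact k)"
      by (intro divide_left_mono power_fact_ge) auto
    also have "\<dots> = (y\<^sup>2 / 2) ^ k / fact k"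
      by (simp add: power_divide power_mult)
    finally show "y ^ (2 * k) /\<^sub>R fact (2 * k) \<le> (y\<^sup>2 / 2) ^ k /\<^sub>R fact k"
      by (simp only: real_scaleR_def divide_inverse_commute)
  qed
  then show ?thesis
    by (simp add: cosh_def)
qed

lemma sign_sum_exp_le:
  assumes "finite I"
  shows "sign_sum I (\<lambda>s. exp (t + (\<Sum>i\<in>I. s i * y i))) \<le> 2 ^ card I * exp (t + (\<Sum>i\<in>I. (y i)\<^sup>2) / 2 :: real)"
  using assms
proof (induction I arbitrary: t)
  case empty
  then show ?case by (simp add: sign_sum_empty)
next
  case (insert x I)
  have upd: "(\<Sum>i\<in>insert x I. (s(x := b)) i * y i) = b * y x + (\<Sum>i\<in>I. s i * y i)" for s b
    using insert.hyps by (auto intro!: sum.cong)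
  let ?V = "\<Sum>i\<in>I. (y i)\<^sup>2"
  have "sign_sum (insert x I) (\<lambda>s. exp (t + (\<Sum>i\<in>insert x I. s i * y i)))
      = sign_sum I (\<lambda>s. exp ((t + y x) + (\<Sum>i\<in>I. s i * y i)))
        + sign_sum I (\<lambda>s. exp ((t - y x) + (\<Sum>i\<in>I. s i * y i)))"
    unfolding sign_sum_insert[OF insert.hyps(1,2)] upd by (simp add: algebra_simps)
  also have "\<dots> \<le> 2 ^ card I * exp ((t + y x) + ?V / 2) + 2 ^ card I * exp ((t - y x) + ?V / 2)"
    by (intro add_mono insert.IH)
  also have "\<dots> = 2 ^ card I * exp (t + ?V / 2) * (exp (y x) + exp (- y x))"
  proof -
    have "exp (t + y x + ?V / 2) = exp (t + ?V / 2) * exp (y x)"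
      "exp (t - y x + ?V / 2) = exp (t + ?V / 2) * exp (- y x)"
      by (simp_all add: exp_add[symmetric])
    then show ?thesis
      by (simp only: distrib_left mult.assoc)
  qed
  also have "\<dots> \<le> 2 ^ card I * exp (t + ?V / 2) * (2 * exp ((y x)\<^sup>2 / 2))"
    by (intro mult_left_mono exp_add_exp_minus_le) auto
  also have "\<dots> = 2 ^ card (insert x I) * exp (t + (\<Sum>i\<in>insert x I. (y i)\<^sup>2) / 2)"
    using insert.hyps by (simp add: exp_add add_divide_distrib)
  finally show ?case .
qed

lemma power_even_le_exp: "x ^ (2 * m) \<le> fact (2 * m) * (exp x + exp (- x))" for x :: real
proof -
  have pos: "z ^ (2 * m) \<le> fact (2 * m) * exp z" if "0 \<le> z" for z :: real
  proof -
    have "z ^ (2 * m) /\<^sub>R fact (2 * m) \<le> exp z"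
      unfolding exp_def using that summable_exp_generic[of z]
      by (intro sum_le_suminf[of _ "{2 * m}", simplified]) auto
    then show ?thesis
      by (simp add: field_simps)
  qed
  show ?thesis
  proof (cases "0 \<le> x")
    case True
    have "fact (2 * m) * exp x \<le> fact (2 * m) * (exp x + exp (- x))"
      by (intro mult_left_mono) auto
    with pos[OF True] show ?thesis by linarith
  next
    case False
    have "fact (2 * m) * exp (- x) \<le> fact (2 * m) * (exp x + exp (- x))"
      by (intro mult_left_mono) auto
    with pos[of "- x", simplified] False show ?thesis by linarith
  qed
qed

text \<open>Even moments are bounded by exponential moments, and a sum of squares equal to 1 makes the
exponential moment at most \<open>exp (1/2)\<close>; the general case follows by homogeneity.\<close>
lemma khintchine_even:
  fixes y :: "'i \<Rightarrow> real"
  assumes "finite I"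
  shows "sign_sum I (\<lambda>s. (\<Sum>i\<in>I. s i * y i) ^ (2 * m))
    \<le> 2 ^ card I * (2 * fact (2 * m) * exp (1 / 2) * (\<Sum>i\<in>I. (y i)\<^sup>2) ^ m)"
proof -
  let ?V = "\<Sum>i\<in>I. (y i)\<^sup>2"
  have normalised: "sign_sum I (\<lambda>s. (\<Sum>i\<in>I. s i * z i) ^ (2 * m))
      \<le> 2 ^ card I * (2 * fact (2 * m) * exp (1 / 2))" if "(\<Sum>i\<in>I. (z i)\<^sup>2) \<le> 1" for z :: "'i \<Rightarrow> real"
  proof -
    have "sign_sum I (\<lambda>s. (\<Sum>i\<in>I. s i * z i) ^ (2 * m))
        \<le> sign_sum I (\<lambda>s. fact (2 * m) * (exp (0 + (\<Sum>i\<in>I. s i * z i)) + exp (0 + (\<Sum>i\<in>I. s i * (- z i)))))"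
      by (intro sign_sum_mono order_trans[OF power_even_le_exp]) (simp add: sum_negf)
    also have "\<dots> = fact (2 * m) * (sign_sum I (\<lambda>s. exp (0 + (\<Sum>i\<in>I. s i * z i)))
        + sign_sum I (\<lambda>s. exp (0 + (\<Sum>i\<in>I. s i * (- z i)))))"
      unfolding sign_sum_cmult sign_sum_add ..
    also have "\<dots> \<le> fact (2 * m) * (2 ^ card I * exp (0 + (\<Sum>i\<in>I. (z i)\<^sup>2) / 2)
        + 2 ^ card I * exp (0 + (\<Sum>i\<in>I. (- z i)\<^sup>2) / 2))"
      by (intro mult_left_mono add_mono sign_sum_exp_le assms) auto
    also have "\<dots> = 2 ^ card I * (2 * fact (2 * m) * exp ((\<Sum>i\<in>I. (z i)\<^sup>2) / 2))"
      by simp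
    also have "\<dots> \<le> 2 ^ card I * (2 * fact (2 * m) * exp (1 / 2))"
      using that by (intro mult_left_mono) auto
    finally show ?thesis .
  qed
  show ?thesis
  proof (cases "?V = 0")
    case True
    then have zero: "y i = 0" if "i \<in> I" for i
      using that assms by (simp add: sum_nonneg_eq_0_iff)
    then have S: "(\<Sum>i\<in>I. s i * y i) = 0" for s
      by (simp add: sum.neutral)
    show ?thesis
      using normalised[of y] zero True unfolding S
      by (cases m) (auto simp: sign_sum_def)
  next
    case False
    then have V: "0 < ?V"
      by (simp add: sum_nonneg order_less_le)
    define z where "z i = y i / sqrt ?V" for i
    have "(\<Sum>i\<in>I. (z i)\<^sup>2) = ?V / ?V"
      using V by (simp add: z_def power_divide sum_divide_distrib[symmetric] sum_nonneg)
    then have z1: "(\<Sum>i\<in>I. (z i)\<^sup>2) \<le> 1"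
      using V by simp
    have "(\<Sum>i\<in>I. s i * y i) = sqrt ?V * (\<Sum>i\<in>I. s i * z i)" for s
      using V by (simp add: z_def sum_distrib_left)
    then have S: "(\<Sum>i\<in>I. s i * y i) ^ (2 * m) = ?V ^ m * (\<Sum>i\<in>I. s i * z i) ^ (2 * m)" for s
      using V by (simp only: power_mult_distrib power_mult) simp
    show ?thesis
      unfolding S sign_sum_cmult
      using mult_left_mono[OF normalised[OF z1], of "?V ^ m"] V
      by (simp add: mult_ac)
  qed
qed

lemma convex_on_power_nonneg: "convex_on {0::real..} (\<lambda>x. x ^ m)"
  using convex_power_odd[of m] convex_on_subset[OF convex_power_even[of m], of "{0..}"]
  by (cases "even m") auto

lemma abs_power_midpoint: "2 * \<bar>a\<bar> ^ m \<le> \<bar>a + y\<bar> ^ m + \<bar>a - y\<bar> ^ m" for a y :: real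
proof -

  have "\<bar>a\<bar> \<le> (\<bar>a + y\<bar> + \<bar>a - y\<bar>) / 2"
    using abs_triangle_ineq[of "a + y" "a - y"] by simp
  then have "\<bar>a\<bar> ^ m \<le> ((\<bar>a + y\<bar> + \<bar>a - y\<bar>) / 2) ^ m"
    by (intro power_mono) auto
  also have "\<dots> \<le> (\<bar>a + y\<bar> ^ m + \<bar>a - y\<bar> ^ m) / 2"
    using convex_onD[OF convex_on_power_nonneg, of "1 / 2" "\<bar>a + y\<bar>" "\<bar>a - y\<bar>"]
    by (simp add: add_divide_distrib)
  finally show ?thesis by simp
qed

text \<open>A version of Doob's \<open>L\<^sup>2\<close> maximal inequality, applied to the submartingale formed by the \<open>m\<close>-th powers
of the absolute values of the partial sums, with the indices ordered by decreasing \<open>T\<close>.  The numbers \<open>a\<close> and \<open>B\<close> stand for a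
partial sum and a running maximum from which the walk continues.  The induction works because, with
\<open>X = \<bar>a\<bar> ^ m\<close>, the function \<open>2 * (B\<^sup>2 - 2 * B * X)\<close> dominates \<open>B\<^sup>2 - 4 * X\<^sup>2\<close> and does not increase on
average in one step: it is decreasing in \<open>X\<close>, which grows on average by convexity, and updating the
maximum \<open>B\<close> to \<open>max B X\<close> can only decrease it, by \<open>2 * (B - X)\<^sup>2\<close>.  An arbitrary
selector \<open>N\<close> takes the place of the maximum, which avoids describing its range.\<close>
lemma sign_sum_doob:
  fixes y T :: "'i \<Rightarrow> real" and N :: "('i \<Rightarrow> real) \<Rightarrow> real"
  assumes "finite I" "\<bar>a\<bar> ^ m \<le> B" "\<And>s. 0 \<le> N s"
    and "\<And>s. N s \<le> B \<or> (\<exists>u. N s \<le> \<bar>a + (\<Sum>i\<in>{i\<in>I. u \<le> T i}. s i * y i)\<bar> ^ m)"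
  shows "sign_sum I (\<lambda>s. (N s)\<^sup>2)
    \<le> sign_sum I (\<lambda>s. 4 * (\<bar>a + (\<Sum>i\<in>I. s i * y i)\<bar> ^ m)\<^sup>2 + 2 * (B\<^sup>2 - 2 * B * \<bar>a\<bar> ^ m))"
  using assms
proof (induction I arbitrary: a B N rule: finite_ranking_induct[where f = T])
  case empty
  have "(N s)\<^sup>2 \<le> B\<^sup>2" for s
    using empty(1,2) empty(3)[of s] by (intro power_mono) auto
  moreover have "B\<^sup>2 \<le> 4 * (\<bar>a\<bar> ^ m)\<^sup>2 + 2 * (B\<^sup>2 - 2 * B * \<bar>a\<bar> ^ m)"
    using zero_le_power2[of "B - 2 * \<bar>a\<bar> ^ m"] by (simp add: power2_eq_square algebra_simps)
  ultimately show ?case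
    unfolding sign_sum_empty sum.empty add_0_right by (rule order_trans)
next
  case (insert x J)
  show ?case
  proof (cases "x \<in> J")
    case True
    then show ?thesis
      using insert.IH[of a B N] insert.prems by (simp add: insert_absorb)
  next
    case False
    define A where "A b = a + b * y x" for b
    define B' where "B' b = max B (\<bar>A b\<bar> ^ m)" for b
    have B0: "0 \<le> B"
      using insert.prems(1) by (rule order_trans[rotated]) simp
    have upd: "(\<Sum>i\<in>insert x J. (s(x := b)) i * y i) = b * y x + (\<Sum>i\<in>J. s i * y i)" for s b
      using insert.hyps False by (auto intro!: sum.cong)
    have branch: "sign_sum J (\<lambda>s. (N (s(x := b)))\<^sup>2)
        \<le> sign_sum J (\<lambda>s. 4 * (\<bar>A b + (\<Sum>i\<in>J. s i * y i)\<bar> ^ m)\<^sup>2 + 2 * (B\<^sup>2 - 2 * B * \<bar>A b\<bar> ^ m))" for b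
    proof -
      have "sign_sum J (\<lambda>s. (N (s(x := b)))\<^sup>2)
          \<le> sign_sum J (\<lambda>s. 4 * (\<bar>A b + (\<Sum>i\<in>J. s i * y i)\<bar> ^ m)\<^sup>2
              + 2 * ((B' b)\<^sup>2 - 2 * B' b * \<bar>A b\<bar> ^ m))"
      proof (rule insert.IH)
        fix s
        let ?s = "s(x := b)"
        show "N ?s \<le> B' b \<or> (\<exists>u. N ?s \<le> \<bar>A b + (\<Sum>i\<in>{i\<in>J. u \<le> T i}. s i * y i)\<bar> ^ m)"
        proof (cases "N ?s \<le> B")
          case True
          then show ?thesis by (simp add: B'_def le_max_iff_disj)
        next
          case F: False
          then obtain u where u: "N ?s \<le> \<bar>a + (\<Sum>i\<in>{i\<in>insert x J. u \<le> T i}. ?s i * y i)\<bar> ^ m"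
            using insert.prems(3)[of ?s] by blast
          show ?thesis
          proof (cases "u \<le> T x")
            case True
            then have "{i\<in>insert x J. u \<le> T i} = insert x {i\<in>J. u \<le> T i}"
              by auto
            then have "(\<Sum>i\<in>{i\<in>insert x J. u \<le> T i}. ?s i * y i) = b * y x + (\<Sum>i\<in>{i\<in>J. u \<le> T i}. s i * y i)"
              using insert.hyps False by (auto intro!: sum.cong)
            with u have "N ?s \<le> \<bar>A b + (\<Sum>i\<in>{i\<in>J. u \<le> T i}. s i * y i)\<bar> ^ m"
              by (simp add: A_def add.assoc)
            then show ?thesis by blast
          next
            case False
            then have "{i\<in>insert x J. u \<le> T i} = {}"
              using insert.hyps(2) by force
            with u have "N ?s \<le> \<bar>a\<bar> ^ m"
              by (simp only: sum.empty add_0_right)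
            with insert.prems(1) F show ?thesis by linarith
          qed
        qed
      qed (use insert.prems in \<open>auto simp: B'_def\<close>)
      also have "\<dots> \<le> sign_sum J (\<lambda>s. 4 * (\<bar>A b + (\<Sum>i\<in>J. s i * y i)\<bar> ^ m)\<^sup>2 + 2 * (B\<^sup>2 - 2 * B * \<bar>A b\<bar> ^ m))"
        using zero_le_power2[of "B - \<bar>A b\<bar> ^ m"]
        by (intro sign_sum_mono add_left_mono mult_left_mono)
           (auto simp: B'_def max_def power2_eq_square algebra_simps)
      finally show ?thesis .
    qed
    have convex: "2 * \<bar>a\<bar> ^ m \<le> \<bar>A 1\<bar> ^ m + \<bar>A (- 1)\<bar> ^ m"
      using abs_power_midpoint[of a m "y x"] by (simp add: A_def)
    have "sign_sum (insert x J) (\<lambda>s. (N s)\<^sup>2)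
        = sign_sum J (\<lambda>s. (N (s(x := 1)))\<^sup>2) + sign_sum J (\<lambda>s. (N (s(x := - 1)))\<^sup>2)"
      using insert.hyps False by (simp add: sign_sum_insert)
    also have "\<dots> \<le> sign_sum J (\<lambda>s. (4 * (\<bar>A 1 + (\<Sum>i\<in>J. s i * y i)\<bar> ^ m)\<^sup>2 + 2 * (B\<^sup>2 - 2 * B * \<bar>A 1\<bar> ^ m))
         + (4 * (\<bar>A (- 1) + (\<Sum>i\<in>J. s i * y i)\<bar> ^ m)\<^sup>2 + 2 * (B\<^sup>2 - 2 * B * \<bar>A (- 1)\<bar> ^ m)))"
      using add_mono[OF branch[of 1] branch[of "- 1"]] by (simp only: sign_sum_add)
    also have "\<dots> \<le> sign_sum J (\<lambda>s. (4 * (\<bar>A 1 + (\<Sum>i\<in>J. s i * y i)\<bar> ^ m)\<^sup>2 + 2 * (B\<^sup>2 - 2 * B * \<bar>a\<bar> ^ m))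
         + (4 * (\<bar>A (- 1) + (\<Sum>i\<in>J. s i * y i)\<bar> ^ m)\<^sup>2 + 2 * (B\<^sup>2 - 2 * B * \<bar>a\<bar> ^ m)))"
      using mult_left_mono[OF convex B0]
      by (intro sign_sum_mono) (simp add: algebra_simps)
    also have "\<dots> = sign_sum (insert x J) (\<lambda>s. 4 * (\<bar>a + (\<Sum>i\<in>insert x J. s i * y i)\<bar> ^ m)\<^sup>2
         + 2 * (B\<^sup>2 - 2 * B * \<bar>a\<bar> ^ m))"
      unfolding sign_sum_insert[OF insert.hyps(1) False] upd sign_sum_add
      by (simp add: A_def algebra_simps)
    finally show ?thesis .
  qed
qed

text \<open>For each choice of signs only finitely many thresholds give different sums, so the supremum is
attained and the selector form of the maximal inequality applies.\<close>
lemma sign_sum_maximal: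
  fixes y T :: "'i \<Rightarrow> real"
  assumes "finite I"
  shows "sign_sum I (\<lambda>s. SUP u\<in>U. ennreal (\<bar>\<Sum>i\<in>{i\<in>I. u \<le> T i}. s i * y i\<bar> ^ (2 * m)))
    \<le> ennreal (2 ^ card I * (8 * fact (2 * m) * exp (1 / 2) * (\<Sum>i\<in>I. (y i)\<^sup>2) ^ m))"
proof -
  define f where "f s u = \<bar>\<Sum>i\<in>{i\<in>I. u \<le> T i}. s i * y i\<bar> ^ m" for s u
  define N where "N s = Max (range (f s))" for s
  have "finite (range (f s))" for s
  proof -
    have "range (f s) \<subseteq> (\<lambda>A. \<bar>\<Sum>i\<in>A. s i * y i\<bar> ^ m) ` Pow I"
      by (auto simp: f_def)
    then show ?thesis
      using assms by (meson finite_Pow_iff finite_imageI finite_subset)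
  qed
  then have N: "f s u \<le> N s" "N s \<in> range (f s)" for s u
    unfolding N_def by (auto intro!: Max_ge Max_in)
  have f0: "0 \<le> f s u" for s u
    by (simp add: f_def)
  have "sign_sum I (\<lambda>s. SUP u\<in>U. ennreal (\<bar>\<Sum>i\<in>{i\<in>I. u \<le> T i}. s i * y i\<bar> ^ (2 * m)))
      \<le> sign_sum I (\<lambda>s. ennreal ((N s)\<^sup>2))"
  proof (intro sign_sum_mono SUP_least ennreal_leI)
    fix s u
    have "\<bar>\<Sum>i\<in>{i\<in>I. u \<le> T i}. s i * y i\<bar> ^ (2 * m) = (f s u)\<^sup>2"
      by (simp add: f_def power_mult[symmetric] mult.commute)
    then show "\<bar>\<Sum>i\<in>{i\<in>I. u \<le> T i}. s i * y i\<bar> ^ (2 * m) \<le> (N s)\<^sup>2"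
      using N(1)[of s u] f0[of s u] by (simp add: power_mono)
  qed
  also have "\<dots> = ennreal (sign_sum I (\<lambda>s. (N s)\<^sup>2))"
    by (simp add: sign_sum_def)
  also have "sign_sum I (\<lambda>s. (N s)\<^sup>2)
      \<le> sign_sum I (\<lambda>s. 4 * (\<bar>0 + (\<Sum>i\<in>I. s i * y i)\<bar> ^ m)\<^sup>2 + 2 * ((0 ^ m)\<^sup>2 - 2 * 0 ^ m * \<bar>0\<bar> ^ m))"
  proof (rule sign_sum_doob[where T = T])
    fix s
    show "0 \<le> N s"
      using f0[of s] N(1)[of s] order_trans by blast
    obtain u where "N s = f s u"
      using N(2)[of s] by auto
    then show "N s \<le> 0 ^ m \<or> (\<exists>u. N s \<le> \<bar>0 + (\<Sum>i\<in>{i\<in>I. u \<le> T i}. s i * y i)\<bar> ^ m)"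
      by (auto simp: f_def)
  qed (use assms in auto)
  also have "\<dots> \<le> sign_sum I (\<lambda>s. 4 * (\<Sum>i\<in>I. s i * y i) ^ (2 * m))"
  proof (intro sign_sum_mono)
    fix s :: "'i \<Rightarrow> real"
    have "(\<bar>S\<bar> ^ m)\<^sup>2 = S ^ (2 * m)" for S :: real
      by (metis mult.commute power_abs power_even_abs power_mult even_two_times_div_two dvd_triv_left)
    moreover have "((0::real) ^ m)\<^sup>2 - 2 * 0 ^ m * \<bar>0\<bar> ^ m \<le> 0"
      by (cases m) auto
    ultimately show "4 * (\<bar>0 + (\<Sum>i\<in>I. s i * y i)\<bar> ^ m)\<^sup>2 + 2 * ((0 ^ m)\<^sup>2 - 2 * 0 ^ m * \<bar>0\<bar> ^ m)
        \<le> 4 * (\<Sum>i\<in>I. s i * y i) ^ (2 * m)"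
      by simp
  qed
  also have "\<dots> \<le> 4 * (2 ^ card I * (2 * fact (2 * m) * exp (1 / 2) * (\<Sum>i\<in>I. (y i)\<^sup>2) ^ m))"
    unfolding sign_sum_cmult by (intro mult_left_mono khintchine_even assms) auto
  finally show ?thesis
    by (simp add: ennreal_leI mult_ac)
qed

section \<open>Moments of weighted empirical tails\<close>

lemma sum_power_le:
  fixes x :: "'i \<Rightarrow> real"
  assumes "finite I" "\<And>i. i \<in> I \<Longrightarrow> 0 \<le> x i" "m \<ge> 1"
  shows "(\<Sum>i\<in>I. x i) ^ m \<le> real (card I) ^ (m - 1) * (\<Sum>i\<in>I. x i ^ m)"
proof (cases "I = {}")
  case True
  then show ?thesis using assms by (cases m) auto
next
  case False
  then have c: "0 < real (card I)"
    using assms(1) by (simp add: card_gt_0_iff)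
  have "(\<Sum>i\<in>I. (1 / card I) *\<^sub>R x i) ^ m \<le> (\<Sum>i\<in>I. (1 / card I) * x i ^ m)"
    using assms c False by (intro convex_on_sum[OF _ _ convex_on_power_nonneg]) auto
  then have "(\<Sum>i\<in>I. x i) ^ m / card I ^ m \<le> (\<Sum>i\<in>I. x i ^ m) / card I"
    by (simp add: sum_divide_distrib[symmetric] power_divide)
  moreover have "real (card I) ^ m = real (card I) ^ (m - 1) * card I"
    using assms(3) by (cases m) auto
  ultimately show ?thesis
    using c by (simp add: field_simps)
qed

context prob_space begin

lemma jensen_even_power:
  assumes "integrable M f" "even k"
  shows "ennreal (\<bar>expectation f\<bar> ^ k) \<le> (\<integral>\<^sup>+x. ennreal (\<bar>f x\<bar> ^ k) \<partial>M)"
proof (cases "(\<integral>\<^sup>+x. ennreal (\<bar>f x\<bar> ^ k) \<partial>M) = \<infinity>")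
  case False
  have [measurable]: "f \<in> borel_measurable M"
    using assms by auto
  have "integrable M (\<lambda>x. f x ^ k)"
    using False assms(2) by (intro integrableI_bounded) (auto simp: power_abs less_top)
  then have "expectation f ^ k \<le> expectation (\<lambda>x. f x ^ k)" 
    "(\<integral>\<^sup>+x. ennreal (f x ^ k) \<partial>M) = ennreal (expectation (\<lambda>x. f x ^ k))"
    using jensens_inequality[of f UNIV _ _ "\<lambda>x. x ^ k"] assms convex_power_even[of k]
    by (auto intro!: nn_integral_eq_integral)
  then show ?thesis
    using assms(2) by (simp add: power_even_abs ennreal_leI)
qed simp

text \<open>The argument \<open>a + g - E g\<close> is the midpoint of \<open>a + 2 * g\<close> and \<open>a - 2 * E g\<close>; convexity of the
even power separates the two, and Jensen's inequality moves the expectation in the second one outside.\<close>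

lemma centring_step:
  fixes g :: "real \<Rightarrow> 'a \<Rightarrow> real" and a :: "real \<Rightarrow> real"
  assumes "countable U" "\<And>u. integrable M (g u)" "even k"
  shows "2 * (\<integral>\<^sup>+w. (SUP u\<in>U. ennreal (\<bar>a u + (g u w - expectation (g u))\<bar> ^ k)) \<partial>M)
    \<le> (\<integral>\<^sup>+w. (SUP u\<in>U. ennreal (\<bar>a u + 2 * g u w\<bar> ^ k)) \<partial>M)
      + (\<integral>\<^sup>+w. (SUP u\<in>U. ennreal (\<bar>a u - 2 * g u w\<bar> ^ k)) \<partial>M)"
proof -
  have [measurable]: "g u \<in> borel_measurable M" for u
    using assms(2) by auto
  let ?c = "SUP u\<in>U. ennreal (\<bar>a u - 2 * expectation (g u)\<bar> ^ k)"
  have "2 * (SUP u\<in>U. ennreal (\<bar>a u + (g u w - expectation (g u))\<bar> ^ k))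
      \<le> (SUP u\<in>U. ennreal (\<bar>a u + 2 * g u w\<bar> ^ k)) + ?c" for w
    unfolding SUP_mult_left_ennreal
  proof (intro SUP_least)
    fix u assume u: "u \<in> U"
    have "2 * \<bar>a u + (g u w - expectation (g u))\<bar> ^ k
        \<le> \<bar>a u + 2 * g u w\<bar> ^ k + \<bar>a u - 2 * expectation (g u)\<bar> ^ k"
      using abs_power_midpoint[of "a u + (g u w - expectation (g u))" k "g u w + expectation (g u)"]
      by (simp add: algebra_simps)
    then have "2 * ennreal (\<bar>a u + (g u w - expectation (g u))\<bar> ^ k)
        \<le> ennreal (\<bar>a u + 2 * g u w\<bar> ^ k) + ennreal (\<bar>a u - 2 * expectation (g u)\<bar> ^ k)"
      by (metis abs_ge_zero ennreal_leI ennreal_mult ennreal_numeral ennreal_plus zero_le_numeral zero_le_power)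
    also have "\<dots> \<le> (SUP u\<in>U. ennreal (\<bar>a u + 2 * g u w\<bar> ^ k)) + ?c"
      using u by (intro add_mono SUP_upper)
    finally show "2 * ennreal (\<bar>a u + (g u w - expectation (g u))\<bar> ^ k)
        \<le> (SUP u\<in>U. ennreal (\<bar>a u + 2 * g u w\<bar> ^ k)) + ?c" .
  qed
  then have "(\<integral>\<^sup>+w. 2 * (SUP u\<in>U. ennreal (\<bar>a u + (g u w - expectation (g u))\<bar> ^ k)) \<partial>M)
      \<le> (\<integral>\<^sup>+w. (SUP u\<in>U. ennreal (\<bar>a u + 2 * g u w\<bar> ^ k)) + ?c \<partial>M)"
    by (intro nn_integral_mono)
  also have "\<dots> = (\<integral>\<^sup>+w. (SUP u\<in>U. ennreal (\<bar>a u + 2 * g u w\<bar> ^ k)) \<partial>M) + ?c"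
    using assms(1) by (subst nn_integral_add) (auto simp: emeasure_space_1)
  also have "\<dots> \<le> (\<integral>\<^sup>+w. (SUP u\<in>U. ennreal (\<bar>a u + 2 * g u w\<bar> ^ k)) \<partial>M)
      + (\<integral>\<^sup>+w. (SUP u\<in>U. ennreal (\<bar>a u - 2 * g u w\<bar> ^ k)) \<partial>M)"
  proof (intro add_left_mono SUP_least)
    fix u assume u: "u \<in> U"
    have i: "integrable M (\<lambda>w. a u - 2 * g u w)"
      using assms(2)[of u] by simp
    have e: "expectation (\<lambda>w. a u - 2 * g u w) = a u - 2 * expectation (g u)"
      using assms(2)[of u] by (simp add: prob_space)
    have "ennreal (\<bar>a u - 2 * expectation (g u)\<bar> ^ k)
        \<le> (\<integral>\<^sup>+w. ennreal (\<bar>a u - 2 * g u w\<bar> ^ k) \<partial>M)"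
      using jensen_even_power[OF i assms(3)] unfolding e .
    also have "\<dots> \<le> (\<integral>\<^sup>+w. (SUP u\<in>U. ennreal (\<bar>a u - 2 * g u w\<bar> ^ k)) \<partial>M)"
      using u by (intro nn_integral_mono SUP_upper)
    finally show "ennreal (\<bar>a u - 2 * expectation (g u)\<bar> ^ k)
        \<le> (\<integral>\<^sup>+w. (SUP u\<in>U. ennreal (\<bar>a u - 2 * g u w\<bar> ^ k)) \<partial>M)" .
  qed
  finally show ?thesis
    using assms(1) by (subst (asm) nn_integral_cmult) auto
qed

end

text \<open>Each centred summand is exchanged in turn for a randomly signed one.  Quantifying over the starting
function \<open>a\<close> is what lets the induction absorb the summands already exchanged.\<close>
lemma symmetrization:
  fixes g :: "real \<Rightarrow> 'b \<Rightarrow> real" and a :: "real \<Rightarrow> real"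
  assumes "prob_space P" "countable U" "\<And>u. integrable P (g u)" "even k" "finite I"
  shows "2 ^ card I * (\<integral>\<^sup>+w. (SUP u\<in>U. ennreal (\<bar>a u + (\<Sum>i\<in>I. g u (w i) - (\<integral>x. g u x \<partial>P))\<bar> ^ k)) \<partial>Pi\<^sub>M I (\<lambda>_. P))
    \<le> sign_sum I (\<lambda>s. \<integral>\<^sup>+w. (SUP u\<in>U. ennreal (\<bar>a u + (\<Sum>i\<in>I. s i * (2 * g u (w i)))\<bar> ^ k)) \<partial>Pi\<^sub>M I (\<lambda>_. P))"
  using assms(5)
proof (induction I arbitrary: a)
  case empty
  then show ?case by (simp add: sign_sum_empty)
next
  case (insert x J)
  interpret P: prob_space P by fact
  interpret product_sigma_finite "\<lambda>_. P" by standard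
  have [measurable]: "g u \<in> borel_measurable P" for u
    using assms(3) by auto
  note [simp] = assms(2)
  define \<mu> where "\<mu> u = (\<integral>x. g u x \<partial>P)" for u
  let ?Psi = "\<lambda>b :: real \<Rightarrow> real. SUP u\<in>U. ennreal (\<bar>b u\<bar> ^ k)"
  have upd: "(\<Sum>i\<in>insert x J. g u ((w(x := y)) i) - \<mu> u) = (g u y - \<mu> u) + (\<Sum>i\<in>J. g u (w i) - \<mu> u)" for u w y
    using insert.hyps by (auto intro!: sum.cong)
  have upd2: "(\<Sum>i\<in>insert x J. (s(x := b)) i * (2 * g u ((w(x := y)) i))) = b * (2 * g u y) + (\<Sum>i\<in>J. s i * (2 * g u (w i)))" 
    for u w y s b
    using insert.hyps by (auto intro!: sum.cong)
  have [measurable]: "(\<lambda>w. g u (w i)) \<in> borel_measurable (Pi\<^sub>M (insert x J) (\<lambda>_. P))" if "i \<in> insert x J" for i u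
    using that by measurable
  have [measurable]: "(\<lambda>w. g u (w i)) \<in> borel_measurable (Pi\<^sub>M J (\<lambda>_. P))" if "i \<in> J" for i u
    using that by measurable
  interpret J: finite_product_sigma_finite "\<lambda>_. P" J
    by standard (use insert.hyps in auto)
  have outer: "(\<lambda>y. \<integral>\<^sup>+w. ?Psi (\<lambda>u. a u + (g u y - \<mu> u) + (\<Sum>i\<in>J. k i u (w i))) \<partial>Pi\<^sub>M J (\<lambda>_. P)) \<in> borel_measurable P"
    if [measurable]: "\<And>i u. k i u \<in> borel_measurable P" for k
  proof (rule J.borel_measurable_nn_integral)
    have "(\<lambda>p. k i u (snd p i)) \<in> borel_measurable (P \<Otimes>\<^sub>M Pi\<^sub>M J (\<lambda>_. P))" if "i \<in> J" for i u
      using that by measurable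
    then show "(\<lambda>(y, w). ?Psi (\<lambda>u. a u + (g u y - \<mu> u) + (\<Sum>i\<in>J. k i u (w i)))) \<in> borel_measurable (P \<Otimes>\<^sub>M Pi\<^sub>M J (\<lambda>_. P))"
      unfolding split_beta'
      by (intro borel_measurable_SUP measurable_ennreal borel_measurable_power borel_measurable_abs
        borel_measurable_add borel_measurable_diff borel_measurable_sum) auto
  qed
  have inner: "(\<lambda>w. \<integral>\<^sup>+y. ?Psi (\<lambda>u. d u (\<Sum>i\<in>J. s i * (2 * g u (w i))) y) \<partial>P) \<in> borel_measurable (Pi\<^sub>M J (\<lambda>_. P))"
    if [measurable]: "\<And>u. (\<lambda>(x, y). d u x y) \<in> borel_measurable (borel \<Otimes>\<^sub>M P)" for d s
  proof (rule P.borel_measurable_nn_integral)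
    have A: "(\<lambda>p. g u (fst p i)) \<in> borel_measurable (Pi\<^sub>M J (\<lambda>_. P) \<Otimes>\<^sub>M P)" if "i \<in> J" for i u
      using that by measurable
    have "(\<lambda>p. (\<Sum>i\<in>J. s i * (2 * g u (fst p i)))) \<in> borel_measurable (Pi\<^sub>M J (\<lambda>_. P) \<Otimes>\<^sub>M P)" for u
      using A by (intro borel_measurable_sum borel_measurable_times) auto
    then have [measurable]: "(\<lambda>p. d u (\<Sum>i\<in>J. s i * (2 * g u (fst p i))) (snd p)) \<in> borel_measurable (Pi\<^sub>M J (\<lambda>_. P) \<Otimes>\<^sub>M P)" for u
      by measurable
    show "(\<lambda>(w, y). ?Psi (\<lambda>u. d u (\<Sum>i\<in>J. s i * (2 * g u (w i))) y)) \<in> borel_measurable (Pi\<^sub>M J (\<lambda>_. P) \<Otimes>\<^sub>M P)"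
      unfolding split_beta' by measurable
  qed
  have m1: "(\<lambda>w. ?Psi (\<lambda>u. a u + (\<Sum>i\<in>insert x J. g u (w i) - \<mu> u))) \<in> borel_measurable (Pi\<^sub>M (insert x J) (\<lambda>_. P))"
    by (intro borel_measurable_SUP measurable_ennreal borel_measurable_power borel_measurable_abs
        borel_measurable_add borel_measurable_diff borel_measurable_sum borel_measurable_times) (auto)
  have m2: "(\<lambda>w. ?Psi (\<lambda>u. a u + (\<Sum>i\<in>insert x J. s i * (2 * g u (w i))))) \<in> borel_measurable (Pi\<^sub>M (insert x J) (\<lambda>_. P))" for s
    by (intro borel_measurable_SUP measurable_ennreal borel_measurable_power borel_measurable_abs
        borel_measurable_add borel_measurable_diff borel_measurable_sum borel_measurable_times) (auto)
  let ?G = "\<lambda>s w. ?Psi (\<lambda>u. a u + (g u (w x) - \<mu> u) + (\<Sum>i\<in>J. s i * (2 * g u (w i))))"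
  have m: "?G s \<in> borel_measurable (Pi\<^sub>M (insert x J) (\<lambda>_. P))" for s
    by (intro borel_measurable_SUP measurable_ennreal borel_measurable_power borel_measurable_abs
        borel_measurable_add borel_measurable_diff borel_measurable_sum borel_measurable_times) (auto)
  have G: "(\<integral>\<^sup>+y. (\<integral>\<^sup>+w. ?Psi (\<lambda>u. a u + (g u y - \<mu> u) + (\<Sum>i\<in>J. s i * (2 * g u (w i)))) \<partial>Pi\<^sub>M J (\<lambda>_. P)) \<partial>P)
      = (\<integral>\<^sup>+w. (\<integral>\<^sup>+y. ?Psi (\<lambda>u. a u + (g u y - \<mu> u) + (\<Sum>i\<in>J. s i * (2 * g u (w i)))) \<partial>P) \<partial>Pi\<^sub>M J (\<lambda>_. P))" for s
  proof -
    have e: "(\<Sum>i\<in>J. s i * (2 * g u ((w(x := y)) i))) = (\<Sum>i\<in>J. s i * (2 * g u (w i)))" for u w y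
      using insert.hyps by (auto intro!: sum.cong)
    show ?thesis
      using product_nn_integral_insert[OF insert.hyps(1,2) m[of s]] product_nn_integral_insert_rev[OF insert.hyps(1,2) m[of s]]
      by (simp add: e fun_upd_same del: fun_upd_apply)
  qed
  have "2 ^ card (insert x J) * (\<integral>\<^sup>+w. ?Psi (\<lambda>u. a u + (\<Sum>i\<in>insert x J. g u (w i) - \<mu> u)) \<partial>Pi\<^sub>M (insert x J) (\<lambda>_. P))
      = 2 ^ card (insert x J) * (\<integral>\<^sup>+y. (\<integral>\<^sup>+w. ?Psi (\<lambda>u. a u + (g u y - \<mu> u) + (\<Sum>i\<in>J. g u (w i) - \<mu> u)) \<partial>Pi\<^sub>M J (\<lambda>_. P)) \<partial>P)"
    using insert.hyps m1 by (subst product_nn_integral_insert_rev) (auto simp: upd add.assoc simp del: fun_upd_apply)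
  also have "\<dots> = 2 * (\<integral>\<^sup>+y. 2 ^ card J * (\<integral>\<^sup>+w. ?Psi (\<lambda>u. (a u + (g u y - \<mu> u)) + (\<Sum>i\<in>J. g u (w i) - \<mu> u)) \<partial>Pi\<^sub>M J (\<lambda>_. P)) \<partial>P)"
    using insert.hyps outer[of "\<lambda>i u w. g u w - \<mu> u"] by (subst nn_integral_cmult) (auto simp: mult.assoc)
  also have "\<dots> \<le> 2 * (\<integral>\<^sup>+y. sign_sum J (\<lambda>s. \<integral>\<^sup>+w. ?Psi (\<lambda>u. (a u + (g u y - \<mu> u)) + (\<Sum>i\<in>J. s i * (2 * g u (w i)))) \<partial>Pi\<^sub>M J (\<lambda>_. P)) \<partial>P)"
    unfolding \<mu>_def by (intro mult_left_mono nn_integral_mono insert.IH) auto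
  also have "\<dots> = sign_sum J (\<lambda>s. 2 * (\<integral>\<^sup>+y. (\<integral>\<^sup>+w. ?Psi (\<lambda>u. (a u + (g u y - \<mu> u)) + (\<Sum>i\<in>J. s i * (2 * g u (w i)))) \<partial>Pi\<^sub>M J (\<lambda>_. P)) \<partial>P))"
    unfolding sign_sum_def by (subst nn_integral_sum) (auto simp: sum_distrib_left intro!: outer)
  also have "\<dots> = sign_sum J (\<lambda>s. \<integral>\<^sup>+w. 2 * (\<integral>\<^sup>+y. ?Psi (\<lambda>u. (a u + (\<Sum>i\<in>J. s i * (2 * g u (w i)))) + (g u y - \<mu> u)) \<partial>P) \<partial>Pi\<^sub>M J (\<lambda>_. P))"
    unfolding G using inner[of "\<lambda>u x y. a u + x + (g u y - \<mu> u)"] by (subst nn_integral_cmult) (auto simp: ac_simps)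
  also have "\<dots> \<le> sign_sum J (\<lambda>s. \<integral>\<^sup>+w. (\<integral>\<^sup>+y. ?Psi (\<lambda>u. (a u + (\<Sum>i\<in>J. s i * (2 * g u (w i)))) + 2 * g u y) \<partial>P)
       + (\<integral>\<^sup>+y. ?Psi (\<lambda>u. (a u + (\<Sum>i\<in>J. s i * (2 * g u (w i)))) - 2 * g u y) \<partial>P) \<partial>Pi\<^sub>M J (\<lambda>_. P))"
    unfolding \<mu>_def using assms by (intro sign_sum_mono nn_integral_mono P.centring_step)
  also have "\<dots> = sign_sum J (\<lambda>s. (\<integral>\<^sup>+w. (\<integral>\<^sup>+y. ?Psi (\<lambda>u. a u + (1 * (2 * g u y) + (\<Sum>i\<in>J. s i * (2 * g u (w i))))) \<partial>P) \<partial>Pi\<^sub>M J (\<lambda>_. P))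
       + (\<integral>\<^sup>+w. (\<integral>\<^sup>+y. ?Psi (\<lambda>u. a u + (- 1 * (2 * g u y) + (\<Sum>i\<in>J. s i * (2 * g u (w i))))) \<partial>P) \<partial>Pi\<^sub>M J (\<lambda>_. P)))"
    using inner[of "\<lambda>u x y. a u + x + 2 * g u y"] inner[of "\<lambda>u x y. a u + x - 2 * g u y"]
    by (subst nn_integral_add) (auto simp: algebra_simps)
  also have "\<dots> = sign_sum (insert x J) (\<lambda>s. \<integral>\<^sup>+w. ?Psi (\<lambda>u. a u + (\<Sum>i\<in>insert x J. s i * (2 * g u (w i)))) \<partial>Pi\<^sub>M (insert x J) (\<lambda>_. P))"
    unfolding sign_sum_insert[OF insert.hyps(1,2)] sign_sum_add
    using insert.hyps m2 by (subst (1 2) product_nn_integral_insert) (auto simp: upd2 simp del: fun_upd_apply)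
  finally show ?case
    by (simp add: \<mu>_def)
qed

lemma borel_measurable_of_bool [measurable (raw)]:
  "Measurable.pred M Q \<Longrightarrow> (\<lambda>x. of_bool (Q x) :: real) \<in> borel_measurable M"
  unfolding of_bool_def by measurable

text \<open>Every observation has the law \<open>P\<close>; fixing the law instead of one representative variable keeps
the common distribution symbolic.\<close>
locale iid_sample = prob_space M for M :: "'a measure" +
  fixes W :: "nat \<Rightarrow> 'a \<Rightarrow> 'b" and P :: "'b measure"
  assumes prob_space_P: "prob_space P"
    and indep: "indep_vars (\<lambda>_. P) W UNIV"
    and distr: "\<And>i. distr M P (W i) = P"
begin

lemma W_measurable [measurable]: "W i \<in> measurable M P"
  using indep by (auto simp: indep_vars_def)

lemma integrable_W: "integrable P f \<Longrightarrow> integrable M (\<lambda>\<omega>. f (W i \<omega>))" for f :: "'b \<Rightarrow> real"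
  using integrable_distr[of "W i" M P f] by (simp add: distr)

lemma integral_W:
  fixes f :: "'b \<Rightarrow> real"
  assumes "f \<in> borel_measurable P"
  shows "expectation (\<lambda>\<omega>. f (W i \<omega>)) = (\<integral>w. f w \<partial>P)"
  using integral_distr[of "W i" M P f] assms by (simp add: distr)

lemma nn_integral_sample:
  assumes "n \<ge> 1" "f \<in> borel_measurable (Pi\<^sub>M {..<n} (\<lambda>_. P))"
  shows "(\<integral>\<^sup>+w. f w \<partial>Pi\<^sub>M {..<n} (\<lambda>_. P)) = (\<integral>\<^sup>+\<omega>. f (\<lambda>i\<in>{..<n}. W i \<omega>) \<partial>M)"
proof -
  have "indep_vars (\<lambda>_. P) W {..<n}"
    using indep by (rule indep_vars_subset) simp
  then have "distr M (Pi\<^sub>M {..<n} (\<lambda>_. P)) (\<lambda>\<omega>. \<lambda>i\<in>{..<n}. W i \<omega>) = Pi\<^sub>M {..<n} (\<lambda>_. P)"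
    using assms(1) by (subst (asm) indep_vars_iff_distr_eq_PiM) (auto simp: distr lessThan_empty_iff)
  then have "(\<integral>\<^sup>+w. f w \<partial>Pi\<^sub>M {..<n} (\<lambda>_. P))
      = (\<integral>\<^sup>+w. f w \<partial>distr M (Pi\<^sub>M {..<n} (\<lambda>_. P)) (\<lambda>\<omega>. \<lambda>i\<in>{..<n}. W i \<omega>))"
    by simp
  also have "\<dots> = (\<integral>\<^sup>+\<omega>. f (\<lambda>i\<in>{..<n}. W i \<omega>) \<partial>M)"
    using assms(2) by (intro nn_integral_distr) measurable
  finally show ?thesis .
qed

text \<open>The averages are weighted tails in a real key \<open>\<kappa>\<close>.  Plain averages are the case of a constant key, and
averages over small values of a variable are the case of its negative as key.\<close>
definition emp :: "('b \<Rightarrow> real) \<Rightarrow> ('b \<Rightarrow> real) \<Rightarrow> nat \<Rightarrow> real \<Rightarrow> 'a \<Rightarrow> real" where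
  "emp \<kappa> h n u \<omega> = (\<Sum>i<n. of_bool (u \<le> \<kappa> (W i \<omega>)) * h (W i \<omega>)) / real n"

definition tail :: "('b \<Rightarrow> real) \<Rightarrow> ('b \<Rightarrow> real) \<Rightarrow> real \<Rightarrow> real" where
  "tail \<kappa> h u = (\<integral>w. of_bool (u \<le> \<kappa> w) * h w \<partial>P)"

text \<open>The supremum is over rational thresholds, for measurability; by left continuity in the threshold it
bounds the deviation at every real threshold.\<close>
definition dev :: "('b \<Rightarrow> real) \<Rightarrow> ('b \<Rightarrow> real) \<Rightarrow> nat \<Rightarrow> 'a \<Rightarrow> real" where
  "dev \<kappa> h n \<omega> = (SUP u\<in>\<rat>. \<bar>emp \<kappa> h n u \<omega> - tail \<kappa> h u\<bar>)"

lemma abs_emp_le: "\<bar>emp \<kappa> h n u \<omega>\<bar> \<le> (\<Sum>i<n. \<bar>h (W i \<omega>)\<bar>) / real n"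
proof -
  have "\<bar>\<Sum>i<n. of_bool (u \<le> \<kappa> (W i \<omega>)) * h (W i \<omega>)\<bar> \<le> (\<Sum>i<n. \<bar>h (W i \<omega>)\<bar>)"
    by (rule order_trans[OF sum_abs]) (auto intro!: sum_mono)
  then show ?thesis
    unfolding emp_def by (simp add: divide_right_mono)
qed

lemma tail_integrable:
  fixes \<kappa> h :: "'b \<Rightarrow> real"
  assumes [measurable]: "\<kappa> \<in> borel_measurable P" and "integrable P h"
  shows "integrable P (\<lambda>w. of_bool (u \<le> \<kappa> w) * h w)"
proof -
  have [measurable]: "h \<in> borel_measurable P"
    using assms(2) by auto
  show ?thesis
    by (rule Bochner_Integration.integrable_bound[OF assms(2)]) auto
qed

lemma abs_tail_le:
  assumes "\<kappa> \<in> borel_measurable P" "integrable P h"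
  shows "\<bar>tail \<kappa> h u\<bar> \<le> (\<integral>w. \<bar>h w\<bar> \<partial>P)"
  unfolding tail_def
  by (rule order_trans[OF integral_abs_bound] integral_mono)+
     (use tail_integrable[OF assms] assms(2) in auto)

context
  fixes \<kappa> h :: "'b \<Rightarrow> real"
  assumes \<kappa>[measurable]: "\<kappa> \<in> borel_measurable P" and h: "integrable P h"
begin

lemma h_measurable: "h \<in> borel_measurable P"
  using h by auto

lemma dev_bdd: "bdd_above ((\<lambda>u. \<bar>emp \<kappa> h n u \<omega> - tail \<kappa> h u\<bar>) ` U)"
proof (intro bdd_aboveI2)
  fix u
  show "\<bar>emp \<kappa> h n u \<omega> - tail \<kappa> h u\<bar> \<le> (\<Sum>i<n. \<bar>h (W i \<omega>)\<bar>) / real n + (\<integral>w. \<bar>h w\<bar> \<partial>P)"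
    using abs_emp_le[of \<kappa> h n u \<omega>] abs_tail_le[OF \<kappa> h, of u] by linarith
qed

lemma dev_measurable[measurable]: "dev \<kappa> h n \<in> borel_measurable M"
  supply h_measurable [measurable]
  unfolding dev_def emp_def
  by (intro borel_measurable_cSUP dev_bdd[unfolded emp_def] countable_rat) measurable

text \<open>Approximating \<open>u\<close> strictly from below by rationals, the indicators of \<open>u \<le> \<kappa> w\<close> converge at every
\<open>w\<close>, including those with \<open>\<kappa> w = u\<close>.\<close>
lemma emp_dev: "\<bar>emp \<kappa> h n u \<omega> - tail \<kappa> h u\<bar> \<le> dev \<kappa> h n \<omega>"
proof -
  note h_measurable [measurable]
  have "\<exists>q\<in>\<rat>. u - 1 / Suc k < q \<and> q < u" for k
    by (intro Rats_dense_in_real) simp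
  then obtain q where q: "\<And>k. q k \<in> \<rat>" "\<And>k. u - 1 / Suc k < q k" "\<And>k. q k < u"
    by metis
  have qlim: "q \<longlonglongrightarrow> u"
  proof (rule tendsto_sandwich[of "\<lambda>k. u - 1 / Suc k" _ _ "\<lambda>_. u"])
    show "(\<lambda>k. u - 1 / real (Suc k)) \<longlonglongrightarrow> u"
      using tendsto_diff[OF tendsto_const[of u] LIMSEQ_inverse_real_of_nat] by (simp add: inverse_eq_divide)
  qed (use q in \<open>auto intro!: always_eventually less_imp_le\<close>)
  have ind: "(\<lambda>k. of_bool (q k \<le> x) :: real) \<longlonglongrightarrow> of_bool (u \<le> x)" for x
  proof (cases "u \<le> x")
    case True
    then have "q k \<le> x" for k
      using q(3)[of k] by linarith
    then show ?thesis using True by simp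
  next
    case False
    then have "eventually (\<lambda>k. x < q k) sequentially"
      using qlim by (intro order_tendstoD(1)) auto
    then have "eventually (\<lambda>k. of_bool (q k \<le> x) = (0::real)) sequentially"
      by eventually_elim auto
    then show ?thesis
      using False by (simp add: tendsto_eventually)
  qed
  have "(\<lambda>k. emp \<kappa> h n (q k) \<omega>) \<longlonglongrightarrow> emp \<kappa> h n u \<omega>"
    unfolding emp_def divide_inverse by (intro tendsto_intros ind)
  moreover have "(\<lambda>k. tail \<kappa> h (q k)) \<longlonglongrightarrow> tail \<kappa> h u"
    unfolding tail_def
  proof (rule integral_dominated_convergence[where w = "\<lambda>w. \<bar>h w\<bar>"])
    show "AE w in P. (\<lambda>k. of_bool (q k \<le> \<kappa> w) * h w) \<longlonglongrightarrow> of_bool (u \<le> \<kappa> w) * h w"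
      by (intro always_eventually allI tendsto_intros ind)
  qed (use h in auto)
  ultimately have "(\<lambda>k. \<bar>emp \<kappa> h n (q k) \<omega> - tail \<kappa> h (q k)\<bar>) \<longlonglongrightarrow> \<bar>emp \<kappa> h n u \<omega> - tail \<kappa> h u\<bar>"
    by (intro tendsto_intros)
  then show ?thesis
    by (rule LIMSEQ_le_const2) (use q(1) in \<open>auto simp: dev_def intro!: exI cSUP_upper dev_bdd\<close>)
qed

lemma dev_nonneg: "0 \<le> dev \<kappa> h n \<omega>"
  using emp_dev[of n 0 \<omega>] by linarith

lemma dev_power_le:
  assumes "k \<ge> 1"
  shows "ennreal (dev \<kappa> h n \<omega> ^ k) \<le> (SUP u\<in>\<rat>. ennreal (\<bar>emp \<kappa> h n u \<omega> - tail \<kappa> h u\<bar> ^ k))" (is "_ \<le> ?S")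
proof (cases ?S)
  case (real r)
  have "dev \<kappa> h n \<omega> \<le> root k r"
    unfolding dev_def
  proof (intro cSUP_least)
    fix u :: real assume "u \<in> \<rat>"
    then have "ennreal (\<bar>emp \<kappa> h n u \<omega> - tail \<kappa> h u\<bar> ^ k) \<le> ennreal r"
      unfolding real(2)[symmetric] by (intro SUP_upper)
    then have "\<bar>emp \<kappa> h n u \<omega> - tail \<kappa> h u\<bar> ^ k \<le> r"
      using real(1) by simp
    then have "root k (\<bar>emp \<kappa> h n u \<omega> - tail \<kappa> h u\<bar> ^ k) \<le> root k r"
      using assms by (intro real_root_le_mono) auto
    then show "\<bar>emp \<kappa> h n u \<omega> - tail \<kappa> h u\<bar> \<le> root k r"
      using assms by (simp add: real_root_power_cancel)
  qed auto
  then have "dev \<kappa> h n \<omega> ^ k \<le> root k r ^ k"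
    using dev_nonneg by (intro power_mono)
  also have "\<dots> = r"
    using assms real by simp
  finally show ?thesis
    unfolding real(2) by (rule ennreal_leI)
next
  case top
  then show ?thesis
    by (metis top_greatest)
qed

text \<open>After symmetrization the maximal inequality bounds the \<open>2 * m\<close>-th moment of the sum by the \<open>m\<close>-th power
of the sum of the \<open>n\<close> squares, hence by \<open>n ^ m\<close> times a \<open>2 * m\<close>-th moment of \<open>h\<close>.\<close>
lemma dev_moment:
  assumes m: "m \<ge> 1" and mom: "integrable P (\<lambda>w. h w ^ (2 * m))"
  shows "\<exists>C\<ge>0. \<forall>n\<ge>1. (\<integral>\<^sup>+\<omega>. ennreal (dev \<kappa> h n \<omega> ^ (2 * m)) \<partial>M) \<le> ennreal (C / real n ^ m)"
proof -
  note h_measurable [measurable]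
  define K :: real where "K = 8 * fact (2 * m) * exp (1 / 2)"
  define H where "H = (\<integral>w. h w ^ (2 * m) \<partial>P)"
  have H0: "0 \<le> H"
    unfolding H_def by (intro integral_nonneg_AE) auto
  define C where "C = 4 ^ m * K * H"
  have "(\<integral>\<^sup>+\<omega>. ennreal (dev \<kappa> h n \<omega> ^ (2 * m)) \<partial>M) \<le> ennreal (C / real n ^ m)" if n: "n \<ge> 1" for n
  proof -
    define g where "g u w = of_bool (u \<le> \<kappa> w) * h w" for u w
    have g: "integrable P (g u)" for u
      unfolding g_def by (rule tail_integrable[OF \<kappa> h])
    have [measurable]: "g u \<in> borel_measurable P" for u
      using g by auto
    have mc: "(\<lambda>w. g u (w i)) \<in> borel_measurable (Pi\<^sub>M {..<n} (\<lambda>_. P))" "(\<lambda>w. h (w i)) \<in> borel_measurable (Pi\<^sub>M {..<n} (\<lambda>_. P))"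
      if "i < n" for i u
      using measurable_compose[OF measurable_component_singleton[of i "{..<n}" "\<lambda>_. P"]] that by auto
    let ?c = "\<lambda>w. SUP u\<in>\<rat>. ennreal (\<bar>0 + (\<Sum>i<n. g u (w i) - (\<integral>x. g u x \<partial>P))\<bar> ^ (2 * m))"
    let ?r = "\<lambda>s w. SUP u\<in>\<rat>. ennreal (\<bar>0 + (\<Sum>i<n. s i * (2 * g u (w i)))\<bar> ^ (2 * m))"
    have meas: "?c \<in> borel_measurable (Pi\<^sub>M {..<n} (\<lambda>_. P))" "?r s \<in> borel_measurable (Pi\<^sub>M {..<n} (\<lambda>_. P))" for s
      using mc by (auto intro!: borel_measurable_SUP countable_rat measurable_ennreal borel_measurable_power borel_measurable_abs
        borel_measurable_add borel_measurable_diff borel_measurable_sum borel_measurable_times)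
    have "2 ^ n * (\<integral>\<^sup>+w. ?c w \<partial>Pi\<^sub>M {..<n} (\<lambda>_. P)) \<le> sign_sum {..<n} (\<lambda>s. \<integral>\<^sup>+w. ?r s w \<partial>Pi\<^sub>M {..<n} (\<lambda>_. P))"
      using symmetrization[OF prob_space_P countable_rat g, where k = "2 * m" and I = "{..<n}" and a = "\<lambda>_. 0"] by simp
    also have "\<dots> = (\<integral>\<^sup>+w. sign_sum {..<n} (\<lambda>s. ?r s w) \<partial>Pi\<^sub>M {..<n} (\<lambda>_. P))"
      unfolding sign_sum_def using meas(2) by (subst nn_integral_sum) auto
    also have "\<dots> \<le> (\<integral>\<^sup>+w. ennreal (4 ^ m * (2 ^ n * (K * (real n ^ (m - 1) * (\<Sum>i<n. h (w i) ^ (2 * m)))))) \<partial>Pi\<^sub>M {..<n} (\<lambda>_. P))"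
    proof (intro nn_integral_mono)
      fix w :: "nat \<Rightarrow> 'b"
      have r: "?r s w = ennreal (4 ^ m) * (SUP u\<in>\<rat>. ennreal (\<bar>\<Sum>i\<in>{i\<in>{..<n}. u \<le> \<kappa> (w i)}. s i * h (w i)\<bar> ^ (2 * m)))" for s
      proof -
        have "(\<Sum>i<n. s i * (2 * g u (w i))) = 2 * (\<Sum>i\<in>{i\<in>{..<n}. u \<le> \<kappa> (w i)}. s i * h (w i))" for u
          unfolding g_def sum_distrib_left by (rule sum.mono_neutral_cong_right) auto
        then have "\<bar>0 + (\<Sum>i<n. s i * (2 * g u (w i)))\<bar> ^ (2 * m)
            = 4 ^ m * \<bar>\<Sum>i\<in>{i\<in>{..<n}. u \<le> \<kappa> (w i)}. s i * h (w i)\<bar> ^ (2 * m)" for u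
          by (simp add: abs_mult power_mult_distrib power_mult)
        then show ?thesis
          by (simp add: ennreal_mult SUP_mult_left_ennreal)
      qed
      have "sign_sum {..<n} (\<lambda>s. ?r s w) \<le> ennreal (4 ^ m) * ennreal (2 ^ n * (K * (\<Sum>i<n. (h (w i))\<^sup>2) ^ m))"
        unfolding r sign_sum_cmult K_def
        using sign_sum_maximal[where I = "{..<n}" and U = \<rat> and T = "\<lambda>i. \<kappa> (w i)" and y = "\<lambda>i. h (w i)" and m = m]
        by (intro mult_left_mono) auto
      also have "\<dots> = ennreal (4 ^ m * (2 ^ n * (K * (\<Sum>i<n. (h (w i))\<^sup>2) ^ m)))"
        by (simp add: ennreal_mult K_def sum_nonneg)
      also have "\<dots> \<le> ennreal (4 ^ m * (2 ^ n * (K * (real n ^ (m - 1) * (\<Sum>i<n. h (w i) ^ (2 * m))))))"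
        using sum_power_le[of "{..<n}" "\<lambda>i. (h (w i))\<^sup>2" m] m
        by (intro ennreal_leI mult_left_mono) (auto simp: power_mult K_def)
      finally show "sign_sum {..<n} (\<lambda>s. ?r s w)
          \<le> ennreal (4 ^ m * (2 ^ n * (K * (real n ^ (m - 1) * (\<Sum>i<n. h (w i) ^ (2 * m))))))" .
    qed
    also have "\<dots> = (\<integral>\<^sup>+\<omega>. ennreal (4 ^ m * (2 ^ n * (K * (real n ^ (m - 1) * (\<Sum>i<n. h (W i \<omega>) ^ (2 * m)))))) \<partial>M)"
      using mc by (subst nn_integral_sample[OF n]) (auto intro!: measurable_ennreal borel_measurable_times borel_measurable_sum borel_measurable_power)
    also have "\<dots> = ennreal (expectation (\<lambda>\<omega>. 4 ^ m * (2 ^ n * (K * (real n ^ (m - 1) * (\<Sum>i<n. h (W i \<omega>) ^ (2 * m)))))))"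
      using integrable_W[OF mom] by (intro nn_integral_eq_integral) (auto simp: K_def intro!: always_eventually mult_nonneg_nonneg sum_nonneg zero_le_even_power')
    also have "expectation (\<lambda>\<omega>. 4 ^ m * (2 ^ n * (K * (real n ^ (m - 1) * (\<Sum>i<n. h (W i \<omega>) ^ (2 * m))))))
        = 4 ^ m * (2 ^ n * (K * (real n ^ (m - 1) * (n * H))))"
      using integrable_W[OF mom] integral_W[of "\<lambda>w. h w ^ (2 * m)"] by (simp add: H_def)
    also have "\<dots> = 2 ^ n * (C * real n ^ m)"
      using m by (cases m) (auto simp: C_def)
    finally have "2 ^ n * (\<integral>\<^sup>+w. ?c w \<partial>Pi\<^sub>M {..<n} (\<lambda>_. P)) \<le> ennreal (2 ^ n * (C * real n ^ m))" .
    then have A: "2 ^ n * (\<integral>\<^sup>+w. ?c w \<partial>Pi\<^sub>M {..<n} (\<lambda>_. P)) \<le> 2 ^ n * ennreal (C * real n ^ m)"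
    proof -
      have "ennreal (2 ^ n * (C * real n ^ m)) = 2 ^ n * ennreal (C * real n ^ m)"
        using H0 by (subst ennreal_mult) (auto simp: C_def K_def simp flip: ennreal_power)
      then show ?thesis
        using \<open>2 ^ n * (\<integral>\<^sup>+w. ?c w \<partial>Pi\<^sub>M {..<n} (\<lambda>_. P)) \<le> ennreal (2 ^ n * (C * real n ^ m))\<close> by simp
    qed
    have B: "(\<integral>\<^sup>+w. ?c w \<partial>Pi\<^sub>M {..<n} (\<lambda>_. P)) \<le> ennreal (C * real n ^ m)"
      using A by (subst (asm) ennreal_mult_le_mult_iff) (auto simp: power_eq_top_ennreal)
    have "(\<integral>\<^sup>+\<omega>. ennreal (dev \<kappa> h n \<omega> ^ (2 * m)) \<partial>M)
        \<le> (\<integral>\<^sup>+\<omega>. ennreal (1 / real n ^ (2 * m)) * ?c (\<lambda>i\<in>{..<n}. W i \<omega>) \<partial>M)"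
    proof (intro nn_integral_mono order_trans[OF dev_power_le])
      fix \<omega>
      have "\<bar>emp \<kappa> h n u \<omega> - tail \<kappa> h u\<bar> ^ (2 * m)
          = 1 / real n ^ (2 * m) * \<bar>0 + (\<Sum>i<n. g u ((\<lambda>i\<in>{..<n}. W i \<omega>) i) - (\<integral>x. g u x \<partial>P))\<bar> ^ (2 * m)" for u
      proof -
        have "emp \<kappa> h n u \<omega> - tail \<kappa> h u = (\<Sum>i<n. g u ((\<lambda>i\<in>{..<n}. W i \<omega>) i) - (\<integral>x. g u x \<partial>P)) / n"
          using n by (simp add: emp_def tail_def g_def sum_subtractf field_simps)
        then show ?thesis
          by (simp add: power_divide)
      qed
      then show "(SUP u\<in>\<rat>. ennreal (\<bar>emp \<kappa> h n u \<omega> - tail \<kappa> h u\<bar> ^ (2 * m)))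
          \<le> ennreal (1 / real n ^ (2 * m)) * ?c (\<lambda>i\<in>{..<n}. W i \<omega>)"
        by (simp only: SUP_mult_left_ennreal) (simp only: ennreal_mult zero_le_power abs_ge_zero zero_le_divide_1_iff of_nat_0_le_iff order_refl)
    qed (use m in auto)
    also have "\<dots> = ennreal (1 / real n ^ (2 * m)) * (\<integral>\<^sup>+w. ?c w \<partial>Pi\<^sub>M {..<n} (\<lambda>_. P))"
      using meas(1) by (subst nn_integral_sample[OF n]) (auto intro!: nn_integral_cmult measurable_compose[OF _ meas(1)] simp del: restrict_apply)
    also have "\<dots> \<le> ennreal (1 / real n ^ (2 * m)) * ennreal (C * real n ^ m)"
      by (intro mult_left_mono B) auto
    also have "\<dots> = ennreal (C / real n ^ m)"
      using n H0 by (simp add: ennreal_mult[symmetric] C_def K_def mult_2 power_add)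
    finally show ?thesis .
  qed
  moreover have "0 \<le> C"
    using H0 by (simp add: C_def K_def)
  ultimately show ?thesis by blast
qed

end

end

section \<open>The partial likelihood near the true parameter\<close>

text \<open>The remainder of order 4 in the Taylor expansion is nonnegative.\<close>
lemma exp_ge_cubic: "1 + x + x\<^sup>2 / 2 - \<bar>x\<bar> ^ 3 / 6 \<le> exp x" for x :: real
proof -
  obtain t where "exp x = (\<Sum>m<4. x ^ m / fact m) + exp t / fact 4 * x ^ 4"
    using Maclaurin_exp_le[of x 4] by (elim exE conjE) (rule that)
  moreover have "0 \<le> exp t / fact 4 * x ^ 4"
    by simp
  moreover have "- (x ^ 3) \<le> \<bar>x\<bar> ^ 3"
    using abs_ge_minus_self[of "x ^ 3"] by (simp only: power_abs)
  moreover have "(\<Sum>m<4. x ^ m / fact m) = 1 + x + x\<^sup>2 / 2 + x ^ 3 / 6"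
    by (simp add: lessThan_nat_numeral fact_numeral)
  ultimately show ?thesis
    by linarith
qed

context
  fixes J :: "'i set" and w x :: "'i \<Rightarrow> real" and W :: real
  assumes finite_J: "finite J" and w: "\<And>j. j \<in> J \<Longrightarrow> 0 \<le> w j"
    and W: "W = (\<Sum>j\<in>J. w j)" "0 < W"
begin

text \<open>A second order expansion of the logarithm of a weighted exponential mean, with the variance as
quadratic term and with an error of third order.  The bounds on \<open>v\<close> and \<open>k\<close> keep the
argument of the logarithm within \<open>1/2\<close> of 1.\<close>
lemma log_mean_exp_ge:
  assumes m: "m = (\<Sum>j\<in>J. w j * x j) / W"
    and v: "v = (\<Sum>j\<in>J. w j * (x j - m)\<^sup>2) / W" "v \<le> 1 / 2"
    and k: "(\<Sum>j\<in>J. w j * \<bar>x j - m\<bar> ^ 3) / W \<le> k" "k \<le> 1"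
  shows "m + v / 2 - v\<^sup>2 - k \<le> ln ((\<Sum>j\<in>J. w j * exp (x j)) / W)"
proof -
  define k' where "k' = (\<Sum>j\<in>J. w j * \<bar>x j - m\<bar> ^ 3) / W"
  have v0: "0 \<le> v" and k0: "0 \<le> k'"
    using w W by (auto simp: v k'_def intro!: divide_nonneg_pos sum_nonneg mult_nonneg_nonneg)
  have centred: "(\<Sum>j\<in>J. w j * (x j - m)) = 0"
  proof -
    have "(\<Sum>j\<in>J. w j * (x j - m)) = (\<Sum>j\<in>J. w j * x j) - m * W"
      by (simp add: right_diff_distrib sum_subtractf W(1) sum_distrib_left mult.commute)
    then show ?thesis
      using W(2) by (simp add: m)
  qed
  have "exp m * (W * (1 + v / 2 - k' / 6))
      = exp m * (\<Sum>j\<in>J. w j * (1 + (x j - m) + (x j - m)\<^sup>2 / 2 - \<bar>x j - m\<bar> ^ 3 / 6))"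
  proof -
    have "W * v = (\<Sum>j\<in>J. w j * (x j - m)\<^sup>2)" "W * k' = (\<Sum>j\<in>J. w j * \<bar>x j - m\<bar> ^ 3)"
      using W by (simp_all add: v k'_def)
    then show ?thesis
      using centred by (simp add: distrib_left right_diff_distrib[of _ _ "_ / 6"] sum.distrib sum_subtractf W(1)[symmetric]
          sum_divide_distrib[symmetric])
  qed
  also have "\<dots> \<le> exp m * (\<Sum>j\<in>J. w j * exp (x j - m))"
    using w by (intro mult_left_mono sum_mono exp_ge_cubic) auto
  also have "\<dots> = (\<Sum>j\<in>J. w j * exp (x j))"
    by (simp add: sum_distrib_left exp_diff)
  finally have A: "exp m * (1 + v / 2 - k' / 6) \<le> (\<Sum>j\<in>J. w j * exp (x j)) / W"
    using W by (simp add: field_simps)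
  define y where "y = v / 2 - k' / 6"
  have y: "\<bar>y\<bar> \<le> 1 / 2"
    using v0 k0 v(2) k unfolding y_def k'_def[symmetric] by linarith
  have "y\<^sup>2 \<le> (v / 2)\<^sup>2 + (k' / 6)\<^sup>2"
    using v0 k0 by (simp add: y_def power2_diff)
  moreover have "k'\<^sup>2 \<le> k' * 1"
    unfolding power2_eq_square using k0 k by (intro mult_left_mono) (auto simp: k'_def)
  moreover have "(v / 2)\<^sup>2 = v\<^sup>2 / 4" "(k' / 6)\<^sup>2 = k'\<^sup>2 / 36"
    by (simp_all add: power_divide)
  ultimately have "2 * y\<^sup>2 \<le> v\<^sup>2 + k' / 18"
    using zero_le_power2[of v] by linarith
  moreover have "\<bar>ln (1 + y) - y\<bar> \<le> 2 * y\<^sup>2"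
    using y by (rule abs_ln_one_plus_x_minus_x_bound)
  ultimately have "m + v / 2 - v\<^sup>2 - k \<le> m + ln (1 + y)"
    using k(1) k0 unfolding y_def k'_def[symmetric] by linarith
  also have "\<dots> = ln (exp m * (1 + y))"
    using y by (subst ln_mult_pos) auto
  also have "\<dots> \<le> ln ((\<Sum>j\<in>J. w j * exp (x j)) / W)"
  proof (rule ln_mono)
    show "0 < exp m * (1 + y)"
      using y by auto
    show "exp m * (1 + y) \<le> (\<Sum>j\<in>J. w j * exp (x j)) / W"
      using A by (simp add: y_def add_diff_eq)
  qed
  finally show ?thesis .
qed

lemma weighted_exp_pos: "0 < (\<Sum>j\<in>J. w j * exp (x j))"
proof -
  obtain j where "j \<in> J" "w j \<noteq> 0"
    using W by (metis less_irrefl sum.neutral)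
  then show ?thesis
    using w finite_J by (intro sum_pos2[of J j]) (auto simp: order_less_le)
qed

text \<open>Convexity of the log-sum-exp function along a ray from the origin, where it vanishes.  After division
by the mean it is Bernoulli's inequality for the exponent \<open>a\<close>.\<close>
lemma log_mean_exp_superhomogeneous:
  assumes a: "1 \<le> a"
  shows "a * ln ((\<Sum>j\<in>J. w j * exp (x j)) / W) \<le> ln ((\<Sum>j\<in>J. w j * exp (a * x j)) / W)"
proof -
  define G where "G = ln ((\<Sum>j\<in>J. w j * exp (x j)) / W)"
  have G: "exp G = (\<Sum>j\<in>J. w j * exp (x j)) / W"
    unfolding G_def using weighted_exp_pos W(2) by (intro exp_ln) simp
  have bernoulli: "1 + a * (exp y - 1) \<le> exp (a * y)" for y
  proof -
    have "exp ((1 - 1 / a) *\<^sub>R 0 + (1 / a) *\<^sub>R (a * y)) \<le> (1 - 1 / a) * exp 0 + (1 / a) * exp (a * y)"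
      using a by (intro convex_onD[OF exp_convex]) auto
    then have "exp y \<le> (1 - 1 / a) + (1 / a) * exp (a * y)"
      using a by simp
    then have "a * exp y \<le> a * ((1 - 1 / a) + (1 / a) * exp (a * y))"
      using a by (intro mult_left_mono) auto
    also have "\<dots> = a - 1 + exp (a * y)"
      using a by (simp add: distrib_left right_diff_distrib)
    finally show ?thesis
      by (simp add: right_diff_distrib)
  qed
  have "W * exp (a * G) = exp (a * G) * (\<Sum>j\<in>J. w j * (1 + a * (exp (x j - G) - 1)))"
  proof -
    have "(\<Sum>j\<in>J. w j * exp (x j - G)) = W"
    proof -
      have "(\<Sum>j\<in>J. w j * exp (x j - G)) = (\<Sum>j\<in>J. w j * exp (x j)) / exp G"
        by (simp add: exp_diff sum_divide_distrib)
      moreover have "(\<Sum>j\<in>J. w j * exp (x j)) = W * exp G"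
        using W(2) G by simp
      ultimately show ?thesis by simp
    qed
    then show ?thesis
      by (simp add: algebra_simps sum.distrib sum_subtractf sum_distrib_left[symmetric] W(1)[symmetric])
  qed
  also have "\<dots> \<le> exp (a * G) * (\<Sum>j\<in>J. w j * exp (a * (x j - G)))"
    using w bernoulli by (intro mult_left_mono sum_mono) auto
  also have "\<dots> = (\<Sum>j\<in>J. w j * exp (a * x j))"
    by (simp add: sum_distrib_left right_diff_distrib exp_diff)
  finally have "exp (a * G) \<le> (\<Sum>j\<in>J. w j * exp (a * x j)) / W"
    using W(2) by (simp add: field_simps)
  then have "ln (exp (a * G)) \<le> ln ((\<Sum>j\<in>J. w j * exp (a * x j)) / W)"
    by (intro ln_mono) auto
  then show ?thesis
    by (simp add: G_def)
qed

end

definition risk_weight :: "(nat \<Rightarrow> real) \<Rightarrow> (nat \<Rightarrow> real ^ 'd::finite) \<Rightarrow> real ^ 'd \<Rightarrow> real \<Rightarrow> nat \<Rightarrow> real" where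
  "risk_weight t z \<beta> u j = of_bool (u \<le> t j) * exp (\<beta> \<bullet> z j)"

definition risk_mean :: "nat \<Rightarrow> (nat \<Rightarrow> real) \<Rightarrow> (nat \<Rightarrow> real ^ 'd::finite) \<Rightarrow> real ^ 'd \<Rightarrow> real \<Rightarrow> real ^ 'd" where
  "risk_mean n t z \<beta> u = (1 / (\<Sum>j<n. risk_weight t z \<beta> u j)) *\<^sub>R (\<Sum>j<n. risk_weight t z \<beta> u j *\<^sub>R z j)"

definition risk_var :: "nat \<Rightarrow> (nat \<Rightarrow> real) \<Rightarrow> (nat \<Rightarrow> real ^ 'd::finite) \<Rightarrow> real ^ 'd \<Rightarrow> real \<Rightarrow> real ^ 'd \<Rightarrow> real" where
  "risk_var n t z \<beta> u d = (\<Sum>j<n. risk_weight t z \<beta> u j * (d \<bullet> (z j - risk_mean n t z \<beta> u))\<^sup>2)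
     / (\<Sum>j<n. risk_weight t z \<beta> u j)"

definition score :: "nat \<Rightarrow> (nat \<Rightarrow> real) \<Rightarrow> (nat \<Rightarrow> bool) \<Rightarrow> (nat \<Rightarrow> real ^ 'd::finite) \<Rightarrow> real ^ 'd \<Rightarrow> real ^ 'd" where
  "score n t \<delta> z \<beta> = (1 / real n) *\<^sub>R (\<Sum>i<n. of_bool (\<delta> i) *\<^sub>R (z i - risk_mean n t z \<beta> (t i)))"

definition observed_information ::
    "nat \<Rightarrow> (nat \<Rightarrow> real) \<Rightarrow> (nat \<Rightarrow> bool) \<Rightarrow> (nat \<Rightarrow> real ^ 'd::finite) \<Rightarrow> real ^ 'd \<Rightarrow> real ^ 'd \<Rightarrow> real" where
  "observed_information n t \<delta> z \<beta> d = (1 / real n) * (\<Sum>i<n. of_bool (\<delta> i) * risk_var n t z \<beta> (t i) d)"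

text \<open>The increase of the log partial likelihood from \<open>\<beta>\<close> to \<open>\<beta> + d\<close>, divided by \<open>n\<close>.\<close>
definition log_likelihood_gain ::
    "nat \<Rightarrow> (nat \<Rightarrow> real) \<Rightarrow> (nat \<Rightarrow> bool) \<Rightarrow> (nat \<Rightarrow> real ^ 'd::finite) \<Rightarrow> real ^ 'd \<Rightarrow> real ^ 'd \<Rightarrow> real" where
  "log_likelihood_gain n t \<delta> z \<beta> d = (1 / real n) * (\<Sum>i<n. of_bool (\<delta> i) *
     (d \<bullet> z i - ln (Phi_n n t z (t i) (\<beta> + d) / Phi_n n t z (t i) \<beta>)))"

lemma Phi_n_risk_weight: "Phi_n n t z u \<beta> = (\<Sum>j<n. risk_weight t z \<beta> u j) / real n"
  by (simp add: Phi_n_def risk_weight_def)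

lemma Phi_n_pos: "0 < Phi_n n t z (t i) \<beta>" if "i < n"
proof -
  have "0 < (\<Sum>j<n. risk_weight t z \<beta> (t i) j)"
    using that by (intro sum_pos2[of _ i]) (auto simp: risk_weight_def)
  then show ?thesis
    using that by (simp add: Phi_n_risk_weight)
qed

lemma Phi_n_ratio:
  "Phi_n n t z u (\<beta> + d) / Phi_n n t z u \<beta>
    = (\<Sum>j<n. risk_weight t z \<beta> u j * exp (d \<bullet> z j)) / (\<Sum>j<n. risk_weight t z \<beta> u j)" if "n \<ge> 1"
  using that by (simp add: Phi_n_risk_weight) (simp add: risk_weight_def inner_add_left exp_add mult.assoc)

text \<open>Distinct event times are needed here: the likelihood is a product over times, each with a unique
subject, and becomes a product over subjects.\<close>
lemma partial_likelihood_gain: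
  assumes n: "n \<ge> 1" and inj: "inj_on t {i. i < n \<and> \<delta> i}"
  shows "partial_likelihood n t \<delta> z (\<beta> + d)
    = partial_likelihood n t \<delta> z \<beta> * exp (real n * log_likelihood_gain n t \<delta> z \<beta> d)"
proof -
  let ?E = "{i. i < n \<and> \<delta> i}"
  have subject: "event_subject n t \<delta> (t i) = i" if "i \<in> ?E" for i
    unfolding event_subject_def using that inj by (intro the_equality) (auto dest: inj_onD)
  have L: "partial_likelihood n t \<delta> z b = (\<Prod>i\<in>?E. exp (b \<bullet> z i) / (n * Phi_n n t z (t i) b))" for b
    unfolding partial_likelihood_def event_times_def using n subject
    by (subst prod.reindex[OF inj]) (auto intro!: prod.cong simp: Phi_n_def)
  have "exp ((\<beta> + d) \<bullet> z i) / (n * Phi_n n t z (t i) (\<beta> + d)) = exp (\<beta> \<bullet> z i) / (n * Phi_n n t z (t i) \<beta>)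
      * exp (d \<bullet> z i - ln (Phi_n n t z (t i) (\<beta> + d) / Phi_n n t z (t i) \<beta>))" if "i \<in> ?E" for i
  proof -
    have p: "0 < Phi_n n t z (t i) (\<beta> + d)" "0 < Phi_n n t z (t i) \<beta>"
      using that Phi_n_pos[of i n t z] by auto
    then have "exp (d \<bullet> z i - ln (Phi_n n t z (t i) (\<beta> + d) / Phi_n n t z (t i) \<beta>))
        = exp (d \<bullet> z i) / (Phi_n n t z (t i) (\<beta> + d) / Phi_n n t z (t i) \<beta>)"
      by (simp only: exp_diff exp_ln divide_pos_pos)
    then show ?thesis
      using p n by (simp add: exp_add inner_add_left)
  qed
  then have "partial_likelihood n t \<delta> z (\<beta> + d) = (\<Prod>i\<in>?E. exp (\<beta> \<bullet> z i) / (n * Phi_n n t z (t i) \<beta>)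
      * exp (d \<bullet> z i - ln (Phi_n n t z (t i) (\<beta> + d) / Phi_n n t z (t i) \<beta>)))"
    unfolding L by (rule prod.cong[OF refl])
  also have "\<dots> = partial_likelihood n t \<delta> z \<beta>
      * (\<Prod>i\<in>?E. exp (d \<bullet> z i - ln (Phi_n n t z (t i) (\<beta> + d) / Phi_n n t z (t i) \<beta>)))"
    unfolding L by (rule prod.distrib)
  also have "(\<Prod>i\<in>?E. exp (d \<bullet> z i - ln (Phi_n n t z (t i) (\<beta> + d) / Phi_n n t z (t i) \<beta>)))
      = exp (\<Sum>i\<in>?E. d \<bullet> z i - ln (Phi_n n t z (t i) (\<beta> + d) / Phi_n n t z (t i) \<beta>))"
    by (simp add: exp_sum)
  also have "(\<Sum>i\<in>?E. d \<bullet> z i - ln (Phi_n n t z (t i) (\<beta> + d) / Phi_n n t z (t i) \<beta>))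
      = (\<Sum>i<n. of_bool (\<delta> i) * (d \<bullet> z i - ln (Phi_n n t z (t i) (\<beta> + d) / Phi_n n t z (t i) \<beta>)))"
    by (rule sum.mono_neutral_cong_left) auto
  also have "\<dots> = real n * log_likelihood_gain n t \<delta> z \<beta> d"
    using n by (simp only: log_likelihood_gain_def)  simp
  finally show ?thesis .
qed

lemma partial_likelihood_pos: "0 < partial_likelihood n t \<delta> z \<beta>"
proof -
  have "0 < (\<Sum>j<n. of_bool (s \<le> t j) * exp (\<beta> \<bullet> z j))" if s: "s \<in> event_times n t \<delta>" for s
  proof -
    obtain i where "i < n" "s = t i"
      using s by (auto simp: event_times_def)
    then show ?thesis
      by (intro sum_pos2[of _ i]) auto
  qed
  then show ?thesis
    unfolding partial_likelihood_def by (intro prod_pos) simp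
qed

lemma log_likelihood_gain_superhomogeneous:
  assumes n: "n \<ge> 1" and a: "1 \<le> a"
  shows "log_likelihood_gain n t \<delta> z \<beta> (a *\<^sub>R d) \<le> a * log_likelihood_gain n t \<delta> z \<beta> d"
proof -
  have "a * ln (Phi_n n t z (t i) (\<beta> + d) / Phi_n n t z (t i) \<beta>)
      \<le> ln (Phi_n n t z (t i) (\<beta> + a *\<^sub>R d) / Phi_n n t z (t i) \<beta>)" if "i < n" for i
    unfolding Phi_n_ratio[OF n] inner_scaleR_left
    using Phi_n_pos[OF that, of t z \<beta>] n a
    by (intro log_mean_exp_superhomogeneous) (auto simp: Phi_n_risk_weight risk_weight_def zero_less_divide_iff)
  then have "(\<Sum>i<n. of_bool (\<delta> i) * ((a *\<^sub>R d) \<bullet> z i - ln (Phi_n n t z (t i) (\<beta> + a *\<^sub>R d) / Phi_n n t z (t i) \<beta>)))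
      \<le> (\<Sum>i<n. a * (of_bool (\<delta> i) * (d \<bullet> z i - ln (Phi_n n t z (t i) (\<beta> + d) / Phi_n n t z (t i) \<beta>))))"
    by (intro sum_mono) (auto simp: right_diff_distrib)
  also have "\<dots> = a * (\<Sum>i<n. of_bool (\<delta> i) * (d \<bullet> z i - ln (Phi_n n t z (t i) (\<beta> + d) / Phi_n n t z (t i) \<beta>)))"
    by (simp only: sum_distrib_left)
  finally show ?thesis
    unfolding log_likelihood_gain_def by (subst mult.left_commute[of a]) (intro mult_left_mono, auto)
qed

lemma continuous_log_likelihood_gain: "continuous_on S (log_likelihood_gain n t \<delta> z \<beta>)"
proof -
  have c: "continuous_on S (\<lambda>d. Phi_n n t z u (\<beta> + d))" for u
    unfolding Phi_n_def by (intro continuous_intros)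
  have nz: "Phi_n n t z (t i) b \<noteq> 0" if "i < n" for i b
    using Phi_n_pos[OF that, of t z b] by simp
  show ?thesis
    unfolding log_likelihood_gain_def using nz
    by (intro continuous_intros c) auto
qed

text \<open>A single weighted third moment of \<open>1 + norm z\<close> controls both the weighted mean and all central moments
up to order 3.\<close>
lemma weighted_central_moments:
  fixes z :: "'i \<Rightarrow> 'b::real_inner"
  assumes J: "finite J" and w: "\<And>j. j \<in> J \<Longrightarrow> 0 \<le> w j" and W: "W = (\<Sum>j\<in>J. w j)" "0 < W"
    and m: "m = (1 / W) *\<^sub>R (\<Sum>j\<in>J. w j *\<^sub>R z j)"
    and q: "(\<Sum>j\<in>J. w j * (1 + norm (z j)) ^ 3) / W \<le> q" and k: "k \<le> 3"
  shows "(\<Sum>j\<in>J. w j * norm (z j - m) ^ k) / W \<le> (1 + q) ^ 3 * q"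
proof -
  let ?Q = "\<Sum>j\<in>J. w j * (1 + norm (z j)) ^ 3"
  have Qq: "?Q \<le> q * W"
    using q W by (simp add: field_simps)
  have "0 \<le> ?Q"
    using w by (intro sum_nonneg) auto
  then have q0: "0 \<le> q"
    using Qq W by (metis order.trans zero_le_mult_iff not_less)
  have "norm m \<le> (1 / W) * (\<Sum>j\<in>J. w j * norm (z j))"
    unfolding m using w W by (auto intro!: divide_right_mono order_trans[OF norm_sum] sum_mono)
  also have "\<dots> \<le> (1 / W) * ?Q"
  proof (intro mult_left_mono sum_mono)
    fix j
    have "norm (z j) \<le> 1 + norm (z j)" by simp
    also have "\<dots> \<le> (1 + norm (z j)) ^ 3" by (rule self_le_power) auto
    finally show "norm (z j) \<le> (1 + norm (z j)) ^ 3" .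
  qed (use w W in auto)
  also have "\<dots> \<le> q"
    using q by simp
  finally have mq: "norm m \<le> q" .
  have "norm (z j - m) ^ k \<le> (1 + q) ^ 3 * (1 + norm (z j)) ^ 3" for j
  proof -
    have "norm (z j - m) \<le> norm (z j) + q"
      using norm_triangle_ineq4[of "z j" m] mq by linarith
    also have "\<dots> \<le> (1 + q) * (1 + norm (z j))"
      using q0 by (simp add: distrib_left distrib_right)
    finally have "norm (z j - m) ^ k \<le> ((1 + q) * (1 + norm (z j))) ^ k"
      by (intro power_mono) auto
    also have "\<dots> \<le> ((1 + q) * (1 + norm (z j))) ^ 3"
    proof (rule power_increasing[OF k])
      have "1 * 1 \<le> (1 + q) * (1 + norm (z j))"
        using q0 by (intro mult_mono) auto
      then show "1 \<le> (1 + q) * (1 + norm (z j))" by simp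
    qed
    finally show ?thesis
      by (simp add: power_mult_distrib)
  qed
  then have "(\<Sum>j\<in>J. w j * norm (z j - m) ^ k) \<le> (\<Sum>j\<in>J. w j * ((1 + q) ^ 3 * (1 + norm (z j)) ^ 3))"
    using w by (intro sum_mono mult_left_mono) auto
  also have "\<dots> = (1 + q) ^ 3 * ?Q"
    by (simp add: sum_distrib_left mult.left_commute)
  also have "\<dots> \<le> (1 + q) ^ 3 * (q * W)"
    using Qq q0 by (intro mult_left_mono) auto
  finally show ?thesis
    using W by (simp add: field_simps)
qed

lemma log_Phi_n_ratio_ge:
  fixes z :: "nat \<Rightarrow> real ^ 'd::finite"
  assumes n: "n \<ge> 1" and pos: "0 < (\<Sum>j<n. risk_weight t z \<beta> u j)"
    and q: "(\<Sum>j<n. risk_weight t z \<beta> u j * (1 + norm (z j)) ^ 3) / (\<Sum>j<n. risk_weight t z \<beta> u j) \<le> q"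
    and B: "B = (1 + q) ^ 3 * q" and d: "norm d \<le> 1" "B * (norm d)\<^sup>2 \<le> 1 / 2"
  shows "d \<bullet> risk_mean n t z \<beta> u + risk_var n t z \<beta> u d / 2 - (B\<^sup>2 + B) * norm d ^ 3
    \<le> ln (Phi_n n t z u (\<beta> + d) / Phi_n n t z u \<beta>)"
proof -
  let ?w = "risk_weight t z \<beta> u"
  define W where "W = (\<Sum>j<n. ?w j)"
  define m where "m = risk_mean n t z \<beta> u"
  define v where "v = risk_var n t z \<beta> u d"
  have w0: "0 \<le> ?w j" for j
    by (simp add: risk_weight_def)
  have W0: "0 < W"
    using pos by (simp add: W_def)
  have m: "m = (1 / W) *\<^sub>R (\<Sum>j<n. ?w j *\<^sub>R z j)"
    by (simp add: m_def W_def risk_mean_def)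
  have moments: "(\<Sum>j<n. ?w j * norm (z j - m) ^ k) / W \<le> B" if "k \<le> 3" for k
    unfolding B using q W0 m that w0 by (intro weighted_central_moments) (auto simp: W_def)
  have dm: "d \<bullet> m = (\<Sum>j<n. ?w j * (d \<bullet> z j)) / W"
    by (simp add: m inner_sum_right)
  have v: "v = (\<Sum>j<n. ?w j * (d \<bullet> z j - d \<bullet> m)\<^sup>2) / W"
    by (simp add: v_def risk_var_def m_def W_def inner_diff_right)
  have scaled: "(\<Sum>j<n. ?w j * \<bar>d \<bullet> z j - d \<bullet> m\<bar> ^ k) / W \<le> B * norm d ^ k" if "k \<le> 3" for k
  proof -
    have "(\<Sum>j<n. ?w j * \<bar>d \<bullet> z j - d \<bullet> m\<bar> ^ k) \<le> (\<Sum>j<n. norm d ^ k * (?w j * norm (z j - m) ^ k))"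
    proof (intro sum_mono)
      fix j
      have "\<bar>d \<bullet> z j - d \<bullet> m\<bar> ^ k \<le> (norm d * norm (z j - m)) ^ k"
        using Cauchy_Schwarz_ineq2[of d "z j - m"] by (intro power_mono) (auto simp: inner_diff_right)
      then show "?w j * \<bar>d \<bullet> z j - d \<bullet> m\<bar> ^ k \<le> norm d ^ k * (?w j * norm (z j - m) ^ k)"
        using mult_left_mono[OF _ w0[of j]] by (fastforce simp: power_mult_distrib mult_ac)
    qed
    then have "(\<Sum>j<n. ?w j * \<bar>d \<bullet> z j - d \<bullet> m\<bar> ^ k) / W \<le> norm d ^ k * ((\<Sum>j<n. ?w j * norm (z j - m) ^ k) / W)"
      using W0 by (simp add: sum_distrib_left[symmetric] divide_right_mono)
    also have "\<dots> \<le> norm d ^ k * B"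
      by (intro mult_left_mono moments that) auto
    finally show ?thesis by (simp add: mult.commute)
  qed
  have v0: "0 \<le> v"
    unfolding v using w0 W0 by (auto intro!: divide_nonneg_pos sum_nonneg)
  have v_le: "v \<le> B * (norm d)\<^sup>2"
    using scaled[of 2] by (simp add: v)
  have B0: "0 \<le> B"
    by (rule order_trans[OF _ moments[of 0]]) (use w0 W0 in \<open>auto intro!: divide_nonneg_pos sum_nonneg\<close>)
  have "norm d ^ 3 \<le> (norm d)\<^sup>2"
    using d(1) by (intro power_decreasing) auto
  then have "B * norm d ^ 3 \<le> B * (norm d)\<^sup>2"
    using B0 by (intro mult_left_mono)
  then have k1: "B * norm d ^ 3 \<le> 1"
    using d(2) by linarith
  have "v\<^sup>2 \<le> (B * (norm d)\<^sup>2)\<^sup>2"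
    using v0 v_le by (intro power_mono)
  also have "\<dots> = B\<^sup>2 * norm d ^ 4"
    by (simp add: power_mult_distrib)
  also have "\<dots> \<le> B\<^sup>2 * norm d ^ 3"
    using d(1) by (intro mult_left_mono power_decreasing) auto
  finally have v2: "v\<^sup>2 \<le> B\<^sup>2 * norm d ^ 3" .
  have "d \<bullet> m + v / 2 - v\<^sup>2 - B * norm d ^ 3 \<le> ln ((\<Sum>j<n. ?w j * exp (d \<bullet> z j)) / W)"
  proof (rule log_mean_exp_ge[OF _ _ W_def W0 dm v])
    show "v \<le> 1 / 2"
      using v_le d(2) by linarith
  qed (use w0 scaled[of 3] k1 in auto)
  then show ?thesis
    unfolding Phi_n_ratio[OF n] m_def[symmetric] v_def[symmetric] W_def[symmetric] distrib_right
    using v2 by linarith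
qed

text \<open>The quadratic upper bound: averaging the expansions of the logarithms over the observed events, the
means add up to the score and the variances to the observed information.\<close>
lemma log_likelihood_gain_le:
  fixes z :: "nat \<Rightarrow> real ^ 'd::finite"
  assumes n: "n \<ge> 1" and \<phi>: "0 < \<phi>" "\<And>i. i < n \<Longrightarrow> \<delta> i \<Longrightarrow> \<phi> \<le> Phi_n n t z (t i) \<beta>"
    and H: "(\<Sum>j<n. exp (\<beta> \<bullet> z j) * (1 + norm (z j)) ^ 3) / n \<le> H"
    and B: "B = (1 + H / \<phi>) ^ 3 * (H / \<phi>)" and d: "norm d \<le> 1" "B * (norm d)\<^sup>2 \<le> 1 / 2"
  shows "log_likelihood_gain n t \<delta> z \<beta> d
    \<le> d \<bullet> score n t \<delta> z \<beta> - observed_information n t \<delta> z \<beta> d / 2 + (B\<^sup>2 + B) * norm d ^ 3"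
proof -
  let ?c = "(B\<^sup>2 + B) * norm d ^ 3"
  have H0: "0 \<le> H"
    by (rule order_trans[OF _ H]) (auto intro!: divide_nonneg_nonneg sum_nonneg)
  have c0: "0 \<le> ?c"
    using H0 \<phi>(1) by (simp add: B)
  have term_le: "of_bool (\<delta> i) * (d \<bullet> z i - ln (Phi_n n t z (t i) (\<beta> + d) / Phi_n n t z (t i) \<beta>))
      \<le> of_bool (\<delta> i) * (d \<bullet> (z i - risk_mean n t z \<beta> (t i))) - of_bool (\<delta> i) * risk_var n t z \<beta> (t i) d / 2 + ?c"
    if i: "i < n" for i
  proof (cases "\<delta> i")
    case True
    let ?W = "\<Sum>j<n. risk_weight t z \<beta> (t i) j"
    have W: "n * \<phi> \<le> ?W"
      using \<phi>(2)[OF i True] n by (simp add: Phi_n_risk_weight field_simps)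
    then have Wpos: "0 < ?W"
      using \<phi>(1) n by (intro less_le_trans[OF _ W]) auto
    have "(\<Sum>j<n. risk_weight t z \<beta> (t i) j * (1 + norm (z j)) ^ 3) / ?W
        \<le> (\<Sum>j<n. exp (\<beta> \<bullet> z j) * (1 + norm (z j)) ^ 3) / (n * \<phi>)"
      using W \<phi>(1) n
      by (intro frac_le sum_mono sum_nonneg) (auto simp: risk_weight_def)
    also have "\<dots> = (\<Sum>j<n. exp (\<beta> \<bullet> z j) * (1 + norm (z j)) ^ 3) / n / \<phi>"
      by simp
    also have "\<dots> \<le> H / \<phi>"
      using H \<phi>(1) by (intro divide_right_mono) auto
    finally show ?thesis
      using log_Phi_n_ratio_ge[OF n Wpos _ B d] True by (simp add: inner_diff_right)
  qed (use c0 in simp)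
  have "(\<Sum>i<n. of_bool (\<delta> i) * (d \<bullet> z i - ln (Phi_n n t z (t i) (\<beta> + d) / Phi_n n t z (t i) \<beta>)))
      \<le> (\<Sum>i<n. of_bool (\<delta> i) * (d \<bullet> (z i - risk_mean n t z \<beta> (t i))) - of_bool (\<delta> i) * risk_var n t z \<beta> (t i) d / 2 + ?c)"
    by (intro sum_mono term_le) simp
  also have "\<dots> = (\<Sum>i<n. of_bool (\<delta> i) * (d \<bullet> (z i - risk_mean n t z \<beta> (t i))))
      - (\<Sum>i<n. of_bool (\<delta> i) * risk_var n t z \<beta> (t i) d) / 2 + n * ?c"
    by (simp only: sum.distrib sum_subtractf sum_divide_distrib) simp
  finally have "(1 / n) * (\<Sum>i<n. of_bool (\<delta> i) * (d \<bullet> z i - ln (Phi_n n t z (t i) (\<beta> + d) / Phi_n n t z (t i) \<beta>)))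
      \<le> (1 / n) * ((\<Sum>i<n. of_bool (\<delta> i) * (d \<bullet> (z i - risk_mean n t z \<beta> (t i))))
      - (\<Sum>i<n. of_bool (\<delta> i) * risk_var n t z \<beta> (t i) d) / 2 + n * ?c)"
    by (intro mult_left_mono) auto
  also have "\<dots> = d \<bullet> score n t \<delta> z \<beta> - observed_information n t \<delta> z \<beta> d / 2 + ?c"
    using n by (simp add: score_def observed_information_def inner_sum_right add_divide_distrib diff_divide_distrib)
  finally show ?thesis
    unfolding log_likelihood_gain_def .
qed

text \<open>Up to the radius \<open>r\<close> the cubic error is at most half of the quadratic term, so the gain is negative on the
sphere of radius \<open>r\<close> as soon as the score is small; along each ray it then stays negative outside.
Hence a maximum over the ball is a global maximum, and comparing the gain at a maximizer with its
value 0 at the true parameter gives the bound.\<close>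
lemma estimator_near_truth:
  fixes z :: "nat \<Rightarrow> real ^ 'd::finite" and b \<beta> :: "real ^ 'd" and n t \<delta>
  defines "L \<equiv> partial_likelihood n t \<delta> z"
  assumes n: "n \<ge> 1" and inj: "inj_on t {i. i < n \<and> \<delta> i}"
    and \<phi>: "0 < \<phi>" "\<And>i. i < n \<Longrightarrow> \<delta> i \<Longrightarrow> \<phi> \<le> Phi_n n t z (t i) \<beta>"
    and H: "(\<Sum>j<n. exp (\<beta> \<bullet> z j) * (1 + norm (z j)) ^ 3) / n \<le> H"
    and B: "B = (1 + H / \<phi>) ^ 3 * (H / \<phi>)"
    and l: "0 < l" "\<And>d. l * (norm d)\<^sup>2 \<le> observed_information n t \<delta> z \<beta> d"
    and r: "0 < r" "r \<le> 1" "B * r\<^sup>2 \<le> 1 / 2" "(B\<^sup>2 + B) * r \<le> l / 4"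
    and U: "norm (score n t \<delta> z \<beta>) < l * r / 4"
    and b: "(\<exists>\<beta>'. is_maximizer L \<beta>') \<Longrightarrow> is_maximizer L b"
  shows "norm (b - \<beta>) \<le> 4 * norm (score n t \<delta> z \<beta>) / l"
proof -
  let ?g = "log_likelihood_gain n t \<delta> z \<beta>" and ?U = "score n t \<delta> z \<beta>"
  have B0: "0 \<le> B"
  proof -
    have "0 \<le> H"
      by (rule order_trans[OF _ H]) (auto intro!: divide_nonneg_nonneg sum_nonneg)
    then show ?thesis
      using \<phi>(1) by (simp add: B)
  qed
  have L: "L (\<beta> + d) = L \<beta> * exp (n * ?g d)" for d
    unfolding L_def by (rule partial_likelihood_gain[OF n inj])
  have Lpos: "0 < L b'" for b'
    unfolding L_def by (rule partial_likelihood_pos)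
  have L_le: "L (\<beta> + d) \<le> L (\<beta> + d') \<longleftrightarrow> ?g d \<le> ?g d'" for d d'
    using Lpos[of \<beta>] n by (simp add: L)
  have g0: "?g 0 = 0"
    using L[of 0] Lpos[of \<beta>] n by simp
  have near: "?g d \<le> norm d * (norm ?U - l * norm d / 4)" if d: "norm d \<le> r" for d
  proof -
    have "B * (norm d)\<^sup>2 \<le> B * r\<^sup>2"
      using d B0 by (intro mult_left_mono power_mono) auto
    then have "?g d \<le> d \<bullet> ?U - observed_information n t \<delta> z \<beta> d / 2 + (B\<^sup>2 + B) * norm d ^ 3"
      using r d by (intro log_likelihood_gain_le[OF n \<phi> H B]) auto
    moreover have "d \<bullet> ?U \<le> norm d * norm ?U"
      by (rule norm_cauchy_schwarz)
    moreover have "observed_information n t \<delta> z \<beta> d / 2 \<ge> l * (norm d)\<^sup>2 / 2"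
      using l(2)[of d] by simp
    moreover have "(B\<^sup>2 + B) * norm d ^ 3 \<le> l / 4 * (norm d)\<^sup>2"
    proof -
      have "(B\<^sup>2 + B) * norm d ^ 3 = ((B\<^sup>2 + B) * norm d) * (norm d)\<^sup>2"
        by (simp add: power2_eq_square power3_eq_cube)
      also have "(B\<^sup>2 + B) * norm d \<le> (B\<^sup>2 + B) * r"
        using d B0 by (intro mult_left_mono) auto
      finally show ?thesis
        using r(4) by (meson mult_right_mono order_trans zero_le_power2)
    qed
    ultimately have "?g d \<le> norm d * norm ?U - l * (norm d)\<^sup>2 / 2 + l / 4 * (norm d)\<^sup>2"
      by linarith
    then show ?thesis
      by (simp add: power2_eq_square algebra_simps)
  qed
  have far: "?g d < 0" if d: "r \<le> norm d" for d
  proof -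
    define a where "a = norm d / r"
    define d' where "d' = (r / norm d) *\<^sub>R d"
    have a: "1 \<le> a" and d': "d = a *\<^sub>R d'" "norm d' = r"
      using d r(1) by (auto simp: a_def d'_def)
    have "?g d' \<le> r * (norm ?U - l * r / 4)"
      using near[of d'] d' by simp
    also have "\<dots> < 0"
      using U r(1) by (simp add: mult_less_0_iff)
    finally have "a * ?g d' < 0"
      using a by (simp add: mult_less_0_iff)
    then show ?thesis
      using log_likelihood_gain_superhomogeneous[OF n a, of t \<delta> z \<beta> d'] d'(1) by simp
  qed
  obtain d0 where d0: "d0 \<in> cball 0 r" "\<And>d. d \<in> cball 0 r \<Longrightarrow> ?g d \<le> ?g d0"
    using continuous_attains_sup[OF compact_cball, of 0 r ?g] continuous_log_likelihood_gain r(1) by force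
  have "?g d \<le> ?g d0" for d
  proof (cases "norm d \<le> r")
    case False
    then have "?g d < ?g 0"
      using far[of d] g0 by simp
    also have "\<dots> \<le> ?g d0"
      using d0(2)[of 0] r(1) by simp
    finally show ?thesis by simp
  qed (use d0(2)[of d] in simp)
  then have "is_maximizer L (\<beta> + d0)"
    unfolding is_maximizer_def using L_le[of "_ - \<beta>" d0] by simp
  then have "is_maximizer L b"
    using b by blast
  then have "?g 0 \<le> ?g (b - \<beta>)"
    unfolding is_maximizer_def using L_le[of 0 "b - \<beta>"] by simp
  then have g: "0 \<le> ?g (b - \<beta>)"
    using g0 by simp
  then have "norm (b - \<beta>) \<le> r"
    using far[of "b - \<beta>"] by force
  then have "0 \<le> norm (b - \<beta>) * (norm ?U - l * norm (b - \<beta>) / 4)"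
    using g near[of "b - \<beta>"] by linarith
  then have "norm (b - \<beta>) = 0 \<or> l * norm (b - \<beta>) / 4 \<le> norm ?U"
    by (auto simp: zero_le_mult_iff)
  then show ?thesis
    using l(1) by (auto simp: field_simps)
qed

lemma abs_exp_minus_1_le: "\<bar>exp x - 1\<bar> \<le> \<bar>x\<bar> * exp \<bar>x\<bar>" for x :: real
proof (cases "0 \<le> x")
  case True
  have "1 + - x \<le> exp (- x)"
    by (rule exp_ge_add_one_self)
  then have "(1 - x) * exp x \<le> exp (- x) * exp x"
    by (intro mult_right_mono) auto
  then have "exp x - 1 \<le> x * exp x"
    by (simp add: exp_minus algebra_simps)
  then show ?thesis using True by simp
next
  case False
  moreover have "1 - exp x \<le> - x"
    using exp_ge_add_one_self[of x] by linarith
  ultimately have "\<bar>exp x - 1\<bar> \<le> \<bar>x\<bar> * 1"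
    unfolding mult_1_right abs_if by auto
  also have "\<dots> \<le> \<bar>x\<bar> * exp \<bar>x\<bar>"
    by (intro mult_left_mono) auto
  finally show ?thesis .
qed

lemma Phi_n_lipschitz:
  fixes z :: "nat \<Rightarrow> real ^ 'd::finite"
  assumes H: "(\<Sum>j<n. exp (\<beta> \<bullet> z j + \<rho> * norm (z j)) * (1 + norm (z j)) ^ 3) / n \<le> H"
    and b: "norm (b - \<beta>) \<le> \<rho>"
  shows "\<bar>Phi_n n t z u b - Phi_n n t z u \<beta>\<bar> \<le> H * norm (b - \<beta>)"
proof -
  have term_le: "\<bar>of_bool (u \<le> t j) * exp (b \<bullet> z j) - of_bool (u \<le> t j) * exp (\<beta> \<bullet> z j)\<bar>
      \<le> norm (b - \<beta>) * (exp (\<beta> \<bullet> z j + \<rho> * norm (z j)) * (1 + norm (z j)) ^ 3)" for j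
  proof -
    let ?x = "(b - \<beta>) \<bullet> z j"
    have x: "\<bar>?x\<bar> \<le> norm (b - \<beta>) * norm (z j)"
      by (rule Cauchy_Schwarz_ineq2)
    also have "\<dots> \<le> \<rho> * norm (z j)"
      using b by (intro mult_right_mono) auto
    finally have x2: "\<bar>?x\<bar> \<le> \<rho> * norm (z j)" .
    have z: "norm (z j) \<le> (1 + norm (z j)) ^ 3"
      by (rule order_trans[OF _ self_le_power]) auto
    have "\<bar>of_bool (u \<le> t j) * exp (b \<bullet> z j) - of_bool (u \<le> t j) * exp (\<beta> \<bullet> z j)\<bar>
        \<le> \<bar>exp (b \<bullet> z j) - exp (\<beta> \<bullet> z j)\<bar>"
      by auto
    also have "exp (b \<bullet> z j) - exp (\<beta> \<bullet> z j) = exp (\<beta> \<bullet> z j) * (exp ?x - 1)"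
      by (simp add: inner_diff_left exp_diff right_diff_distrib)
    also have "\<bar>\<dots>\<bar> = exp (\<beta> \<bullet> z j) * \<bar>exp ?x - 1\<bar>"
      by (simp add: abs_mult)
    also have "\<dots> \<le> exp (\<beta> \<bullet> z j) * (\<bar>?x\<bar> * exp \<bar>?x\<bar>)"
      by (intro mult_left_mono abs_exp_minus_1_le) auto
    also have "\<dots> \<le> exp (\<beta> \<bullet> z j) * ((norm (b - \<beta>) * norm (z j)) * exp (\<rho> * norm (z j)))"
      using x x2 by (intro mult_left_mono mult_mono) auto
    also have "\<dots> = norm (b - \<beta>) * (exp (\<beta> \<bullet> z j + \<rho> * norm (z j)) * norm (z j))"
      by (simp add: exp_add)
    also have "\<dots> \<le> norm (b - \<beta>) * (exp (\<beta> \<bullet> z j + \<rho> * norm (z j)) * (1 + norm (z j)) ^ 3)"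
      using z by (intro mult_left_mono) auto
    finally show ?thesis .
  qed
  have "\<bar>Phi_n n t z u b - Phi_n n t z u \<beta>\<bar>
      = (1 / n) * \<bar>\<Sum>j<n. of_bool (u \<le> t j) * exp (b \<bullet> z j) - of_bool (u \<le> t j) * exp (\<beta> \<bullet> z j)\<bar>"
    by (simp add: Phi_n_def sum_subtractf diff_divide_distrib[symmetric])
  also have "\<dots> \<le> (1 / n) * (\<Sum>j<n. norm (b - \<beta>) * (exp (\<beta> \<bullet> z j + \<rho> * norm (z j)) * (1 + norm (z j)) ^ 3))"
    by (intro mult_left_mono order_trans[OF sum_abs] sum_mono term_le) auto
  also have "\<dots> = norm (b - \<beta>) * ((\<Sum>j<n. exp (\<beta> \<bullet> z j + \<rho> * norm (z j)) * (1 + norm (z j)) ^ 3) / n)"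
    by (simp add: sum_distrib_left[symmetric])
  also have "\<dots> \<le> norm (b - \<beta>) * H"
    by (intro mult_left_mono H) auto
  finally show ?thesis by (simp add: mult.commute)
qed

text \<open>The estimator is compared with the same sum in which the weights \<open>1 / Phi_n\<close> are replaced by their
limits; the difference has one part from the estimated parameter and one from averaging.\<close>
lemma breslow_perturbation:
  fixes z :: "nat \<Rightarrow> real ^ 'd::finite"
  assumes n: "n \<ge> 1"
    and H: "(\<Sum>j<n. exp (\<beta> \<bullet> z j + \<rho> * norm (z j)) * (1 + norm (z j)) ^ 3) / n \<le> H"
    and b: "norm (b - \<beta>) \<le> \<rho>" "H * norm (b - \<beta>) \<le> \<phi> / 2"
    and \<phi>: "0 < \<phi>" "\<And>i. i < n \<Longrightarrow> \<delta> i \<Longrightarrow> \<phi> \<le> Phi_n n t z (t i) \<beta>"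
    and \<Phi>: "\<And>i. i < n \<Longrightarrow> \<delta> i \<Longrightarrow> \<phi> \<le> \<Phi> (t i)"
      "\<And>i. i < n \<Longrightarrow> \<delta> i \<Longrightarrow> \<bar>Phi_n n t z (t i) \<beta> - \<Phi> (t i)\<bar> \<le> e"
    and e: "0 \<le> e"
  shows "\<bar>breslow n t \<delta> z b s - (\<Sum>i<n. of_bool (\<delta> i \<and> t i \<le> s) / \<Phi> (t i)) / n\<bar>
    \<le> 2 / \<phi>\<^sup>2 * (H * norm (b - \<beta>) + e)"
proof -
  let ?c = "2 / \<phi>\<^sup>2 * (H * norm (b - \<beta>) + e)"
  have H0: "0 \<le> H"
    by (rule order_trans[OF _ H]) (auto intro!: divide_nonneg_nonneg sum_nonneg)
  have term_le: "\<bar>of_bool (\<delta> i) * of_bool (t i \<le> s) / Phi_n n t z (t i) b - of_bool (\<delta> i \<and> t i \<le> s) / \<Phi> (t i)\<bar> \<le> ?c"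
    if i: "i < n" for i
  proof (cases "\<delta> i \<and> t i \<le> s")
    case True
    then have \<delta>: "\<delta> i" by simp
    let ?p = "Phi_n n t z (t i) b" and ?q = "\<Phi> (t i)"
    have d: "\<bar>?p - Phi_n n t z (t i) \<beta>\<bar> \<le> H * norm (b - \<beta>)"
      by (rule Phi_n_lipschitz[OF H b(1)])
    have p: "\<phi> / 2 \<le> ?p"
      using d b(2) \<phi>(2)[OF i \<delta>] by linarith
    have q: "\<phi> \<le> ?q"
      using \<Phi>(1)[OF i \<delta>] .
    have pq: "\<bar>?q - ?p\<bar> \<le> H * norm (b - \<beta>) + e"
      using d \<Phi>(2)[OF i \<delta>] by linarith
    have "\<bar>1 / ?p - 1 / ?q\<bar> = \<bar>?q - ?p\<bar> / (?p * ?q)"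
      using p q \<phi>(1) by (simp add: diff_frac_eq abs_mult)
    also have "\<dots> \<le> (H * norm (b - \<beta>) + e) / (\<phi> / 2 * \<phi>)"
      using p q \<phi>(1) pq by (intro frac_le mult_mono) auto
    also have "\<dots> = ?c"
      by (simp add: power2_eq_square)
    finally show ?thesis using True by simp
  next
    case False
    moreover have "0 \<le> ?c"
      using H0 e by simp
    ultimately show ?thesis by auto
  qed
  have "\<bar>breslow n t \<delta> z b s - (\<Sum>i<n. of_bool (\<delta> i \<and> t i \<le> s) / \<Phi> (t i)) / n\<bar>
      = (1 / n) * \<bar>\<Sum>i<n. of_bool (\<delta> i) * of_bool (t i \<le> s) / Phi_n n t z (t i) b - of_bool (\<delta> i \<and> t i \<le> s) / \<Phi> (t i)\<bar>"
    unfolding breslow_def by (simp add: sum_subtractf diff_divide_distrib[symmetric])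
  also have "\<dots> \<le> (1 / n) * (\<Sum>i<n. ?c)"
    by (intro mult_left_mono order_trans[OF sum_abs] sum_mono term_le) auto
  also have "\<dots> = ?c"
    using n by simp
  finally show ?thesis .
qed

section \<open>The law of the observed event in the Cox model\<close>

lemma measure_eqI_rectangles:
  assumes sets: "sets \<mu> = sets (A \<Otimes>\<^sub>M B)" "sets \<nu> = sets (A \<Otimes>\<^sub>M B)"
    and fin: "emeasure \<mu> (space A \<times> space B) \<noteq> \<infinity>"
    and eq: "\<And>a b. a \<in> sets A \<Longrightarrow> b \<in> sets B \<Longrightarrow> emeasure \<mu> (a \<times> b) = emeasure \<nu> (a \<times> b)"
  shows "\<mu> = \<nu>"
proof (rule measure_eqI_generator_eq[OF Int_stable_pair_measure_generator[of A B]])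
  show "{a \<times> b |a b. a \<in> sets A \<and> b \<in> sets B} \<subseteq> Pow (space A \<times> space B)"
    by (rule pair_measure_closed)
  show "range (\<lambda>_::nat. space A \<times> space B) \<subseteq> {a \<times> b |a b. a \<in> sets A \<and> b \<in> sets B}"
    by auto
  show "\<And>X. X \<in> {a \<times> b |a b. a \<in> sets A \<and> b \<in> sets B} \<Longrightarrow> emeasure \<mu> X = emeasure \<nu> X"
    using eq by blast
  show "(\<Union>i::nat. space A \<times> space B) = space A \<times> space B"
    by simp
  show "emeasure \<mu> (space A \<times> space B) \<noteq> \<infinity>"
    by (rule fin)
qed (simp_all only: sets sets_pair_measure)

text \<open>A function that is right continuous in its first argument is the limit of its values at the next
point of a grid of mesh \<open>1 / Suc k\<close>.\<close>
lemma borel_measurable_right_continuous: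
  fixes H :: "real \<Rightarrow> 'b \<Rightarrow> real"
  assumes meas: "\<And>t. H t \<in> borel_measurable N"
    and cont: "\<And>t z. ((\<lambda>s. H s z) \<longlongrightarrow> H t z) (at_right t)"
  shows "(\<lambda>(t, z). H t z) \<in> borel_measurable (borel \<Otimes>\<^sub>M N)"
proof (rule borel_measurable_LIMSEQ_real)
  define a where "a k t = real_of_int (\<lfloor>t * Suc k\<rfloor> + 1) / Suc k" for k :: nat and t :: real
  show "(\<lambda>k. (\<lambda>(t, z). H (a k t) z) p) \<longlonglongrightarrow> (\<lambda>(t, z). H t z) p" for p
  proof -
    obtain t z where p: "p = (t, z)" by (cases p)
    have gt: "t < a k t" and le: "a k t \<le> t + 1 / Suc k" for k
    proof -
      have "t * Suc k < \<lfloor>t * Suc k\<rfloor> + 1" "\<lfloor>t * Suc k\<rfloor> + 1 \<le> t * Suc k + 1"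
        by linarith+
      then have "t * Suc k / Suc k < (\<lfloor>t * Suc k\<rfloor> + 1) / Suc k"
        "(\<lfloor>t * Suc k\<rfloor> + 1) / Suc k \<le> (t * Suc k + 1) / Suc k"
        by (intro divide_strict_right_mono divide_right_mono; simp)+
      then show "t < a k t" "a k t \<le> t + 1 / Suc k"
        unfolding a_def by (simp_all add: add_divide_distrib)
    qed
    have "(\<lambda>k. a k t) \<longlonglongrightarrow> t"
    proof (rule tendsto_sandwich[of "\<lambda>_. t" _ _ "\<lambda>k. t + 1 / Suc k"])
      show "(\<lambda>k. t + 1 / real (Suc k)) \<longlonglongrightarrow> t"
        using tendsto_add[OF tendsto_const[of t] LIMSEQ_inverse_real_of_nat] by (simp add: inverse_eq_divide)
      show "eventually (\<lambda>k. t \<le> a k t) sequentially"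
        using gt by (intro always_eventually allI less_imp_le)
      show "eventually (\<lambda>k. a k t \<le> t + 1 / Suc k) sequentially"
        using le by (intro always_eventually allI)
    qed (rule tendsto_const)
    moreover have "eventually (\<lambda>k. a k t \<in> {t<..} - {t}) sequentially"
      using gt by (intro always_eventually allI) (auto simp: less_le)
    ultimately have "filterlim (\<lambda>k. a k t) (at_right t) sequentially"
      by (intro filterlim_at_withinI)
    then show ?thesis
      using filterlim_compose[OF cont[of z t]] by (simp add: p)
  qed
  show "(\<lambda>(t, z). H (a k t) z) \<in> borel_measurable (borel \<Otimes>\<^sub>M N)" for k
  proof -
    have "(\<lambda>p. H (real_of_int (\<lfloor>fst p * real (Suc k)\<rfloor> + 1) / Suc k) (snd p)) \<in> borel_measurable (borel \<Otimes>\<^sub>M N)"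
    proof (rule measurable_compose_countable[where g = "\<lambda>p. \<lfloor>fst p * real (Suc k)\<rfloor>"])
      show "(\<lambda>p. H (real_of_int (i + 1) / Suc k) (snd p)) \<in> borel_measurable (borel \<Otimes>\<^sub>M N)" for i :: int
        by (rule measurable_compose[OF measurable_snd meas])
      have "(\<lambda>p. fst p * real (Suc k)) \<in> borel_measurable (borel \<Otimes>\<^sub>M N)"
        by (intro borel_measurable_times borel_measurable_const measurable_fst)
      then show "(\<lambda>p. \<lfloor>fst p * real (Suc k)\<rfloor>) \<in> measurable (borel \<Otimes>\<^sub>M N) (count_space UNIV)"
        by (rule measurable_compose[OF _ measurable_real_floor])
    qed
    then show ?thesis
      by (simp add: a_def split_beta')
  qed
qed

context cox_model
begin

lemma [measurable]: "X \<in> borel_measurable M" "C \<in> borel_measurable M" "Z \<in> borel_measurable M"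
  using X_rv C_rv Z_rv by auto

lemma F_measurable [measurable]: "F t \<in> borel_measurable borel"
  using F_cdf by (simp add: cond_distribution_function_def)

lemma F_real_distribution: "\<exists>N. real_distribution N \<and> (\<forall>t. cdf N t = F t z)"
  using F_cdf unfolding cond_distribution_function_def by blast

lemma F_mono: "s \<le> t \<Longrightarrow> F s z \<le> F t z"
  and F_nonneg: "0 \<le> F t z" and F_le_1: "F t z \<le> 1"
  and F_right_cont: "((\<lambda>s. F s z) \<longlongrightarrow> F t z) (at_right t)"
proof -
  obtain N where N: "real_distribution N" "\<And>t. cdf N t = F t z"
    using F_real_distribution[of z] by blast
  interpret N: real_distribution N by fact
  show "s \<le> t \<Longrightarrow> F s z \<le> F t z" "0 \<le> F t z" "F t z \<le> 1"
    unfolding N(2)[symmetric] by (auto intro: N.cdf_nondecreasing N.cdf_nonneg N.cdf_bounded_prob)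
  show "((\<lambda>s. F s z) \<longlongrightarrow> F t z) (at_right t)"
    using N.cdf_is_right_cont[of t] unfolding N(2)[symmetric] continuous_within by simp
qed

lemma F_joint_measurable [measurable]: "(\<lambda>(t, z). F t z) \<in> borel_measurable (borel \<Otimes>\<^sub>M borel)"
  by (intro borel_measurable_right_continuous F_measurable F_right_cont)

text \<open>An infinite measure would make the real-valued distribution function \<open>F\<close>, defined by the density,
equal to 0 from some point on, although \<open>F\<close> tends to 1.\<close>
lemma emeasure_density_atMost: "emeasure (density lborel (\<lambda>u. ennreal (f u z))) {..t} = ennreal (F t z)"
proof -
  let ?D = "density lborel (\<lambda>u. ennreal (f u z))"
  have [measurable]: "(\<lambda>u. f u z) \<in> borel_measurable borel"
    by (rule f_measurable)
  obtain N where N: "real_distribution N" "\<And>t. cdf N t = F t z"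
    using F_real_distribution[of z] by blast
  interpret N: real_distribution N by fact
  have "emeasure ?D {..t} \<noteq> \<infinity>"
  proof
    assume inf: "emeasure ?D {..t} = \<infinity>"
    have "cdf N s = 0" if "t \<le> s" for s
    proof -
      have "emeasure ?D {..t} \<le> emeasure ?D {..s}"
        using that by (intro emeasure_mono) auto
      then show ?thesis
        using inf by (simp only: N(2) f_density) (simp add: cdf_def measure_def top_unique)
    qed
    then have "eventually (\<lambda>s. cdf N s = 0) at_top"
      by (auto simp: eventually_at_top_linorder)
    then have "(cdf N \<longlongrightarrow> 0) at_top"
      by (rule tendsto_eventually)
    then have "(0::real) = 1"
      using N.cdf_lim_at_top_prob by (rule tendsto_unique[OF trivial_limit_at_top_linorder])
    then show False
      by simp
  qed
  then show ?thesis
    unfolding f_density cdf_def by (intro emeasure_eq_ennreal_measure) auto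
qed

lemma emeasure_density_Ioc:
  assumes "s \<le> t"
  shows "emeasure (density lborel (\<lambda>u. ennreal (f u z))) {s<..t} = ennreal (F t z - F s z)"
proof -
  let ?D = "density lborel (\<lambda>u. ennreal (f u z))"
  have split: "{s<..t} = {..t} - {..s}"
    by auto
  have "emeasure ?D {s<..t} = emeasure ?D {..t} - emeasure ?D {..s}"
    unfolding split
  proof (rule emeasure_Diff)
    show "{..s} \<subseteq> {..t}"
      using assms by auto
  qed (simp_all add: emeasure_density_atMost)
  then show ?thesis
    by (simp add: emeasure_density_atMost ennreal_minus F_nonneg)
qed

text \<open>Beyond the point where \<open>F\<close> reaches 1 the hazard says nothing about \<open>f\<close>, but there the density
  vanishes almost everywhere.\<close>

lemma density_eq_hazard:
  "AE u in lborel. 0 \<le> u \<longrightarrow> ereal u < right_endpoint M X \<longrightarrow>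
     f u z = lambda0 u * exp (\<beta>\<^sub>0 \<bullet> z) * (1 - F u z)"
proof -
  have [measurable]: "(\<lambda>u. f u z) \<in> borel_measurable borel"
    by (rule f_measurable)
  have "AE u in lborel. q < u \<longrightarrow> f u z = 0" if q: "F q z = 1" for q
  proof -
    have "(\<integral>\<^sup>+u. ennreal (f u z) * indicator {q<..q + real k} u \<partial>lborel) = 0" for k :: nat
      using emeasure_density_Ioc[of q "q + real k" z] F_mono[of q "q + real k" z] F_le_1[of "q + real k" z] q
      by (simp add: emeasure_density ennreal_neg)
    then have "AE u in lborel. ennreal (f u z) * indicator {q<..q + real k} u = 0" for k :: nat
      by (subst (asm) nn_integral_0_iff_AE) auto
    then have "AE u in lborel. \<forall>k::nat. ennreal (f u z) * indicator {q<..q + real k} u = 0"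
      by (subst AE_all_countable) blast
    then show ?thesis
    proof eventually_elim
      case (elim u)
      obtain k :: nat where k: "u - q \<le> real k"
        using real_arch_simple by blast
      show ?case
      proof
        assume "q < u"
        then have "ennreal (f u z) = 0"
          using elim[rule_format, of k] k by (auto simp: indicator_def)
        then show "f u z = 0"
          using f_nonneg[of u z] by (simp add: ennreal_eq_0_iff)
      qed
    qed
  qed
  then have 1: "AE u in lborel. \<forall>q\<in>{q\<in>\<rat>. F q z = 1}. q < u \<longrightarrow> f u z = 0"
    by (subst AE_ball_countable) (auto intro: countable_subset[OF _ countable_rat])
  have "\<exists>c. \<forall>u. F u z = 1 \<longrightarrow> u \<noteq> c \<longrightarrow> (\<exists>q\<in>{q\<in>\<rat>. F q z = 1}. q < u)"
  proof (cases "\<exists>c. F c z = 1 \<and> \<not> (\<exists>q\<in>{q\<in>\<rat>. F q z = 1}. q < c)")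
    case True
    then obtain c where c: "F c z = 1" "\<not> (\<exists>q\<in>{q\<in>\<rat>. F q z = 1}. q < c)" by blast
    have "\<exists>q\<in>{q\<in>\<rat>. F q z = 1}. q < u" if u: "F u z = 1" "u \<noteq> c" for u
    proof -
      have "c < u \<or> u < c" using u(2) by linarith
      then show ?thesis
      proof
        assume "c < u"
        then obtain q where "q \<in> \<rat>" "c < q" "q < u"
          using Rats_dense_in_real by blast
        then show ?thesis
          using c(1) F_mono[of c q z] F_le_1[of q z] by force
      next
        assume "u < c"
        then obtain q where "q \<in> \<rat>" "u < q" "q < c"
          using Rats_dense_in_real by blast
        then show ?thesis
          using c(2) u(1) F_mono[of u q z] F_le_1[of q z] by force
      qed
    qed
    then show ?thesis by blast
  qed blast
  then obtain c where c: "\<And>u. F u z = 1 \<Longrightarrow> u \<noteq> c \<Longrightarrow> \<exists>q\<in>{q\<in>\<rat>. F q z = 1}. q < u"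
    by blast
  have 2: "AE u in lborel. u \<noteq> c"
    by (rule AE_lborel_singleton)
  show ?thesis
    using 1 2
  proof eventually_elim
    case (elim u)
    show ?case
    proof (intro impI)
      assume u: "0 \<le> u" "ereal u < right_endpoint M X"
      show "f u z = lambda0 u * exp (\<beta>\<^sub>0 \<bullet> z) * (1 - F u z)"
      proof (cases "F u z = 1")
        case True
        then have "f u z = 0"
          using c[of u] elim by blast
        then show ?thesis using True by simp
      next
        case False
        then show ?thesis
          using hazard_eq[OF u, of z] by (simp add: hazard_def field_simps)
      qed
    qed
  qed
qed

text \<open>The integrated hazard identity.  The density itself need not be jointly measurable in time and
covariate; its expression by the hazard is, up to null sets, and replaces it from here on.\<close>
lemma F_increment:
  assumes "0 \<le> s" "s \<le> t" "ereal t < right_endpoint M X"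
  shows "ennreal (F t z - F s z)
    = (\<integral>\<^sup>+u. ennreal (lambda0 u * exp (\<beta>\<^sub>0 \<bullet> z) * (1 - F u z)) * indicator {s<..t} u \<partial>lborel)"
proof -
  have [measurable]: "(\<lambda>u. f u z) \<in> borel_measurable borel"
    by (rule f_measurable)
  have "ennreal (F t z - F s z) = (\<integral>\<^sup>+u. ennreal (f u z) * indicator {s<..t} u \<partial>lborel)"
    using emeasure_density_Ioc[OF assms(2), of z] by (simp add: emeasure_density)
  also have "\<dots> = (\<integral>\<^sup>+u. ennreal (lambda0 u * exp (\<beta>\<^sub>0 \<bullet> z) * (1 - F u z)) * indicator {s<..t} u \<partial>lborel)"
  proof (intro nn_integral_cong_AE)
    show "AE u in lborel. ennreal (f u z) * indicator {s<..t} u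
        = ennreal (lambda0 u * exp (\<beta>\<^sub>0 \<bullet> z) * (1 - F u z)) * indicator {s<..t} u"
      using density_eq_hazard[of z]
    proof eventually_elim
      case (elim u)
      show ?case
      proof (cases "u \<in> {s<..t}")
        case True
        then have "0 \<le> u" "ereal u < right_endpoint M X"
          using assms by (auto intro: le_less_trans[OF _ assms(3)])
        then show ?thesis using elim by simp
      qed simp
    qed
  qed
  finally show ?thesis .
qed

text \<open>The conditional law of \<open>X\<close> has no atom at 0.  Together with \<open>X_nonneg\<close> this makes \<open>X\<close> positive.\<close>
lemma F_0_eq_lim: "(\<lambda>k. F (- (1 / Suc k)) z) \<longlonglongrightarrow> F 0 z"
proof -
  let ?D = "density lborel (\<lambda>u. ennreal (f u z))"
  have [measurable]: "(\<lambda>u. f u z) \<in> borel_measurable borel"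
    by (rule f_measurable)
  have U: "(\<Union>k. {..- (1 / real (Suc k))}) = {..<0::real}"
  proof (intro equalityI subsetI)
    fix x :: real assume "x \<in> {..<0}"
    then obtain k where "inverse (real (Suc k)) < - x"
      using reals_Archimedean[of "- x"] by auto
    then have "x \<in> {..- (1 / real (Suc k))}"
      by (simp add: inverse_eq_divide)
    then show "x \<in> (\<Union>k. {..- (1 / real (Suc k))})" by blast
  next
    fix x :: real assume "x \<in> (\<Union>k. {..- (1 / real (Suc k))})"
    then obtain k where "x \<le> - (1 / real (Suc k))"
      by auto
    moreover have "0 < 1 / real (Suc k)"
      by simp
    ultimately have "x < 0"
      by linarith
    then show "x \<in> {..<0}"
      by simp
  qed
  have "(\<lambda>k. emeasure ?D {..- (1 / real (Suc k))}) \<longlonglongrightarrow> emeasure ?D (\<Union>k. {..- (1 / real (Suc k))})"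
  proof (rule Lim_emeasure_incseq)
    show "incseq (\<lambda>k. {..- (1 / real (Suc k))})"
    proof (rule incseq_SucI)
      fix k :: nat
      have "1 / real (Suc (Suc k)) \<le> 1 / real (Suc k)"
        by (intro divide_left_mono) auto
      then show "{..- (1 / real (Suc k))} \<subseteq> {..- (1 / real (Suc (Suc k)))}"
        by (simp only: atMost_subset_iff neg_le_iff_le)
    qed
    show "range (\<lambda>k. {..- (1 / real (Suc k))}) \<subseteq> sets ?D"
      by (simp add: image_subset_iff)
  qed
  moreover have "emeasure ?D {..<0} = emeasure ?D {..0}"
  proof (rule emeasure_eq_AE)
    have "AE u in lborel. u \<noteq> (0::real)"
      by (rule AE_lborel_singleton)
    then have "AE u in lborel. 0 < ennreal (f u z) \<longrightarrow> (u \<in> {..<0} \<longleftrightarrow> u \<in> {..0})"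
      by eventually_elim auto
    then show "AE u in ?D. u \<in> {..<0} \<longleftrightarrow> u \<in> {..0}"
      by (subst AE_density) auto
  qed auto
  ultimately have "(\<lambda>k. ennreal (F (- (1 / Suc k)) z)) \<longlonglongrightarrow> ennreal (F 0 z)"
    unfolding U by (simp add: emeasure_density_atMost)
  then show ?thesis
    by (subst (asm) tendsto_ennreal_iff) (auto simp: F_nonneg)
qed

end

context prob_space
begin

lemma nn_integral_eq_from_rectangles:
  fixes a b :: "'a \<Rightarrow> real"
  assumes [measurable]: "Y \<in> measurable M A" "Y' \<in> measurable M B"
    and [measurable]: "a \<in> borel_measurable M" "b \<in> borel_measurable M"
    and a: "\<And>\<omega>. 0 \<le> a \<omega>" "\<And>\<omega>. a \<omega> \<le> 1" and b: "\<And>\<omega>. 0 \<le> b \<omega>" "\<And>\<omega>. b \<omega> \<le> 1"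
    and eq: "\<And>D E. D \<in> sets A \<Longrightarrow> E \<in> sets B \<Longrightarrow>
      expectation (\<lambda>\<omega>. a \<omega> * (indicator D (Y \<omega>) * indicator E (Y' \<omega>)))
      = expectation (\<lambda>\<omega>. b \<omega> * (indicator D (Y \<omega>) * indicator E (Y' \<omega>)))"
    and [measurable]: "\<phi> \<in> borel_measurable (A \<Otimes>\<^sub>M B)"
  shows "(\<integral>\<^sup>+\<omega>. ennreal (a \<omega>) * \<phi> (Y \<omega>, Y' \<omega>) \<partial>M) = (\<integral>\<^sup>+\<omega>. ennreal (b \<omega>) * \<phi> (Y \<omega>, Y' \<omega>) \<partial>M)"
proof -
  let ?m = "\<lambda>c. distr (density M (\<lambda>\<omega>. ennreal (c \<omega>))) (A \<Otimes>\<^sub>M B) (\<lambda>\<omega>. (Y \<omega>, Y' \<omega>))"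
  have nn: "(\<integral>\<^sup>+x. \<psi> x \<partial>?m c) = (\<integral>\<^sup>+\<omega>. ennreal (c \<omega>) * \<psi> (Y \<omega>, Y' \<omega>) \<partial>M)"
    if [measurable]: "c \<in> borel_measurable M" "\<psi> \<in> borel_measurable (A \<Otimes>\<^sub>M B)" for c \<psi>
    by (simp add: nn_integral_distr nn_integral_density)
  have em: "emeasure (?m c) (D \<times> E) = ennreal (expectation (\<lambda>\<omega>. c \<omega> * (indicator D (Y \<omega>) * indicator E (Y' \<omega>))))"
    if [measurable]: "c \<in> borel_measurable M" "D \<in> sets A" "E \<in> sets B" and c: "\<And>\<omega>. 0 \<le> c \<omega>" "\<And>\<omega>. c \<omega> \<le> 1" for c D E
  proof -
    have "emeasure (?m c) (D \<times> E) = (\<integral>\<^sup>+\<omega>. ennreal (c \<omega>) * indicator (D \<times> E) (Y \<omega>, Y' \<omega>) \<partial>M)"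
      using nn[of c "indicator (D \<times> E)"] that by simp
    also have "\<dots> = (\<integral>\<^sup>+\<omega>. ennreal (c \<omega> * (indicator D (Y \<omega>) * indicator E (Y' \<omega>))) \<partial>M)"
      by (intro nn_integral_cong) (auto simp: indicator_def)
    also have "\<dots> = ennreal (expectation (\<lambda>\<omega>. c \<omega> * (indicator D (Y \<omega>) * indicator E (Y' \<omega>))))"
    proof (rule nn_integral_eq_integral)
      show "integrable M (\<lambda>\<omega>. c \<omega> * (indicator D (Y \<omega>) * indicator E (Y' \<omega>)))"
        using c by (intro integrable_const_bound[where B = 1]) (auto simp: indicator_def)
    qed (use c in auto)
    finally show ?thesis .
  qed
  have "?m a = ?m b"
  proof (rule measure_eqI_rectangles)
    show "emeasure (?m a) (space A \<times> space B) \<noteq> \<infinity>"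
      using em[of a "space A" "space B"] a by simp
    show "emeasure (?m a) (D \<times> E) = emeasure (?m b) (D \<times> E)" if "D \<in> sets A" "E \<in> sets B" for D E
      using em[of a D E] em[of b D E] a b eq that by simp
  qed simp_all
  then show ?thesis
    using nn[of a \<phi>] nn[of b \<phi>] by simp
qed

end

context cox_model
begin

text \<open>Conditional independence factors the conditional probability, and the factor \<open>F t (Z \<omega>)\<close>, a function of \<open>Z\<close>,
is pulled out again.  The conditional law of \<open>C\<close> never has to be named.\<close>
lemma cond_X_rectangle:
  assumes [measurable]: "B \<in> sets borel" "D \<in> sets borel"
  shows "expectation (\<lambda>\<omega>. indicat_real {..t} (X \<omega>) * (indicat_real B (C \<omega>) * indicat_real D (Z \<omega>)))
    = expectation (\<lambda>\<omega>. F t (Z \<omega>) * (indicat_real B (C \<omega>) * indicat_real D (Z \<omega>)))"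
proof -
  define Fz where "Fz = vimage_algebra (space M) Z borel"
  have "subalgebra M Fz"
    unfolding subalgebra_def Fz_def using measurable_sets[OF Z_rv] by (auto simp: sets_vimage_algebra2)
  then interpret S: finite_measure_subalgebra M Fz
    by unfold_locales
  have Z_F [measurable]: "Z \<in> measurable Fz borel"
    unfolding Fz_def by (rule measurable_vimage_algebra1) auto
  let ?A = "{\<omega>\<in>space M. X \<omega> \<in> {..t}}" and ?B = "{\<omega>\<in>space M. C \<omega> \<in> B}"
  let ?AB = "{\<omega>\<in>space M. X \<omega> \<in> {..t} \<and> C \<omega> \<in> B}"
  have [measurable]: "?A \<in> sets M" "?B \<in> sets M" "?AB \<in> sets M"
    by measurable
  have int: "integrable M h" if "h \<in> borel_measurable M" "\<And>\<omega>. \<bar>h \<omega>\<bar> \<le> 1" for h :: "'a \<Rightarrow> real"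
    using that by (intro integrable_const_bound[where B = 1]) auto
  have F1: "\<bar>F t (Z \<omega>)\<bar> \<le> 1" for \<omega>
    using F_nonneg[of t "Z \<omega>"] F_le_1[of t "Z \<omega>"] by simp
  have "expectation (\<lambda>\<omega>. indicat_real {..t} (X \<omega>) * (indicat_real B (C \<omega>) * indicat_real D (Z \<omega>)))
      = expectation (\<lambda>\<omega>. indicat_real D (Z \<omega>) * indicat_real ?AB \<omega>)"
    by (intro Bochner_Integration.integral_cong) (auto simp: indicator_def)
  also have "\<dots> = expectation (\<lambda>\<omega>. indicat_real D (Z \<omega>) * real_cond_exp M Fz (indicat_real ?AB) \<omega>)"
    by (intro S.real_cond_exp_intg(2)[symmetric] int) (auto simp: indicator_def)
  also have "\<dots> = expectation (\<lambda>\<omega>. (indicat_real D (Z \<omega>) * F t (Z \<omega>)) * real_cond_exp M Fz (indicat_real ?B) \<omega>)"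
  proof (rule integral_cong_AE)
    have 1: "AE \<omega> in M. real_cond_exp M Fz (indicat_real ?AB) \<omega>
        = real_cond_exp M Fz (indicat_real ?A) \<omega> * real_cond_exp M Fz (indicat_real ?B) \<omega>"
      using cond_indep[unfolded cond_indep_given_def, rule_format, of "{..t}" B] assms(1)
      by (simp only: prob_given_def Fz_def atMost_borel simp_thms)
    have 2: "AE \<omega> in M. real_cond_exp M Fz (indicat_real ?A) \<omega> = F t (Z \<omega>)"
      using F_cdf unfolding cond_distribution_function_def prob_given_def Fz_def by simp
    show "AE \<omega> in M. indicat_real D (Z \<omega>) * real_cond_exp M Fz (indicat_real ?AB) \<omega>
        = (indicat_real D (Z \<omega>) * F t (Z \<omega>)) * real_cond_exp M Fz (indicat_real ?B) \<omega>"
      using 1 2 by eventually_elim simp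
  qed measurable
  also have "\<dots> = expectation (\<lambda>\<omega>. (indicat_real D (Z \<omega>) * F t (Z \<omega>)) * indicat_real ?B \<omega>)"
    using F1 by (intro S.real_cond_exp_intg(2) int) (auto simp: indicator_def)
  also have "\<dots> = expectation (\<lambda>\<omega>. F t (Z \<omega>) * (indicat_real B (C \<omega>) * indicat_real D (Z \<omega>)))"
    by (intro Bochner_Integration.integral_cong) (auto simp: indicator_def)
  finally show ?thesis .
qed

lemma rectangle_integrable:
  fixes h :: "'a \<Rightarrow> real"
  assumes [measurable]: "B \<in> sets borel" "D \<in> sets borel" "h \<in> borel_measurable M"
    and h: "\<And>\<omega>. \<bar>h \<omega>\<bar> \<le> 1"
  shows "integrable M (\<lambda>\<omega>. h \<omega> * (indicator B (C \<omega>) * indicator D (Z \<omega>)))"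
  using h by (intro integrable_const_bound[where B = 1]) (auto simp: indicator_def)

lemma cond_X_Ioc:
  assumes "s \<le> t" and [measurable]: "\<phi> \<in> borel_measurable (borel \<Otimes>\<^sub>M borel)"
  shows "(\<integral>\<^sup>+\<omega>. indicator {s<..t} (X \<omega>) * \<phi> (C \<omega>, Z \<omega>) \<partial>M)
    = (\<integral>\<^sup>+\<omega>. ennreal (F t (Z \<omega>) - F s (Z \<omega>)) * \<phi> (C \<omega>, Z \<omega>) \<partial>M)"
proof -
  have "(\<integral>\<^sup>+\<omega>. ennreal (indicator {s<..t} (X \<omega>)) * \<phi> (C \<omega>, Z \<omega>) \<partial>M)
    = (\<integral>\<^sup>+\<omega>. ennreal (F t (Z \<omega>) - F s (Z \<omega>)) * \<phi> (C \<omega>, Z \<omega>) \<partial>M)"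
  proof (rule nn_integral_eq_from_rectangles[where A = borel and B = borel])
    show "F t (Z \<omega>) - F s (Z \<omega>) \<le> 1" for \<omega>
      using F_nonneg[of s "Z \<omega>"] F_le_1[of t "Z \<omega>"] by linarith
    fix B :: "real set" and D :: "(real ^ 'd) set"
    assume BD[measurable]: "B \<in> sets borel" "D \<in> sets borel"
    have F1: "\<bar>F u (Z \<omega>)\<bar> \<le> 1" for u \<omega>
      using F_nonneg[of u "Z \<omega>"] F_le_1[of u "Z \<omega>"] by simp
    note integrable = rectangle_integrable[OF BD]
    have "expectation (\<lambda>\<omega>. indicat_real {s<..t} (X \<omega>) * (indicator B (C \<omega>) * indicator D (Z \<omega>)))
        = expectation (\<lambda>\<omega>. indicat_real {..t} (X \<omega>) * (indicator B (C \<omega>) * indicator D (Z \<omega>))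
            - indicator {..s} (X \<omega>) * (indicator B (C \<omega>) * indicator D (Z \<omega>)))"
      using assms(1) by (intro Bochner_Integration.integral_cong) (auto simp: indicator_def)
    also have "\<dots> = expectation (\<lambda>\<omega>. F t (Z \<omega>) * (indicator B (C \<omega>) * indicator D (Z \<omega>)))
        - expectation (\<lambda>\<omega>. F s (Z \<omega>) * (indicator B (C \<omega>) * indicator D (Z \<omega>)))"
      unfolding cond_X_rectangle[OF BD, symmetric]
      by (intro Bochner_Integration.integral_diff integrable) (auto simp: indicator_def)
    also have "\<dots> = expectation (\<lambda>\<omega>. (F t (Z \<omega>) - F s (Z \<omega>)) * (indicator B (C \<omega>) * indicator D (Z \<omega>)))"
      by (subst Bochner_Integration.integral_diff[symmetric]) (auto intro!: integrable F1 simp: left_diff_distrib)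
    finally show "expectation (\<lambda>\<omega>. indicat_real {s<..t} (X \<omega>) * (indicator B (C \<omega>) * indicator D (Z \<omega>)))
        = expectation (\<lambda>\<omega>. (F t (Z \<omega>) - F s (Z \<omega>)) * (indicator B (C \<omega>) * indicator D (Z \<omega>)))" .
  qed (use F_mono[OF assms(1)] in \<open>auto simp: indicator_def\<close>)
  then show ?thesis
    by (simp add: ennreal_indicator)
qed

lemma cond_X_gt:
  assumes [measurable]: "\<phi> \<in> borel_measurable (borel \<Otimes>\<^sub>M borel)"
  shows "(\<integral>\<^sup>+\<omega>. indicator {t<..} (X \<omega>) * \<phi> (C \<omega>, Z \<omega>) \<partial>M)
    = (\<integral>\<^sup>+\<omega>. ennreal (1 - F t (Z \<omega>)) * \<phi> (C \<omega>, Z \<omega>) \<partial>M)"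
proof -
  have "(\<integral>\<^sup>+\<omega>. ennreal (indicator {t<..} (X \<omega>)) * \<phi> (C \<omega>, Z \<omega>) \<partial>M)
    = (\<integral>\<^sup>+\<omega>. ennreal (1 - F t (Z \<omega>)) * \<phi> (C \<omega>, Z \<omega>) \<partial>M)"
  proof (rule nn_integral_eq_from_rectangles[where A = borel and B = borel])
    fix B :: "real set" and D :: "(real ^ 'd) set"
    assume BD[measurable]: "B \<in> sets borel" "D \<in> sets borel"
    have F1: "\<bar>F u (Z \<omega>)\<bar> \<le> 1" for u \<omega>
      using F_nonneg[of u "Z \<omega>"] F_le_1[of u "Z \<omega>"] by simp
    note integrable = rectangle_integrable[OF BD]
    have "expectation (\<lambda>\<omega>. indicat_real {t<..} (X \<omega>) * (indicator B (C \<omega>) * indicator D (Z \<omega>)))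
        = expectation (\<lambda>\<omega>. 1 * (indicator B (C \<omega>) * indicator D (Z \<omega>))
            - indicator {..t} (X \<omega>) * (indicator B (C \<omega>) * indicator D (Z \<omega>)))"
      by (intro Bochner_Integration.integral_cong) (auto simp: indicator_def)
    also have "\<dots> = expectation (\<lambda>\<omega>. 1 * (indicator B (C \<omega>) * indicator D (Z \<omega>)))
        - expectation (\<lambda>\<omega>. F t (Z \<omega>) * (indicator B (C \<omega>) * indicator D (Z \<omega>)))"
      unfolding cond_X_rectangle[OF BD, symmetric]
      by (intro Bochner_Integration.integral_diff integrable) (auto simp: indicator_def)
    also have "\<dots> = expectation (\<lambda>\<omega>. 1 * (indicator B (C \<omega>) * indicator D (Z \<omega>)) 
         - F t (Z \<omega>) * (indicator B (C \<omega>) * indicator D (Z \<omega>)))"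
      by (intro Bochner_Integration.integral_diff[symmetric] integrable) (auto intro!: F1)
    also have "\<dots> = expectation (\<lambda>\<omega>. (1 - F t (Z \<omega>)) * (indicator B (C \<omega>) * indicator D (Z \<omega>)))"
      by (simp only: left_diff_distrib)
    finally show "expectation (\<lambda>\<omega>. indicat_real {t<..} (X \<omega>) * (indicator B (C \<omega>) * indicator D (Z \<omega>)))
        = expectation (\<lambda>\<omega>. (1 - F t (Z \<omega>)) * (indicator B (C \<omega>) * indicator D (Z \<omega>)))" .
  qed (use F_le_1 F_nonneg in \<open>auto simp: indicator_def\<close>)
  then show ?thesis
    by (simp add: ennreal_indicator)
qed

lemma X_pos: "AE \<omega> in M. 0 < X \<omega>"
proof -
  have neg: "AE \<omega> in M. F s (Z \<omega>) = 0" if "s < 0" for s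
  proof -
    have "(\<integral>\<^sup>+\<omega>. ennreal (F s (Z \<omega>)) \<partial>M) = (\<integral>\<^sup>+\<omega>. ennreal (indicator {..s} (X \<omega>)) \<partial>M)"
      using nn_integral_eq_from_rectangles[of C borel Z borel "\<lambda>\<omega>. indicator {..s} (X \<omega>)" "\<lambda>\<omega>. F s (Z \<omega>)" "\<lambda>_. 1"]
        cond_X_rectangle[of _ _ s] F_nonneg F_le_1
      by (simp add: indicator_le_1)
    also have "\<dots> = (\<integral>\<^sup>+\<omega>. 0 \<partial>M)"
      using X_nonneg that by (intro nn_integral_cong_AE) (auto elim!: eventually_mono simp: indicator_def)
    finally have "AE \<omega> in M. ennreal (F s (Z \<omega>)) = 0"
      by (simp add: nn_integral_0_iff_AE)
    then show ?thesis
      by eventually_elim (use F_nonneg in \<open>auto simp: ennreal_eq_0_iff intro: antisym\<close>)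
  qed
  have "AE \<omega> in M. \<forall>k. F (- (1 / Suc k)) (Z \<omega>) = 0"
    by (subst AE_all_countable) (auto intro!: neg)
  then have F0: "AE \<omega> in M. F 0 (Z \<omega>) = 0"
  proof eventually_elim
    case (elim \<omega>)
    then show ?case
      using F_0_eq_lim[of "Z \<omega>"] by (simp add: LIMSEQ_const_iff)
  qed
  have "(\<integral>\<^sup>+\<omega>. ennreal (indicator {..0} (X \<omega>)) \<partial>M) = (\<integral>\<^sup>+\<omega>. ennreal (F 0 (Z \<omega>)) \<partial>M)"
    using nn_integral_eq_from_rectangles[of C borel Z borel "\<lambda>\<omega>. indicator {..0} (X \<omega>)" "\<lambda>\<omega>. F 0 (Z \<omega>)" "\<lambda>_. 1"]
      cond_X_rectangle[of _ _ 0] F_nonneg F_le_1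
    by (simp add: indicator_le_1)
  also have "\<dots> = (\<integral>\<^sup>+\<omega>. 0 \<partial>M)"
    using F0 by (intro nn_integral_cong_AE) (auto elim!: eventually_mono)
  finally have "AE \<omega> in M. ennreal (indicator {..0} (X \<omega>)) = 0"
    by (simp add: nn_integral_0_iff_AE)
  then show ?thesis
  proof eventually_elim
    case (elim \<omega>)
    show ?case
    proof (rule ccontr)
      assume "\<not> 0 < X \<omega>"
      then have "indicat_real {..0} (X \<omega>) = 1"
        by simp
      with elim show False
        by simp
    qed
  qed
qed

text \<open>The complement of the support is a union of open null sets, of which countably many suffice by
Lindelof's theorem.\<close>
lemma C_le_endpoint:
  assumes "right_endpoint M C = ereal \<tau>"
  shows "AE \<omega> in M. C \<omega> \<le> \<tau>"
proof -
  let ?N = "distr M borel C"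
  define \<U> where "\<U> = {U. open U \<and> emeasure ?N U = 0}"
  obtain \<V> where V: "\<V> \<subseteq> \<U>" "countable \<V>" "\<Union>\<V> = \<Union>\<U>"
  proof (rule Lindelof)
    show "\<And>S. S \<in> \<U> \<Longrightarrow> open S"
      by (simp add: \<U>_def)
  qed
  have "{\<tau><..} \<subseteq> \<Union>\<U>"
  proof
    fix x assume x: "x \<in> {\<tau><..}"
    have "x \<notin> measure_support ?N"
    proof
      assume "x \<in> measure_support ?N"
      then have "ereal x \<le> right_endpoint M C"
        unfolding right_endpoint_def by (rule SUP_upper)
      then show False
        using x by (simp add: assms)
    qed
    then obtain U where "open U" "x \<in> U" "\<not> 0 < emeasure ?N U"
      unfolding measure_support_def by blast
    then have "U \<in> \<U>"
      by (simp add: \<U>_def zero_less_iff_neq_zero)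
    then show "x \<in> \<Union>\<U>"
      using \<open>x \<in> U\<close> by (rule UnionI)
  qed
  moreover have "(\<Union>U\<in>\<V>. U) \<in> null_sets ?N"
  proof (rule null_sets_UN'[OF V(2)])
    fix U assume "U \<in> \<V>"
    then have "open U" "emeasure ?N U = 0"
      using V(1) by (auto simp: \<U>_def)
    then show "U \<in> null_sets ?N"
      by (simp add: null_sets_def)
  qed
  ultimately have null: "\<Union>\<V> \<in> null_sets ?N" and sub: "{\<tau><..} \<subseteq> \<Union>\<V>"
    by (simp_all add: V(3))
  have "{x \<in> space ?N. \<not> x \<le> \<tau>} \<subseteq> {\<tau><..}"
    by (rule subsetI) simp
  then have "{x \<in> space ?N. \<not> x \<le> \<tau>} \<subseteq> \<Union>\<V>"
    using sub by (rule subset_trans)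
  then have "AE x in ?N. x \<le> \<tau>"
    by (rule AE_I'[OF null])
  then show ?thesis
    by (rule AE_distrD[OF C_rv])
qed

end

context cox_model
begin

context
  fixes \<tau> :: real and lam :: "real \<Rightarrow> real"
  assumes tau: "0 \<le> \<tau>" "ereal \<tau> < right_endpoint M X"
    and lam_measurable [measurable]: "lam \<in> borel_measurable borel"
    and lam: "\<And>u. 0 < u \<Longrightarrow> u \<le> \<tau> \<Longrightarrow> lam u = lambda0 u"
begin

lemma F_joint_measurable2 [measurable]:
  "(\<lambda>p. F (fst p) (Z (snd p))) \<in> borel_measurable (lborel \<Otimes>\<^sub>M M)"
  "(\<lambda>p. F (snd p) (Z (fst p))) \<in> borel_measurable (M \<Otimes>\<^sub>M lborel)"
  using measurable_compose[OF _ F_joint_measurable, of "\<lambda>p. (fst p, Z (snd p))" "lborel \<Otimes>\<^sub>M M"]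
    measurable_compose[OF _ F_joint_measurable, of "\<lambda>p. (snd p, Z (fst p))" "M \<Otimes>\<^sub>M lborel"]
  by simp_all

text \<open>The increment of \<open>F\<close> is an integral of the hazard times the survival function \<open>1 - F u\<close>, and the latter
is again the conditional probability of \<open>u < X\<close>.\<close>
lemma event_law_interval:
  assumes t: "0 \<le> t" "t \<le> \<tau>" and [measurable]: "\<phi> \<in> borel_measurable (borel \<Otimes>\<^sub>M borel)"
  shows "(\<integral>\<^sup>+\<omega>. indicator {0<..t} (X \<omega>) * \<phi> (C \<omega>, Z \<omega>) \<partial>M)
    = (\<integral>\<^sup>+u. ennreal (lam u) * indicator {0<..t} u *
        (\<integral>\<^sup>+\<omega>. indicator {u<..} (X \<omega>) * (ennreal (exp (\<beta>\<^sub>0 \<bullet> Z \<omega>)) * \<phi> (C \<omega>, Z \<omega>)) \<partial>M) \<partial>lborel)"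
proof -
  have "ereal t \<le> ereal \<tau>"
    using t by simp
  then have t_end: "ereal t < right_endpoint M X"
    using tau(2) by (rule le_less_trans)
  have "(\<integral>\<^sup>+\<omega>. indicator {0<..t} (X \<omega>) * \<phi> (C \<omega>, Z \<omega>) \<partial>M)
      = (\<integral>\<^sup>+\<omega>. ennreal (F t (Z \<omega>) - F 0 (Z \<omega>)) * \<phi> (C \<omega>, Z \<omega>) \<partial>M)"
    using t by (intro cond_X_Ioc) auto
  also have "\<dots> = (\<integral>\<^sup>+\<omega>. (\<integral>\<^sup>+u. ennreal (lam u) * indicator {0<..t} u *
      (ennreal (1 - F u (Z \<omega>)) * (ennreal (exp (\<beta>\<^sub>0 \<bullet> Z \<omega>)) * \<phi> (C \<omega>, Z \<omega>))) \<partial>lborel) \<partial>M)"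
  proof (intro nn_integral_cong)
    fix \<omega> assume [measurable]: "\<omega> \<in> space M"
    have [measurable]: "(\<lambda>u. F u (Z \<omega>)) \<in> borel_measurable borel"
      using measurable_compose[OF _ F_joint_measurable, of "\<lambda>u. (u, Z \<omega>)" borel] by simp
    have "ennreal (F t (Z \<omega>) - F 0 (Z \<omega>)) * \<phi> (C \<omega>, Z \<omega>)
        = (\<integral>\<^sup>+u. ennreal (lambda0 u * exp (\<beta>\<^sub>0 \<bullet> Z \<omega>) * (1 - F u (Z \<omega>))) * indicator {0<..t} u \<partial>lborel) * \<phi> (C \<omega>, Z \<omega>)"
      using F_increment[OF order_refl t(1) t_end] by simp
    also have "(\<integral>\<^sup>+u. ennreal (lambda0 u * exp (\<beta>\<^sub>0 \<bullet> Z \<omega>) * (1 - F u (Z \<omega>))) * indicator {0<..t} u \<partial>lborel)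
        = (\<integral>\<^sup>+u. ennreal (lam u) * indicator {0<..t} u * (ennreal (1 - F u (Z \<omega>)) * ennreal (exp (\<beta>\<^sub>0 \<bullet> Z \<omega>))) \<partial>lborel)"
      using t F_le_1 baseline_nonneg
      by (intro nn_integral_cong) (auto simp: indicator_def lam ennreal_mult mult_ac)
    also have "\<dots> * \<phi> (C \<omega>, Z \<omega>) = (\<integral>\<^sup>+u. ennreal (lam u) * indicator {0<..t} u *
      (ennreal (1 - F u (Z \<omega>)) * (ennreal (exp (\<beta>\<^sub>0 \<bullet> Z \<omega>)) * \<phi> (C \<omega>, Z \<omega>))) \<partial>lborel)"
      by (subst nn_integral_multc[symmetric]) (auto simp: mult.assoc)
    finally show "ennreal (F t (Z \<omega>) - F 0 (Z \<omega>)) * \<phi> (C \<omega>, Z \<omega>)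
        = (\<integral>\<^sup>+u. ennreal (lam u) * indicator {0<..t} u *
      (ennreal (1 - F u (Z \<omega>)) * (ennreal (exp (\<beta>\<^sub>0 \<bullet> Z \<omega>)) * \<phi> (C \<omega>, Z \<omega>))) \<partial>lborel)" .
  qed
  also have "\<dots> = (\<integral>\<^sup>+u. (\<integral>\<^sup>+\<omega>. ennreal (lam u) * indicator {0<..t} u *
      (ennreal (1 - F u (Z \<omega>)) * (ennreal (exp (\<beta>\<^sub>0 \<bullet> Z \<omega>)) * \<phi> (C \<omega>, Z \<omega>))) \<partial>M) \<partial>lborel)"
  proof -
    interpret pair_sigma_finite lborel M
      by unfold_locales
    show ?thesis
      by (rule Fubini') measurable
  qed
  also have "\<dots> = (\<integral>\<^sup>+u. ennreal (lam u) * indicator {0<..t} u *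
        (\<integral>\<^sup>+\<omega>. indicator {u<..} (X \<omega>) * (ennreal (exp (\<beta>\<^sub>0 \<bullet> Z \<omega>)) * \<phi> (C \<omega>, Z \<omega>)) \<partial>M) \<partial>lborel)"
  proof (intro nn_integral_cong)
    fix u :: real
    have [measurable]: "(\<lambda>(c, z). ennreal (exp (\<beta>\<^sub>0 \<bullet> z)) * \<phi> (c, z)) \<in> borel_measurable (borel \<Otimes>\<^sub>M borel)"
      by measurable
    show "(\<integral>\<^sup>+\<omega>. ennreal (lam u) * indicator {0<..t} u *
      (ennreal (1 - F u (Z \<omega>)) * (ennreal (exp (\<beta>\<^sub>0 \<bullet> Z \<omega>)) * \<phi> (C \<omega>, Z \<omega>))) \<partial>M)
      = ennreal (lam u) * indicator {0<..t} u *
        (\<integral>\<^sup>+\<omega>. indicator {u<..} (X \<omega>) * (ennreal (exp (\<beta>\<^sub>0 \<bullet> Z \<omega>)) * \<phi> (C \<omega>, Z \<omega>)) \<partial>M)"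
      using cond_X_gt[of "\<lambda>(c, z). ennreal (exp (\<beta>\<^sub>0 \<bullet> z)) * \<phi> (c, z)" u]
      by (subst nn_integral_cmult) auto
  qed
  finally show ?thesis .
qed

text \<open>The extension from intervals of \<open>X\<close> and sets of \<open>(C, Z)\<close> to functions of all three variables compares two
measures: first on the line for a fixed set of \<open>(C, Z)\<close>, by their distribution functions, then on rectangles.\<close>
lemma event_law:
  assumes [measurable]: "k \<in> borel_measurable (borel \<Otimes>\<^sub>M (borel \<Otimes>\<^sub>M borel))"
  shows "(\<integral>\<^sup>+\<omega>. indicator {0<..\<tau>} (X \<omega>) * k (X \<omega>, C \<omega>, Z \<omega>) \<partial>M)
    = (\<integral>\<^sup>+u. (\<integral>\<^sup>+\<omega>. ennreal (lam u) * indicator {0<..\<tau>} u *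
        (indicator {u<..} (X \<omega>) * ennreal (exp (\<beta>\<^sub>0 \<bullet> Z \<omega>)) * k (u, C \<omega>, Z \<omega>)) \<partial>M) \<partial>lborel)"
proof -
  have sM: "sigma_finite_measure M"
    by unfold_locales
  interpret pair_sigma_finite lborel M
    by unfold_locales
  let ?B = "borel \<Otimes>\<^sub>M (borel \<Otimes>\<^sub>M borel) :: (real \<times> real \<times> (real ^ 'd)) measure"
  define d where "d p = ennreal (lam (fst p)) * indicator {0<..\<tau>} (fst p) *
     (indicator {fst p<..} (X (snd p)) * ennreal (exp (\<beta>\<^sub>0 \<bullet> Z (snd p))))" for p
  have [measurable]: "d \<in> borel_measurable (lborel \<Otimes>\<^sub>M M)"
    unfolding d_def indicator_def greaterThan_iff by measurable
  define \<mu> where "\<mu> = distr (density M (\<lambda>\<omega>. indicator {0<..\<tau>} (X \<omega>))) ?B (\<lambda>\<omega>. (X \<omega>, C \<omega>, Z \<omega>))"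
  define \<nu> where "\<nu> = distr (density (lborel \<Otimes>\<^sub>M M) d) ?B (\<lambda>p. (fst p, C (snd p), Z (snd p)))"
  have mu: "(\<integral>\<^sup>+x. k x \<partial>\<mu>) = (\<integral>\<^sup>+\<omega>. indicator {0<..\<tau>} (X \<omega>) * k (X \<omega>, C \<omega>, Z \<omega>) \<partial>M)"
    if [measurable]: "k \<in> borel_measurable ?B" for k
    unfolding \<mu>_def by (simp add: nn_integral_distr nn_integral_density)
  have nu: "(\<integral>\<^sup>+x. k x \<partial>\<nu>) = (\<integral>\<^sup>+u. (\<integral>\<^sup>+\<omega>. ennreal (lam u) * indicator {0<..\<tau>} u *
        (indicator {u<..} (X \<omega>) * ennreal (exp (\<beta>\<^sub>0 \<bullet> Z \<omega>)) * k (u, C \<omega>, Z \<omega>)) \<partial>M) \<partial>lborel)"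
    if [measurable]: "k \<in> borel_measurable ?B" for k
  proof -
    have "(\<integral>\<^sup>+x. k x \<partial>\<nu>) = (\<integral>\<^sup>+p. d p * k (fst p, C (snd p), Z (snd p)) \<partial>(lborel \<Otimes>\<^sub>M M))"
      unfolding \<nu>_def by (simp add: nn_integral_distr nn_integral_density)
    also have "\<dots> = (\<integral>\<^sup>+u. (\<integral>\<^sup>+\<omega>. d (u, \<omega>) * k (u, C \<omega>, Z \<omega>) \<partial>M) \<partial>lborel)"
      using sigma_finite_measure.nn_integral_fst[OF sM, of "\<lambda>p. d p * k (fst p, C (snd p), Z (snd p))" lborel] by simp
    finally show ?thesis
      by (simp add: d_def mult.assoc)
  qed
  have "\<mu> = \<nu>"
  proof (rule measure_eqI_rectangles[where A = borel and B = "borel \<Otimes>\<^sub>M borel"])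
    show "sets \<mu> = sets ?B" "sets \<nu> = sets ?B"
      by (simp_all add: \<mu>_def \<nu>_def)
    have "emeasure \<mu> (space borel \<times> space (borel \<Otimes>\<^sub>M borel)) = (\<integral>\<^sup>+x. 1 \<partial>\<mu>)"
      by (simp add: \<mu>_def space_pair_measure)
    also have "\<dots> \<le> (\<integral>\<^sup>+\<omega>. 1 \<partial>M)"
      unfolding mu[OF borel_measurable_const] by (intro nn_integral_mono) (auto simp: indicator_def)
    finally show "emeasure \<mu> (space borel \<times> space (borel \<Otimes>\<^sub>M borel)) \<noteq> \<infinity>"
      by (auto simp: emeasure_space_1 top_unique)
    fix A :: "real set" and S :: "(real \<times> (real ^ 'd)) set"
    assume [measurable]: "A \<in> sets borel" "S \<in> sets (borel \<Otimes>\<^sub>M borel)"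
    define g where "g u = (\<integral>\<^sup>+\<omega>. indicator {u<..} (X \<omega>) * (ennreal (exp (\<beta>\<^sub>0 \<bullet> Z \<omega>)) * indicator S (C \<omega>, Z \<omega>)) \<partial>M)" for u
    have [measurable]: "g \<in> borel_measurable lborel"
      unfolding g_def indicator_def greaterThan_iff by measurable
    define m1 where "m1 = distr (density M (\<lambda>\<omega>. indicator {0<..\<tau>} (X \<omega>) * indicator S (C \<omega>, Z \<omega>))) borel X"
    define m2 where "m2 = density lborel (\<lambda>u. ennreal (lam u) * indicator {0<..\<tau>} u * g u)"
    have m1: "emeasure m1 D = (\<integral>\<^sup>+\<omega>. indicator {0<..\<tau>} (X \<omega>) * (indicator D (X \<omega>) * indicator S (C \<omega>, Z \<omega>)) \<partial>M)"
      if [measurable]: "D \<in> sets borel" for D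
    proof -
      have "(\<integral>\<^sup>+x. q x \<partial>m1) = (\<integral>\<^sup>+\<omega>. indicator {0<..\<tau>} (X \<omega>) * indicator S (C \<omega>, Z \<omega>) * q (X \<omega>) \<partial>M)"
        if [measurable]: "q \<in> borel_measurable borel" for q
        unfolding m1_def by (simp add: nn_integral_distr nn_integral_density)
      note this[of "indicator D"]
      moreover have "emeasure m1 D = (\<integral>\<^sup>+x. indicator D x \<partial>m1)"
        by (subst nn_integral_indicator) (simp_all add: m1_def)
      ultimately show ?thesis
        by (simp add: mult_ac)
    qed
    have m2: "emeasure m2 D = (\<integral>\<^sup>+u. ennreal (lam u) * indicator {0<..\<tau>} u * g u * indicator D u \<partial>lborel)"
      if [measurable]: "D \<in> sets borel" for D
      unfolding m2_def by (rule emeasure_density) auto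
    have em_eq: "emeasure m1 {..t} = emeasure m2 {..t}" for t
    proof (cases "t \<le> 0")
      case True
      then have zero: "indicator {0<..\<tau>} x * (indicator {..t} x * c) = 0" "indicator {0<..\<tau>} x * c * indicator {..t} x = 0"
        for x :: real and c :: ennreal
        by (auto simp: indicator_def)
      show ?thesis
        by (subst m1, simp, subst m2, simp) (simp add: zero mult.assoc zero[unfolded mult.assoc])
    next
      case False
      define s where "s = min t \<tau>"
      have s: "0 \<le> s" "s \<le> \<tau>"
        using False tau(1) by (auto simp: s_def)
      have ind: "indicator {0<..\<tau>} x * indicator {..t} x = (indicator {0<..s} x :: ennreal)" for x :: real
        by (auto simp: indicator_def s_def)
      have "emeasure m1 {..t} = (\<integral>\<^sup>+\<omega>. indicator {0<..s} (X \<omega>) * indicator S (C \<omega>, Z \<omega>) \<partial>M)"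
        by (subst m1, simp) (simp add: ind mult.assoc[symmetric])
      also have "\<dots> = (\<integral>\<^sup>+u. ennreal (lam u) * indicator {0<..s} u * g u \<partial>lborel)"
        unfolding g_def by (intro event_law_interval s) auto
      also have "\<dots> = emeasure m2 {..t}"
        by (subst m2, simp) (simp add: ind[symmetric] mult_ac)
      finally show ?thesis .
    qed
    have "emeasure m1 UNIV \<le> (\<integral>\<^sup>+\<omega>. 1 \<partial>M)"
      by (subst m1, simp) (intro nn_integral_mono, auto simp: indicator_def)
    then have fin1: "emeasure m1 UNIV \<noteq> \<infinity>"
      by (auto simp: emeasure_space_1 top_unique)
    have "emeasure m2 UNIV = emeasure m2 {..\<tau>}"
      by (subst m2, simp, subst m2, simp, intro nn_integral_cong) (auto simp: indicator_def)
    also have "\<dots> = emeasure m1 {..\<tau>}"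
      by (rule em_eq[symmetric])
    also have "\<dots> \<le> emeasure m1 UNIV"
      by (intro emeasure_mono) (auto simp: m1_def)
    finally have fin2: "emeasure m2 UNIV \<noteq> \<infinity>"
      using fin1 by (auto simp: top_unique)
    have "finite_borel_measure m1" "finite_borel_measure m2"
      using fin1 fin2 by (auto intro!: finite_borel_measure.intro finite_measureI finite_borel_measure_axioms.intro simp: m1_def m2_def)
    then have "m1 = m2"
      by (rule cdf_unique') (simp add: fun_eq_iff cdf_def measure_def em_eq)
    have "emeasure \<mu> (A \<times> S) = (\<integral>\<^sup>+x. indicator (A \<times> S) x \<partial>\<mu>)"
      by (subst nn_integral_indicator) (simp_all add: \<mu>_def)
    also have "\<dots> = emeasure m1 A"
      by (subst mu, simp, subst m1, simp) (simp add: indicator_times)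
    also have "\<dots> = emeasure m2 A"
      by (simp add: \<open>m1 = m2\<close>)
    also have "\<dots> = (\<integral>\<^sup>+u. (\<integral>\<^sup>+\<omega>. ennreal (lam u) * indicator {0<..\<tau>} u *
        (indicator {u<..} (X \<omega>) * ennreal (exp (\<beta>\<^sub>0 \<bullet> Z \<omega>)) * indicator (A \<times> S) (u, C \<omega>, Z \<omega>)) \<partial>M) \<partial>lborel)"
    proof (subst m2, simp, intro nn_integral_cong)
      fix u :: real
      have "ennreal (lam u) * indicator {0<..\<tau>} u * g u * indicator A u
          = ennreal (lam u) * indicator {0<..\<tau>} u * indicator A u * g u"
        by (simp add: mult_ac)
      also have "\<dots> = (\<integral>\<^sup>+\<omega>. ennreal (lam u) * indicator {0<..\<tau>} u * indicator A u *
          (indicator {u<..} (X \<omega>) * (ennreal (exp (\<beta>\<^sub>0 \<bullet> Z \<omega>)) * indicator S (C \<omega>, Z \<omega>))) \<partial>M)"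
        unfolding g_def by (rule nn_integral_cmult[symmetric]) measurable
      finally show "ennreal (lam u) * indicator {0<..\<tau>} u * g u * indicator A u
          = (\<integral>\<^sup>+\<omega>. ennreal (lam u) * indicator {0<..\<tau>} u *
        (indicator {u<..} (X \<omega>) * ennreal (exp (\<beta>\<^sub>0 \<bullet> Z \<omega>)) * indicator (A \<times> S) (u, C \<omega>, Z \<omega>)) \<partial>M)"
        by (simp add: indicator_times mult_ac)
    qed
    also have "\<dots> = (\<integral>\<^sup>+x. indicator (A \<times> S) x \<partial>\<nu>)"
      by (subst nu) simp_all
    also have "\<dots> = emeasure \<nu> (A \<times> S)"
      by (subst nn_integral_indicator) (simp_all add: \<nu>_def)
    finally show "emeasure \<mu> (A \<times> S) = emeasure \<nu> (A \<times> S)" .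
  qed
  then show ?thesis
    using mu[of k] nu[of k] by simp
qed

text \<open>The case of functions that vanish unless \<open>X \<le> C\<close>.  For each \<open>\<omega>\<close> the conditions \<open>u < X \<omega>\<close>
and \<open>u \<le> X \<omega>\<close> differ in a single \<open>u\<close>, and together with \<open>u \<le> C \<omega>\<close> the latter says that the subject is at risk.\<close>
lemma observed_event_law:
  assumes C: "AE \<omega> in M. C \<omega> \<le> \<tau>" and [measurable]: "k \<in> borel_measurable (borel \<Otimes>\<^sub>M borel)"
  shows "(\<integral>\<^sup>+\<omega>. of_bool (X \<omega> \<le> C \<omega>) * k (min (X \<omega>) (C \<omega>), Z \<omega>) \<partial>M)
    = (\<integral>\<^sup>+u. (\<integral>\<^sup>+\<omega>. ennreal (lam u * exp (\<beta>\<^sub>0 \<bullet> Z \<omega>)) * indicator {0<..\<tau>} u * of_bool (u \<le> min (X \<omega>) (C \<omega>)) * k (u, Z \<omega>) \<partial>M) \<partial>lborel)"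
proof -
  interpret pair_sigma_finite lborel M
    by unfold_locales
  have [measurable]: "(\<lambda>(x, c, z). (of_bool (x \<le> c) :: ennreal) * k (x, z)) \<in> borel_measurable (borel \<Otimes>\<^sub>M (borel \<Otimes>\<^sub>M borel))"
    unfolding of_bool_def by measurable
  have "(\<integral>\<^sup>+\<omega>. of_bool (X \<omega> \<le> C \<omega>) * k (min (X \<omega>) (C \<omega>), Z \<omega>) \<partial>M)
      = (\<integral>\<^sup>+\<omega>. indicator {0<..\<tau>} (X \<omega>) * (of_bool (X \<omega> \<le> C \<omega>) * k (X \<omega>, Z \<omega>)) \<partial>M)"
  proof (rule nn_integral_cong_AE)
    show "AE \<omega> in M. of_bool (X \<omega> \<le> C \<omega>) * k (min (X \<omega>) (C \<omega>), Z \<omega>)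
        = indicator {0<..\<tau>} (X \<omega>) * (of_bool (X \<omega> \<le> C \<omega>) * k (X \<omega>, Z \<omega>))"
      using C X_pos by eventually_elim (auto simp: indicator_def min_def)
  qed
  also have "\<dots> = (\<integral>\<^sup>+u. (\<integral>\<^sup>+\<omega>. ennreal (lam u) * indicator {0<..\<tau>} u *
        (indicator {u<..} (X \<omega>) * ennreal (exp (\<beta>\<^sub>0 \<bullet> Z \<omega>)) * (of_bool (u \<le> C \<omega>) * k (u, Z \<omega>))) \<partial>M) \<partial>lborel)"
    using event_law[of "\<lambda>(x, c, z). of_bool (x \<le> c) * k (x, z)"] by simp
  also have "\<dots> = (\<integral>\<^sup>+\<omega>. (\<integral>\<^sup>+u. ennreal (lam u) * indicator {0<..\<tau>} u *
        (indicator {u<..} (X \<omega>) * ennreal (exp (\<beta>\<^sub>0 \<bullet> Z \<omega>)) * (of_bool (u \<le> C \<omega>) * k (u, Z \<omega>))) \<partial>lborel) \<partial>M)"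
    by (rule Fubini'[symmetric]) (unfold indicator_def of_bool_def greaterThan_iff, measurable)
  also have "\<dots> = (\<integral>\<^sup>+\<omega>. (\<integral>\<^sup>+u. ennreal (lam u * exp (\<beta>\<^sub>0 \<bullet> Z \<omega>)) * indicator {0<..\<tau>} u * of_bool (u \<le> min (X \<omega>) (C \<omega>)) * k (u, Z \<omega>) \<partial>lborel) \<partial>M)"
  proof (rule nn_integral_cong, rule nn_integral_cong_AE)
    fix \<omega>
    have "AE u in lborel. u \<noteq> X \<omega>"
      by (rule AE_lborel_singleton)
    then show "AE u in lborel. ennreal (lam u) * indicator {0<..\<tau>} u *
        (indicator {u<..} (X \<omega>) * ennreal (exp (\<beta>\<^sub>0 \<bullet> Z \<omega>)) * (of_bool (u \<le> C \<omega>) * k (u, Z \<omega>)))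
      = ennreal (lam u * exp (\<beta>\<^sub>0 \<bullet> Z \<omega>)) * indicator {0<..\<tau>} u * of_bool (u \<le> min (X \<omega>) (C \<omega>)) * k (u, Z \<omega>)"
    proof eventually_elim
      case (elim u)
      have "ennreal (lam u * exp (\<beta>\<^sub>0 \<bullet> Z \<omega>)) = ennreal (lam u) * ennreal (exp (\<beta>\<^sub>0 \<bullet> Z \<omega>))" if "0 < u" "u \<le> \<tau>"
        using that baseline_nonneg[of u] by (simp add: ennreal_mult lam)
      then show ?case
        using elim by (auto simp: indicator_def mult.assoc)
    qed
  qed
  also have "\<dots> = (\<integral>\<^sup>+u. (\<integral>\<^sup>+\<omega>. ennreal (lam u * exp (\<beta>\<^sub>0 \<bullet> Z \<omega>)) * indicator {0<..\<tau>} u * of_bool (u \<le> min (X \<omega>) (C \<omega>)) * k (u, Z \<omega>) \<partial>M) \<partial>lborel)"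
    by (rule Fubini') (unfold indicator_def of_bool_def, measurable)
  finally show ?thesis .
qed

end

end

section \<open>Weighted moments and limits in a Cox sample\<close>

lemma one_plus_power_le_exp:
  fixes x \<rho> :: real
  assumes "0 \<le> x" "0 < \<rho>" "q \<ge> 1"
  shows "(1 + x) ^ q \<le> (max 1 (q / \<rho>)) ^ q * exp (\<rho> * x)"
proof -
  let ?K = "max 1 (q / \<rho>)"
  have "1 + x \<le> ?K + ?K * (\<rho> / q) * x"
  proof -
    have "1 * x = (q / \<rho>) * (\<rho> / q) * x"
      using assms by simp
    also have "\<dots> \<le> ?K * (\<rho> / q) * x"
      using assms by (intro mult_right_mono) auto
    finally show ?thesis by simp
  qed
  also have "\<dots> = ?K * (1 + \<rho> * x / q)"
    by (simp add: distrib_left)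
  also have "\<dots> \<le> ?K * exp (\<rho> * x / q)"
    by (intro mult_left_mono exp_ge_add_one_self) auto
  finally have "(1 + x) ^ q \<le> (?K * exp (\<rho> * x / q)) ^ q"
    using assms by (intro power_mono) auto
  also have "\<dots> = ?K ^ q * exp (\<rho> * x)"
    using assms by (simp add: power_mult_distrib exp_of_nat_mult[symmetric])
  finally show ?thesis .
qed

lemma borel_measurable_component [measurable (raw)]:
  fixes f :: "'a \<Rightarrow> real ^ 'd::finite"
  assumes "f \<in> borel_measurable M"
  shows "(\<lambda>x. f x $ k) \<in> borel_measurable M"
proof -
  have "(\<lambda>x. f x \<bullet> axis k 1) \<in> borel_measurable M"
    using assms by measurable
  then show ?thesis
    by (simp add: inner_axis)
qed

lemma integrable_dominated:
  fixes h g :: "'a \<Rightarrow> real"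
  assumes "integrable M g" "\<And>x. \<bar>h x\<bar> \<le> g x" "h \<in> borel_measurable M"
  shows "integrable M h"
proof (rule Bochner_Integration.integrable_bound[OF assms(1,3)])
  show "AE x in M. norm (h x) \<le> norm (g x)"
  proof (intro always_eventually allI)
    fix x
    show "norm (h x) \<le> norm (g x)"
      using assms(2)[of x] by simp
  qed
qed

text \<open>All that is used about the model from here on, expressed by the law \<open>P\<close> of one observation: the event
intensity \<open>compensator\<close>, a bounded baseline hazard, moments of an exponential envelope, and a positive
proportion at risk until the end \<open>\<tau>\<close>.\<close>
locale cox_sample = iid_sample M W P
  for M :: "'a measure" and W :: "nat \<Rightarrow> 'a \<Rightarrow> real \<times> bool \<times> (real ^ 'd::finite)" and P +
  fixes \<beta> :: "real ^ 'd" and \<tau> \<rho> L :: real and lam :: "real \<Rightarrow> real"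
  assumes sets_P [measurable_cong]: "sets P = sets obs_algebra"
    and times: "AE w in P. 0 \<le> fst w \<and> fst w \<le> \<tau>"
    and lam_measurable [measurable]: "lam \<in> borel_measurable borel"
    and lam_nonneg: "\<And>u. 0 \<le> lam u" and lam_le: "\<And>u. lam u \<le> L" and lam_outside: "\<And>u. u \<notin> {0<..\<tau>} \<Longrightarrow> lam u = 0"
    and compensator: "\<And>k. k \<in> borel_measurable (borel \<Otimes>\<^sub>M borel) \<Longrightarrow>
      (\<integral>\<^sup>+w. of_bool (fst (snd w)) * k (fst w, snd (snd w)) \<partial>P)
      = (\<integral>\<^sup>+u. (\<integral>\<^sup>+w. ennreal (lam u * exp (\<beta> \<bullet> snd (snd w))) * of_bool (u \<le> fst w) * k (u, snd (snd w)) \<partial>P) \<partial>lborel)"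
    and \<rho>: "0 < \<rho>"
    and envelope: "\<And>q::nat. integrable P (\<lambda>w. exp (\<beta> \<bullet> snd (snd w) + 2 * \<rho> * norm (snd (snd w))) ^ q)"
    and at_risk: "0 < measure P {w \<in> space P. \<tau> \<le> fst w}"
begin

sublocale P: prob_space P
  by (rule prob_space_P)

lemma P_measurable [measurable]:
  "fst \<in> borel_measurable P" "(\<lambda>w. fst (snd w)) \<in> measurable P (count_space UNIV)"
  "(\<lambda>w. snd (snd w)) \<in> borel_measurable P"
  unfolding measurable_cong_sets[OF sets_P refl] by measurable

abbreviation cov :: "real \<times> bool \<times> (real ^ 'd) \<Rightarrow> real ^ 'd" where "cov w \<equiv> snd (snd w)"
abbreviation event :: "real \<times> bool \<times> (real ^ 'd) \<Rightarrow> bool" where "event w \<equiv> fst (snd w)"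

text \<open>One envelope for all weighted averages: it dominates the weights \<open>w0\<close>, \<open>w1\<close>, \<open>w2\<close> of the risk set
averages, and it also controls the third order error of the likelihood expansion and the dependence on
the parameter within distance \<open>\<rho>\<close>.\<close>
definition env where "env w = exp (\<beta> \<bullet> cov w + \<rho> * norm (cov w)) * (1 + norm (cov w)) ^ 3"
definition w0 where "w0 w = exp (\<beta> \<bullet> cov w)"
definition w1 where "w1 k w = w0 w * cov w $ k"
definition w2 where "w2 k l w = w0 w * (cov w $ k * cov w $ l)"

lemma w_measurable [measurable]:
  "env \<in> borel_measurable P" "w0 \<in> borel_measurable P" "w1 k \<in> borel_measurable P" "w2 k l \<in> borel_measurable P"
  unfolding env_def w0_def w1_def w2_def by measurable

lemma env_nonneg: "0 \<le> env w"
  by (simp add: env_def)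

lemma w0_moment:
  assumes "q \<ge> 1"
  shows "integrable P (\<lambda>w. w0 w * (1 + norm (cov w)) ^ q)"
proof (rule integrable_dominated)
  let ?K = "max 1 (q / (2 * \<rho>)) ^ q"
  show "integrable P (\<lambda>w. ?K * exp (\<beta> \<bullet> cov w + 2 * \<rho> * norm (cov w)) ^ 1)"
    by (rule integrable_mult_right[OF envelope])
  fix w
  have "w0 w * (1 + norm (cov w)) ^ q \<le> w0 w * (?K * exp (2 * \<rho> * norm (cov w)))"
    using one_plus_power_le_exp[of "norm (cov w)" "2 * \<rho>" q] assms \<rho>
    by (intro mult_left_mono) (simp_all add: w0_def)
  also have "\<dots> = ?K * exp (\<beta> \<bullet> cov w + 2 * \<rho> * norm (cov w)) ^ 1"
    by (simp only: w0_def exp_add power_one_right mult.left_commute)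
  finally show "\<bar>w0 w * (1 + norm (cov w)) ^ q\<bar> \<le> ?K * exp (\<beta> \<bullet> cov w + 2 * \<rho> * norm (cov w)) ^ 1"
    by (subst abs_of_nonneg) (simp_all add: w0_def)
qed measurable

lemma env_moment: "integrable P (\<lambda>w. env w ^ q)"
proof (rule integrable_dominated)
  let ?K = "max 1 (real 3 / \<rho>) ^ 3"
  show "integrable P (\<lambda>w. ?K ^ q * exp (\<beta> \<bullet> cov w + 2 * \<rho> * norm (cov w)) ^ q)"
    by (rule integrable_mult_right[OF envelope])
  fix w
  have "env w \<le> exp (\<beta> \<bullet> cov w + \<rho> * norm (cov w)) * (?K * exp (\<rho> * norm (cov w)))"
    using one_plus_power_le_exp[of "norm (cov w)" \<rho> 3] \<rho> unfolding env_def
    by (intro mult_left_mono) simp_all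
  also have "\<dots> = ?K * exp (\<beta> \<bullet> cov w + 2 * \<rho> * norm (cov w))"
  proof -
    have "\<beta> \<bullet> cov w + 2 * \<rho> * norm (cov w) = \<beta> \<bullet> cov w + \<rho> * norm (cov w) + \<rho> * norm (cov w)"
      by simp
    then show ?thesis
      by (simp only: exp_add mult.left_commute mult.assoc)
  qed
  finally have "env w ^ q \<le> (?K * exp (\<beta> \<bullet> cov w + 2 * \<rho> * norm (cov w))) ^ q"
    by (intro power_mono env_nonneg)
  then show "\<bar>env w ^ q\<bar> \<le> ?K ^ q * exp (\<beta> \<bullet> cov w + 2 * \<rho> * norm (cov w)) ^ q"
    by (subst abs_of_nonneg) (simp_all only: power_mult_distrib zero_le_power env_nonneg)
qed measurable

lemma env_integrable: "integrable P env"
  using env_moment[of 1] by simp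

lemma env_dominates:
  "\<bar>w0 w\<bar> \<le> env w" "\<bar>w1 k w\<bar> \<le> env w" "\<bar>w2 k l w\<bar> \<le> env w"
proof -
  let ?x = "1 + norm (cov w)"
  have pow: "?x ^ j \<le> ?x ^ 3" if "j \<le> 3" for j
    using that by (intro power_increasing) auto
  have env: "w0 w * c \<le> env w" if "c \<le> ?x ^ 3" for c
  proof -
    have "w0 w * c \<le> w0 w * ?x ^ 3"
      using that by (intro mult_left_mono) (auto simp: w0_def)
    also have "\<dots> \<le> env w"
      using \<rho> unfolding env_def w0_def by (intro mult_right_mono) auto
    finally show ?thesis .
  qed
  have c: "\<bar>cov w $ k\<bar> \<le> ?x" for k
    using component_le_norm_cart[of "cov w" k] by simp
  show "\<bar>w0 w\<bar> \<le> env w"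
    using env[of 1] pow[of 0] by (simp add: w0_def)
  show "\<bar>w1 k w\<bar> \<le> env w"
    using env[of "\<bar>cov w $ k\<bar>"] pow[of 1] c[of k] by (simp add: w1_def abs_mult w0_def)
  show "\<bar>w2 k l w\<bar> \<le> env w"
    using env[of "\<bar>cov w $ k * cov w $ l\<bar>"] pow[of 2] mult_mono[OF c[of k] c[of l]]
    by (simp add: w2_def abs_mult w0_def power2_eq_square)
qed

lemma dominated_moment:
  fixes h :: "_ \<Rightarrow> real"
  assumes [measurable]: "h \<in> borel_measurable P" and h: "\<And>w. \<bar>h w\<bar> \<le> env w"
  shows "integrable P (\<lambda>w. h w ^ q)"
proof (rule integrable_dominated[OF env_moment[of q]])
  show "\<bar>h w ^ q\<bar> \<le> env w ^ q" for w
    unfolding power_abs by (intro power_mono h) simp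
qed measurable

lemma dominated_integrable:
  fixes h :: "_ \<Rightarrow> real"
  assumes "h \<in> borel_measurable P" "\<And>w. \<bar>h w\<bar> \<le> env w"
  shows "integrable P h"
  using dominated_moment[OF assms, of 1] by simp

lemma w_integrable: "integrable P w0" "integrable P (w1 k)" "integrable P (w2 k l)"
  by (intro dominated_integrable w_measurable env_dominates)+

lemma tail_measurable [measurable]:
  fixes h :: "_ \<Rightarrow> real"
  assumes [measurable]: "h \<in> borel_measurable P"
  shows "tail fst h \<in> borel_measurable borel"
  unfolding tail_def of_bool_def by measurable

text \<open>In the notation of the model these are \<open>\<Phi>\<close> and the entries of \<open>D\<^sup>1\<close> and \<open>D\<^sup>2\<close>.\<close>
definition R0 where "R0 u = tail fst w0 u"
definition R1 where "R1 k u = tail fst (w1 k) u"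
definition R2 where "R2 k l u = tail fst (w2 k l) u"

lemma R_measurable [measurable]:
  "R0 \<in> borel_measurable borel" "R1 k \<in> borel_measurable borel" "R2 k l \<in> borel_measurable borel"
  unfolding R0_def[abs_def] R1_def[abs_def] R2_def[abs_def] by measurable

definition EH where "EH = (\<integral>w. env w \<partial>P)"

lemma EH_nonneg: "0 \<le> EH"
  unfolding EH_def by (intro integral_nonneg_AE) (auto simp: env_nonneg)

lemma tail_le_EH:
  assumes [measurable]: "h \<in> borel_measurable P" and h: "\<And>w. \<bar>h w\<bar> \<le> env w" 
  shows "\<bar>tail fst h u\<bar> \<le> EH"
proof -
  have i: "integrable P h"
    by (rule dominated_integrable[OF assms])
  have "\<bar>tail fst h u\<bar> \<le> (\<integral>w. \<bar>h w\<bar> \<partial>P)"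
    by (rule abs_tail_le[OF _ i]) measurable
  also have "\<dots> \<le> EH"
    unfolding EH_def using i env_integrable h by (intro integral_mono) auto
  finally show ?thesis .
qed

lemma R_le: "\<bar>R0 u\<bar> \<le> EH" "\<bar>R1 k u\<bar> \<le> EH" "\<bar>R2 k l u\<bar> \<le> EH"
  unfolding R0_def R1_def R2_def by (intro tail_le_EH w_measurable env_dominates)+

lemma R0_antimono: "u \<le> v \<Longrightarrow> R0 v \<le> R0 u"
  unfolding R0_def tail_def
  by (intro integral_mono tail_integrable w_integrable) (auto simp: w0_def)

lemma R0_pos: "0 < R0 \<tau>"
proof -
  have nn: "AE w in P. 0 \<le> of_bool (\<tau> \<le> fst w) * w0 w"
    by (auto simp: w0_def)
  have int: "integrable P (\<lambda>w. of_bool (\<tau> \<le> fst w) * w0 w)"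
    by (intro tail_integrable w_integrable) measurable
  have "R0 \<tau> \<noteq> 0"
  proof
    assume "R0 \<tau> = 0"
    then have "AE w in P. of_bool (\<tau> \<le> fst w) * w0 w = 0"
      using integral_nonneg_eq_0_iff_AE[OF int nn] by (simp add: R0_def tail_def)
    then have "AE w in P. \<not> \<tau> \<le> fst w"
      by eventually_elim (auto simp: w0_def)
    then have "measure P {w \<in> space P. \<tau> \<le> fst w} = 0"
      by (subst P.prob_eq_0) auto
    with at_risk show False by simp
  qed
  moreover have "0 \<le> R0 \<tau>"
    unfolding R0_def tail_def using nn by (rule integral_nonneg_AE)
  ultimately show ?thesis by simp
qed

lemma R0_ge: "u \<le> \<tau> \<Longrightarrow> R0 \<tau> \<le> R0 u"
  by (rule R0_antimono)

lemma integrable_lam: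
  assumes [measurable]: "g \<in> borel_measurable borel" and g: "\<And>u. u \<le> \<tau> \<Longrightarrow> \<bar>g u\<bar> \<le> c"
  shows "integrable lborel (\<lambda>u. lam u * g u)"
proof (rule Bochner_Integration.integrable_bound)
  show "integrable lborel (\<lambda>u. (L * \<bar>c\<bar>) * indicator {0..\<tau>} u)"
    by (intro integrable_mult_right integrable_real_indicator) (auto simp: emeasure_lborel_Icc_eq)
  show "AE u in lborel. norm (lam u * g u) \<le> norm (L * \<bar>c\<bar> * indicator {0..\<tau>} u)"
  proof (intro always_eventually allI)
    fix u
    show "norm (lam u * g u) \<le> norm (L * \<bar>c\<bar> * indicator {0..\<tau>} u)"
    proof (cases "u \<in> {0<..\<tau>}")
      case True
      then have "\<bar>lam u\<bar> * \<bar>g u\<bar> \<le> L * \<bar>c\<bar>"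
        using lam_nonneg[of u] lam_le[of u] g[of u] by (intro mult_mono) auto
      then show ?thesis
        using True lam_nonneg[of u] lam_le[of u] by (simp add: abs_mult)
    next
      case False
      then show ?thesis using lam_outside[of u] by simp
    qed
  qed
qed measurable

lemma compensator_nonneg:
  assumes [measurable]: "k \<in> borel_measurable (borel \<Otimes>\<^sub>M borel)"
    and k: "\<And>u z. 0 \<le> k (u, z)" "\<And>u z. k (u, z) \<le> c * (1 + norm z) ^ q" and q: "q \<ge> 1"
  shows "integrable P (\<lambda>w. of_bool (event w) * k (fst w, cov w))" (is ?I)
    and "(\<integral>w. of_bool (event w) * k (fst w, cov w) \<partial>P)
      = (\<integral>u. lam u * (\<integral>w. of_bool (u \<le> fst w) * (w0 w * k (u, cov w)) \<partial>P) \<partial>lborel)" (is ?E)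
    and "integrable lborel (\<lambda>u. lam u * (\<integral>w. of_bool (u \<le> fst w) * (w0 w * k (u, cov w)) \<partial>P))" (is ?J)
proof -
  let ?g = "\<lambda>u. \<integral>w. of_bool (u \<le> fst w) * (w0 w * k (u, cov w)) \<partial>P"
  have bound_int: "integrable P (\<lambda>w. c * (w0 w * (1 + norm (cov w)) ^ q))"
    by (intro integrable_mult_right w0_moment q)
  have bound: "\<bar>of_bool (u \<le> fst w) * (w0 w * k (u, cov w))\<bar> \<le> c * (w0 w * (1 + norm (cov w)) ^ q)" for u w
  proof -
    have "w0 w * k (u, cov w) \<le> w0 w * (c * (1 + norm (cov w)) ^ q)"
      using k(2) by (intro mult_left_mono) (auto simp: w0_def)
    moreover have "0 \<le> w0 w * k (u, cov w)"
      using k(1) by (simp add: w0_def)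
    ultimately show ?thesis
      by (auto simp: mult.left_commute)
  qed
  have inner_int: "integrable P (\<lambda>w. of_bool (u \<le> fst w) * (w0 w * k (u, cov w)))" for u
    by (rule integrable_dominated[OF bound_int bound]) measurable
  have g_le: "\<bar>?g u\<bar> \<le> (\<integral>w. c * (w0 w * (1 + norm (cov w)) ^ q) \<partial>P)" for u
    using bound inner_int bound_int
    by (intro order_trans[OF integral_abs_bound] integral_mono) auto
  have g0: "0 \<le> ?g u" for u
    using k(1) by (intro integral_nonneg_AE) (auto simp: w0_def)
  have [measurable]: "?g \<in> borel_measurable borel"
    unfolding of_bool_def by measurable
  show J: ?J
    by (rule integrable_lam[OF _ g_le]) measurable
  have "(\<integral>\<^sup>+w. ennreal (of_bool (event w) * k (fst w, cov w)) \<partial>P)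
      = (\<integral>\<^sup>+w. of_bool (event w) * ennreal (k (fst w, cov w)) \<partial>P)"
    by (intro nn_integral_cong) auto
  also have "\<dots> = (\<integral>\<^sup>+u. (\<integral>\<^sup>+w. ennreal (lam u * exp (\<beta> \<bullet> snd (snd w))) * of_bool (u \<le> fst w) * ennreal (k (u, snd (snd w))) \<partial>P) \<partial>lborel)"
    by (rule compensator) measurable
  also have "\<dots> = (\<integral>\<^sup>+u. ennreal (lam u * ?g u) \<partial>lborel)"
  proof (intro nn_integral_cong)
    fix u
    have "(\<integral>\<^sup>+w. ennreal (lam u * exp (\<beta> \<bullet> snd (snd w))) * of_bool (u \<le> fst w) * ennreal (k (u, snd (snd w))) \<partial>P)
        = (\<integral>\<^sup>+w. ennreal (lam u * (of_bool (u \<le> fst w) * (w0 w * k (u, cov w)))) \<partial>P)"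
      using lam_nonneg k(1) by (intro nn_integral_cong) (auto simp: w0_def ennreal_mult[symmetric] mult.assoc)
    also have "\<dots> = ennreal (lam u * ?g u)"
      using inner_int lam_nonneg k(1)
      by (subst nn_integral_eq_integral) (auto simp: w0_def)
    finally show "(\<integral>\<^sup>+w. ennreal (lam u * exp (\<beta> \<bullet> snd (snd w))) * of_bool (u \<le> fst w) * ennreal (k (u, snd (snd w))) \<partial>P)
        = ennreal (lam u * ?g u)" .
  qed
  also have "\<dots> = ennreal (\<integral>u. lam u * ?g u \<partial>lborel)"
    using J g0 lam_nonneg by (intro nn_integral_eq_integral) auto
  finally have E: "(\<integral>\<^sup>+w. ennreal (of_bool (event w) * k (fst w, cov w)) \<partial>P) = ennreal (\<integral>u. lam u * ?g u \<partial>lborel)" .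
  show ?I
    using E k(1) by (intro integrableI_nonneg) auto
  show ?E
    using E k(1) g0 lam_nonneg by (subst integral_eq_nn_integral) (auto intro!: enn2real_ennreal integral_nonneg_AE)
qed

text \<open>The bound by a power of \<open>1 + norm z\<close> is all that is required of \<open>k\<close>, although only the weighted powers
\<open>w0 w * (1 + norm (cov w)) ^ q\<close> are known to be integrable: the factor \<open>of_bool (event w)\<close> supplies the weight.\<close>
lemma compensator_real:
  assumes [measurable]: "k \<in> borel_measurable (borel \<Otimes>\<^sub>M borel)"
    and k: "\<And>u z. \<bar>k (u, z)\<bar> \<le> c * (1 + norm z) ^ q" and q: "q \<ge> 1"
  shows "integrable P (\<lambda>w. of_bool (event w) * k (fst w, cov w))" (is ?I)
    and "(\<integral>w. of_bool (event w) * k (fst w, cov w) \<partial>P)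
      = (\<integral>u. lam u * (\<integral>w. of_bool (u \<le> fst w) * (w0 w * k (u, cov w)) \<partial>P) \<partial>lborel)" (is ?E)
proof -
  define kp where "kp x = max 0 (k x)" for x
  define kn where "kn x = max 0 (- k x)" for x
  have [measurable]: "kp \<in> borel_measurable (borel \<Otimes>\<^sub>M borel)" "kn \<in> borel_measurable (borel \<Otimes>\<^sub>M borel)"
    unfolding kp_def[abs_def] kn_def[abs_def] by measurable
  have split: "k x = kp x - kn x" for x
    by (simp add: kp_def kn_def)
  have b: "0 \<le> kp (u, z)" "0 \<le> kn (u, z)" "kp (u, z) \<le> c * (1 + norm z) ^ q" "kn (u, z) \<le> c * (1 + norm z) ^ q" for u z
    using k[of u z] by (auto simp: kp_def kn_def)
  note p = compensator_nonneg[of kp, OF _ b(1,3) q] and n = compensator_nonneg[of kn, OF _ b(2,4) q]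
  have int: "integrable P (\<lambda>w. of_bool (u \<le> fst w) * (w0 w * h (u, cov w)))"
    if [measurable]: "h \<in> borel_measurable (borel \<Otimes>\<^sub>M borel)" and h: "\<And>u z. 0 \<le> h (u, z)" "\<And>u z. h (u, z) \<le> c * (1 + norm z) ^ q" for h and u :: real
  proof (rule integrable_dominated)
    show "integrable P (\<lambda>w. c * (w0 w * (1 + norm (cov w)) ^ q))"
      by (intro integrable_mult_right w0_moment q)
    show "\<bar>of_bool (u \<le> fst w) * (w0 w * h (u, cov w))\<bar> \<le> c * (w0 w * (1 + norm (cov w)) ^ q)" for w
    proof -
      have "w0 w * h (u, cov w) \<le> w0 w * (c * (1 + norm (cov w)) ^ q)"
        using h(2) by (intro mult_left_mono) (auto simp: w0_def)
      moreover have "0 \<le> w0 w * h (u, cov w)"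
        using h(1) by (simp add: w0_def)
      ultimately show ?thesis
        by (auto simp: mult.left_commute)
    qed
  qed measurable
  show ?I
    unfolding split right_diff_distrib by (intro Bochner_Integration.integrable_diff p(1) n(1)) measurable
  have "(\<integral>w. of_bool (event w) * k (fst w, cov w) \<partial>P)
      = (\<integral>w. of_bool (event w) * kp (fst w, cov w) \<partial>P) - (\<integral>w. of_bool (event w) * kn (fst w, cov w) \<partial>P)"
    unfolding split right_diff_distrib by (intro Bochner_Integration.integral_diff p(1) n(1)) measurable
  also have "\<dots> = (\<integral>u. lam u * (\<integral>w. of_bool (u \<le> fst w) * (w0 w * kp (u, cov w)) \<partial>P)
      - lam u * (\<integral>w. of_bool (u \<le> fst w) * (w0 w * kn (u, cov w)) \<partial>P) \<partial>lborel)"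
    by (subst p(2), measurable, subst n(2), measurable)
       (intro Bochner_Integration.integral_diff[symmetric] p(3) n(3); measurable)
  also have "\<dots> = (\<integral>u. lam u * (\<integral>w. of_bool (u \<le> fst w) * (w0 w * k (u, cov w)) \<partial>P) \<partial>lborel)"
    unfolding right_diff_distrib[symmetric] split
    by (intro Bochner_Integration.integral_cong refl arg_cong2[where f = "(*)"] Bochner_Integration.integral_diff[symmetric, THEN trans])
       (use int[of kp] int[of kn] b in \<open>auto simp: right_diff_distrib\<close>)
  finally show ?E .
qed

end

context cox_sample
begin

text \<open>The limits of the risk set mean and covariance, and \<open>1 / R0\<close>, are set to 0 beyond \<open>\<tau>\<close>, where \<open>R0\<close> may
vanish; this makes them bounded everywhere.\<close>
definition risk_mean_lim where "risk_mean_lim k u = (if u \<le> \<tau> then R1 k u / R0 u else 0)"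
definition risk_cov_lim where
  "risk_cov_lim k l u = (if u \<le> \<tau> then R2 k l u / R0 u - risk_mean_lim k u * risk_mean_lim l u else 0)"
definition inverse_R0 where "inverse_R0 u = (if u \<le> \<tau> then 1 / R0 u else 0)"

definition score_term where "score_term k w = of_bool (event w) * (cov w $ k - risk_mean_lim k (fst w))"
definition info_term where "info_term k l w = of_bool (event w) * risk_cov_lim k l (fst w)"
definition hazard_term where "hazard_term w = of_bool (event w) * inverse_R0 (fst w)"

definition mean_bound where "mean_bound = EH / R0 \<tau>"

lemma R0_pos': "u \<le> \<tau> \<Longrightarrow> 0 < R0 u"
  using R0_pos R0_ge[of u] by linarith

lemma lim_measurable [measurable]:
  "risk_mean_lim k \<in> borel_measurable borel" "risk_cov_lim k l \<in> borel_measurable borel" "inverse_R0 \<in> borel_measurable borel"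
  unfolding risk_cov_lim_def[abs_def] risk_mean_lim_def[abs_def] inverse_R0_def[abs_def] by measurable

lemma term_measurable [measurable]:
  "score_term k \<in> borel_measurable P" "info_term k l \<in> borel_measurable P" "hazard_term \<in> borel_measurable P"
  unfolding score_term_def[abs_def] info_term_def[abs_def] hazard_term_def[abs_def] by measurable

lemma mean_bound_nonneg: "0 \<le> mean_bound"
  using EH_nonneg R0_pos by (simp add: mean_bound_def)

lemma quotient_le: "u \<le> \<tau> \<Longrightarrow> \<bar>a\<bar> \<le> EH \<Longrightarrow> \<bar>a / R0 u\<bar> \<le> mean_bound"
  unfolding mean_bound_def abs_divide
  using R0_ge[of u] R0_pos by (intro frac_le) auto

lemma risk_mean_lim_le: "\<bar>risk_mean_lim k u\<bar> \<le> mean_bound"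
  unfolding risk_mean_lim_def using quotient_le[OF _ R_le(2)] mean_bound_nonneg by simp

lemma risk_cov_lim_le: "\<bar>risk_cov_lim k l u\<bar> \<le> mean_bound + mean_bound * mean_bound"
proof (cases "u \<le> \<tau>")
  case True
  have "\<bar>risk_mean_lim k u * risk_mean_lim l u\<bar> \<le> mean_bound * mean_bound"
    unfolding abs_mult by (intro mult_mono risk_mean_lim_le mean_bound_nonneg) simp
  moreover have "\<bar>R2 k l u / R0 u\<bar> \<le> mean_bound"
    using quotient_le[OF True R_le(3)] .
  ultimately have "\<bar>R2 k l u / R0 u - risk_mean_lim k u * risk_mean_lim l u\<bar> \<le> mean_bound + mean_bound * mean_bound"
    by linarith
  then show ?thesis
    using True by (simp add: risk_cov_lim_def)
qed (use mean_bound_nonneg in \<open>simp add: risk_cov_lim_def\<close>)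

lemma inverse_R0_le: "\<bar>inverse_R0 u\<bar> \<le> 1 / R0 \<tau>"
  unfolding inverse_R0_def using R0_ge[of u] R0_pos R0_pos'[of u] by (auto simp: divide_simps)

lemma inverse_R0_mult: "u \<le> \<tau> \<Longrightarrow> inverse_R0 u * R0 u = 1"
  using R0_pos'[of u] by (simp add: inverse_R0_def)

lemma of_bool_power: "q \<ge> 1 \<Longrightarrow> (of_bool b * x) ^ q = of_bool b * x ^ q" for x :: real
  by (cases b) auto

lemma score_term_moment:
  assumes "q \<ge> 1"
  shows "integrable P (\<lambda>w. score_term k w ^ q)"
proof -
  define f where "f = (\<lambda>(u, z :: real ^ 'd). (z $ k - risk_mean_lim k u) ^ q)"
  have m: "f \<in> borel_measurable (borel \<Otimes>\<^sub>M borel)"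
    unfolding f_def by measurable
  have b: "\<bar>f (u, z)\<bar> \<le> (1 + mean_bound) ^ q * (1 + norm z) ^ q" for u z
  proof -
    have "\<bar>z $ k - risk_mean_lim k u\<bar> \<le> norm z + mean_bound"
      using component_le_norm_cart[of z k] risk_mean_lim_le[of k u] by linarith
    also have "\<dots> \<le> (1 + mean_bound) * (1 + norm z)"
      using mean_bound_nonneg by (simp add: distrib_left distrib_right)
    finally show ?thesis
      unfolding f_def by (simp add: power_abs power_mult_distrib[symmetric] power_mono)
  qed
  show ?thesis
    using compensator_real(1)[OF m b assms] assms
    by (simp add: score_term_def f_def of_bool_power)
qed

lemma bounded_moment:
  fixes h :: "_ \<Rightarrow> real"
  assumes [measurable]: "h \<in> borel_measurable P" and h: "\<And>w. \<bar>h w\<bar> \<le> c"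
  shows "integrable P (\<lambda>w. h w ^ q)"
proof (rule integrable_dominated)
  show "integrable P (\<lambda>_. c ^ q)" by simp
  show "\<bar>h w ^ q\<bar> \<le> c ^ q" for w
    unfolding power_abs by (intro power_mono h) simp
qed measurable

lemma info_term_moment: "integrable P (\<lambda>w. info_term k l w ^ q)"
proof (rule bounded_moment)
  show "\<bar>info_term k l w\<bar> \<le> mean_bound + mean_bound * mean_bound" for w
    using risk_cov_lim_le[of k l "fst w"] by (simp add: info_term_def mean_bound_nonneg)
qed measurable

lemma hazard_term_moment: "integrable P (\<lambda>w. hazard_term w ^ q)"
proof (rule bounded_moment)
  show "\<bar>hazard_term w\<bar> \<le> 1 / R0 \<tau>" for w
    using inverse_R0_le[of "fst w"] R0_pos by (simp add: hazard_term_def)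
qed measurable

lemma compensator_bounded:
  assumes [measurable]: "g \<in> borel_measurable borel" and g: "\<And>u. \<bar>g u\<bar> \<le> c"
  shows "(\<integral>w. of_bool (event w) * g (fst w) \<partial>P) = (\<integral>u. lam u * (g u * R0 u) \<partial>lborel)"
proof -
  have m: "(\<lambda>(u, z :: real ^ 'd). g u) \<in> borel_measurable (borel \<Otimes>\<^sub>M borel)"
    by measurable
  have b: "\<bar>(\<lambda>(u, z :: real ^ 'd). g u) (u, z)\<bar> \<le> c * (1 + norm z) ^ 1" for u z
  proof -
    have "0 \<le> c"
      using g[of u] by linarith
    then have "c * 1 \<le> c * (1 + norm z)"
      by (intro mult_left_mono) auto
    then show ?thesis using g[of u] by simp
  qed
  have "(\<integral>w. of_bool (u \<le> fst w) * (w0 w * g u) \<partial>P) = g u * R0 u" for u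
    by (simp add: R0_def tail_def mult.assoc[symmetric])
  then show ?thesis
    using compensator_real(2)[OF m b order_refl] by simp
qed

text \<open>Among the subjects at risk the weighted covariates have mean \<open>risk_mean_lim\<close> by definition, and events
select subjects with the same weights.\<close>
lemma score_term_mean: "(\<integral>w. score_term k w \<partial>P) = 0"
proof -
  define f where "f = (\<lambda>(u, z :: real ^ 'd). z $ k - risk_mean_lim k u)"
  have m: "f \<in> borel_measurable (borel \<Otimes>\<^sub>M borel)"
    unfolding f_def by measurable
  have b: "\<bar>f (u, z)\<bar> \<le> (1 + mean_bound) * (1 + norm z) ^ 1" for u z
  proof -
    have "\<bar>z $ k - risk_mean_lim k u\<bar> \<le> norm z + mean_bound"
      using component_le_norm_cart[of z k] risk_mean_lim_le[of k u] by linarith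
    also have "\<dots> \<le> (1 + mean_bound) * (1 + norm z)"
      using mean_bound_nonneg by (simp add: distrib_left distrib_right)
    finally show ?thesis
      unfolding f_def by simp
  qed
  have zero: "lam u * (\<integral>w. of_bool (u \<le> fst w) * (w0 w * f (u, cov w)) \<partial>P) = 0" for u
  proof (cases "u \<in> {0<..\<tau>}")
    case True
    have "(\<integral>w. of_bool (u \<le> fst w) * (w0 w * f (u, cov w)) \<partial>P)
        = (\<integral>w. of_bool (u \<le> fst w) * w1 k w - risk_mean_lim k u * (of_bool (u \<le> fst w) * w0 w) \<partial>P)"
      by (simp add: f_def w1_def algebra_simps)
    also have "\<dots> = R1 k u - risk_mean_lim k u * R0 u"
      using tail_integrable[OF P_measurable(1) w_integrable(1), of u] tail_integrable[OF P_measurable(1) w_integrable(2), of u k]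
      by (simp add: R0_def R1_def tail_def)
    also have "\<dots> = 0"
      using True R0_pos'[of u] by (simp add: risk_mean_lim_def)
    finally show ?thesis by simp
  qed (simp add: lam_outside)
  have "(\<integral>w. score_term k w \<partial>P) = (\<integral>w. of_bool (event w) * f (fst w, cov w) \<partial>P)"
    by (simp add: score_term_def f_def)
  also have "\<dots> = (\<integral>u. lam u * (\<integral>w. of_bool (u \<le> fst w) * (w0 w * f (u, cov w)) \<partial>P) \<partial>lborel)"
    by (rule compensator_real(2)[OF m b order_refl])
  also have "\<dots> = 0"
    unfolding zero by simp
  finally show ?thesis .
qed

definition info_lim where "info_lim k l = (\<integral>u. lam u * (risk_cov_lim k l u * R0 u) \<partial>lborel)"

lemma info_term_mean: "(\<integral>w. info_term k l w \<partial>P) = info_lim k l"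
  unfolding info_term_def info_lim_def by (rule compensator_bounded[OF _ risk_cov_lim_le]) measurable

lemma hazard_term_tail:
  "tail (\<lambda>w. - fst w) hazard_term (- s) = (\<integral>u. lam u * indicator {..s} u \<partial>lborel)"
proof -
  have "tail (\<lambda>w. - fst w) hazard_term (- s) = (\<integral>w. of_bool (event w) * (of_bool (fst w \<le> s) * inverse_R0 (fst w)) \<partial>P)"
    unfolding tail_def hazard_term_def by (simp add: mult.left_commute)
  also have "\<dots> = (\<integral>u. lam u * ((of_bool (u \<le> s) * inverse_R0 u) * R0 u) \<partial>lborel)"
  proof (rule compensator_bounded)
    show "\<bar>of_bool (u \<le> s) * inverse_R0 u\<bar> \<le> 1 / R0 \<tau>" for u
      using inverse_R0_le[of u] R0_pos by simp
  qed measurable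
  also have "\<dots> = (\<integral>u. lam u * indicator {..s} u \<partial>lborel)"
  proof (intro Bochner_Integration.integral_cong refl)
    fix u
    show "lam u * ((of_bool (u \<le> s) * inverse_R0 u) * R0 u) = lam u * indicator {..s} u"
    proof (cases "u \<in> {0<..\<tau>}")
      case True
      then show ?thesis
        using inverse_R0_mult[of u] by (simp add: indicator_def mult.assoc)
    qed (simp add: lam_outside)
  qed
  finally show ?thesis .
qed

abbreviation key0 :: "real \<times> bool \<times> (real ^ 'd) \<Rightarrow> real" where "key0 \<equiv> \<lambda>_. 0"

text \<open>The deviations that control the whole error, as pairs of a key and a function: \<open>key0\<close> makes
\<open>emp key0 h n 0\<close> a plain average, and the key \<open>- fst\<close> selects early times.\<close>
definition family :: "((real \<times> bool \<times> (real ^ 'd) \<Rightarrow> real) \<times> (real \<times> bool \<times> (real ^ 'd) \<Rightarrow> real)) set" where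
  "family = {(fst, w0), (key0, env), ((\<lambda>w. - fst w), hazard_term)}
     \<union> range (\<lambda>k. (fst, w1 k)) \<union> range (\<lambda>(k, l). (fst, w2 k l))
     \<union> range (\<lambda>k. (key0, score_term k)) \<union> range (\<lambda>(k, l). (key0, info_term k l))"

lemma finite_family: "finite family"
  unfolding family_def by simp

lemma family_moment:
  assumes "(\<kappa>, h) \<in> family"
  shows "\<kappa> \<in> borel_measurable P" "q \<ge> 1 \<Longrightarrow> integrable P (\<lambda>w. h w ^ q)" "integrable P h"
proof -
  have neg: "(\<lambda>w. - fst w) \<in> borel_measurable P"
    by measurable
  show "\<kappa> \<in> borel_measurable P"
    using assms neg P_measurable(1) unfolding family_def by (elim UnE insertE emptyE rangeE) (auto split: prod.splits)
  have mom: "integrable P (\<lambda>w. h w ^ q)" if q: "q \<ge> 1" for q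
  proof -
    consider "h = w0" | "h = env" | "h = hazard_term" | k where "h = w1 k" | k l where "h = w2 k l"
      | k where "h = score_term k" | k l where "h = info_term k l"
      using assms unfolding family_def by fast
    then show ?thesis
    proof cases
      case 1 then show ?thesis by (simp only: dominated_moment[OF w_measurable(2) env_dominates(1)])
    next
      case 2 then show ?thesis by (simp only: env_moment)
    next
      case 3 then show ?thesis by (simp only: hazard_term_moment)
    next
      case 4 then show ?thesis by (simp only: dominated_moment[OF w_measurable(3) env_dominates(2)])
    next
      case 5 then show ?thesis by (simp only: dominated_moment[OF w_measurable(4) env_dominates(3)])
    next
      case 6 then show ?thesis by (simp only: score_term_moment[OF q])
    next
      case 7 then show ?thesis by (simp only: info_term_moment)
    qed
  qed
  show "q \<ge> 1 \<Longrightarrow> integrable P (\<lambda>w. h w ^ q)"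
    by (rule mom)
  show "integrable P h"
    using mom[of 1] by simp
qed

definition total_dev :: "nat \<Rightarrow> 'a \<Rightarrow> real" where
  "total_dev n \<omega> = (\<Sum>(\<kappa>, h)\<in>family. dev \<kappa> h n \<omega>)"

lemma family_dev_nonneg: "(\<kappa>, h) \<in> family \<Longrightarrow> 0 \<le> dev \<kappa> h n \<omega>"
  using dev_nonneg family_moment by blast

lemma total_dev_measurable [measurable]: "total_dev n \<in> borel_measurable M"
  unfolding total_dev_def
proof (intro borel_measurable_sum)
  fix x assume "x \<in> family"
  then show "(\<lambda>\<omega>. case x of (\<kappa>, h) \<Rightarrow> dev \<kappa> h n \<omega>) \<in> borel_measurable M"
    using dev_measurable[OF family_moment(1,3)] by (cases x) auto
qed

lemma total_dev_nonneg: "0 \<le> total_dev n \<omega>"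
  unfolding total_dev_def by (intro sum_nonneg) (use family_dev_nonneg in auto)

lemma family_emp:
  assumes "(\<kappa>, h) \<in> family"
  shows "\<bar>emp \<kappa> h n u \<omega> - tail \<kappa> h u\<bar> \<le> total_dev n \<omega>"
proof -
  have "\<bar>emp \<kappa> h n u \<omega> - tail \<kappa> h u\<bar> \<le> dev \<kappa> h n \<omega>"
    by (rule emp_dev[OF family_moment(1,3)[OF assms]])
  also have "\<dots> \<le> total_dev n \<omega>"
    unfolding total_dev_def
    using member_le_sum[of "(\<kappa>, h)" family "\<lambda>(\<kappa>, h). dev \<kappa> h n \<omega>"] assms finite_family family_dev_nonneg by auto
  finally show ?thesis .
qed

lemma total_dev_moment:
  assumes m: "m \<ge> 1"
  shows "\<exists>C\<ge>0. \<forall>n\<ge>1. (\<integral>\<^sup>+\<omega>. ennreal (total_dev n \<omega> ^ (2 * m)) \<partial>M) \<le> ennreal (C / real n ^ m)"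
proof -
  have "\<exists>C\<ge>0. \<forall>n\<ge>1. (\<integral>\<^sup>+\<omega>. ennreal (dev (fst x) (snd x) n \<omega> ^ (2 * m)) \<partial>M) \<le> ennreal (C / real n ^ m)"
    if "x \<in> family" for x
  proof -
    have x: "(fst x, snd x) \<in> family"
      using that by simp
    show ?thesis
      by (rule dev_moment[OF family_moment(1,3)[OF x] m family_moment(2)[OF x]]) (use m in simp)
  qed
  then have "\<forall>x\<in>family. \<exists>C. 0 \<le> C \<and> (\<forall>n\<ge>1. (\<integral>\<^sup>+\<omega>. ennreal (dev (fst x) (snd x) n \<omega> ^ (2 * m)) \<partial>M) \<le> ennreal (C / real n ^ m))"
    by blast
  from bchoice[OF this] obtain C where "\<forall>x\<in>family. 0 \<le> C x \<and>
      (\<forall>n\<ge>1. (\<integral>\<^sup>+\<omega>. ennreal (dev (fst x) (snd x) n \<omega> ^ (2 * m)) \<partial>M) \<le> ennreal (C x / real n ^ m))" ..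
  then have C: "\<And>x. x \<in> family \<Longrightarrow> 0 \<le> C x"
    "\<And>x n. x \<in> family \<Longrightarrow> n \<ge> 1 \<Longrightarrow> (\<integral>\<^sup>+\<omega>. ennreal (dev (fst x) (snd x) n \<omega> ^ (2 * m)) \<partial>M) \<le> ennreal (C x / real n ^ m)"
    by simp_all
  define c where "c = real (card family) ^ (2 * m - 1)"
  have "(\<integral>\<^sup>+\<omega>. ennreal (total_dev n \<omega> ^ (2 * m)) \<partial>M) \<le> ennreal (c * (\<Sum>x\<in>family. C x) / real n ^ m)" if n: "n \<ge> 1" for n
  proof -
    have dm: "dev (fst x) (snd x) n \<in> borel_measurable M" if "x \<in> family" for x
      using dev_measurable[OF family_moment(1,3), of "fst x" "snd x" "fst x" "snd x"] that by simp
    have d0: "0 \<le> dev (fst x) (snd x) n \<omega>" if "x \<in> family" for x \<omega>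
      using family_dev_nonneg[of "fst x" "snd x"] that by simp
    have "(\<integral>\<^sup>+\<omega>. ennreal (total_dev n \<omega> ^ (2 * m)) \<partial>M)
        \<le> (\<integral>\<^sup>+\<omega>. ennreal c * (\<Sum>x\<in>family. ennreal (dev (fst x) (snd x) n \<omega> ^ (2 * m))) \<partial>M)"
    proof (intro nn_integral_mono)
      fix \<omega>
      have "total_dev n \<omega> ^ (2 * m) \<le> c * (\<Sum>x\<in>family. dev (fst x) (snd x) n \<omega> ^ (2 * m))"
        unfolding total_dev_def c_def split_beta' using m
        by (intro sum_power_le[OF finite_family d0]) auto
      then have "ennreal (total_dev n \<omega> ^ (2 * m)) \<le> ennreal (c * (\<Sum>x\<in>family. dev (fst x) (snd x) n \<omega> ^ (2 * m)))"
        by (rule ennreal_leI)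
      also have "\<dots> = ennreal c * (\<Sum>x\<in>family. ennreal (dev (fst x) (snd x) n \<omega> ^ (2 * m)))"
        using d0 by (subst ennreal_mult) (auto simp: c_def intro!: sum_nonneg)
      finally show "ennreal (total_dev n \<omega> ^ (2 * m))
          \<le> ennreal c * (\<Sum>x\<in>family. ennreal (dev (fst x) (snd x) n \<omega> ^ (2 * m)))" .
    qed
    also have "\<dots> = ennreal c * (\<Sum>x\<in>family. (\<integral>\<^sup>+\<omega>. ennreal (dev (fst x) (snd x) n \<omega> ^ (2 * m)) \<partial>M))"
    proof -
      have meas: "(\<lambda>\<omega>. ennreal (dev (fst x) (snd x) n \<omega> ^ (2 * m))) \<in> borel_measurable M" if "x \<in> family" for x
      proof -
        note dm [OF that, measurable]
        show ?thesis by measurable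
      qed
      have "(\<integral>\<^sup>+\<omega>. ennreal c * (\<Sum>x\<in>family. ennreal (dev (fst x) (snd x) n \<omega> ^ (2 * m))) \<partial>M)
          = ennreal c * (\<integral>\<^sup>+\<omega>. (\<Sum>x\<in>family. ennreal (dev (fst x) (snd x) n \<omega> ^ (2 * m))) \<partial>M)"
        by (intro nn_integral_cmult borel_measurable_sum meas)
      also have "(\<integral>\<^sup>+\<omega>. (\<Sum>x\<in>family. ennreal (dev (fst x) (snd x) n \<omega> ^ (2 * m))) \<partial>M)
          = (\<Sum>x\<in>family. (\<integral>\<^sup>+\<omega>. ennreal (dev (fst x) (snd x) n \<omega> ^ (2 * m)) \<partial>M))"
        by (intro nn_integral_sum meas)
      finally show ?thesis .
    qed
    also have "\<dots> \<le> ennreal c * (\<Sum>x\<in>family. ennreal (C x / real n ^ m))"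
      using C(2) n by (intro mult_left_mono sum_mono) auto
    also have "\<dots> = ennreal c * ennreal (\<Sum>x\<in>family. C x / real n ^ m)"
      using C(1) by (subst sum_ennreal) auto
    also have "\<dots> = ennreal (c * (\<Sum>x\<in>family. C x / real n ^ m))"
      using C(1) by (subst ennreal_mult) (auto simp: c_def intro!: sum_nonneg)
    also have "c * (\<Sum>x\<in>family. C x / real n ^ m) = c * (\<Sum>x\<in>family. C x) / real n ^ m"
      by (simp add: sum_divide_distrib[symmetric])
    finally show ?thesis .
  qed
  moreover have "0 \<le> c * (\<Sum>x\<in>family. C x)"
    using C(1) by (auto simp: c_def intro!: mult_nonneg_nonneg sum_nonneg)
  ultimately show ?thesis by blast
qed

text \<open>For a fixed value \<open>c\<close> the probability of an observed event at time \<open>c\<close> is 0, because events have an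
intensity with respect to Lebesgue measure; integrate over the independent other observation.\<close>
lemma AE_no_tie:
  assumes "i \<noteq> j"
  shows "AE \<omega> in M. \<not> (event (W i \<omega>) \<and> event (W j \<omega>) \<and> fst (W i \<omega>) = fst (W j \<omega>))"
proof -
  define n where "n = Suc (max i j)"
  interpret product_sigma_finite "\<lambda>_::nat. P"
    by unfold_locales
  let ?J = "{..<n} - {i}"
  have I: "insert i ?J = {..<n}" "finite ?J" "i \<notin> ?J" and ij: "i < n" "j < n" "j \<in> ?J"
    using assms by (auto simp: n_def)
  let ?f = "\<lambda>w. (of_bool (event (w i)) * (of_bool (event (w j)) * of_bool (fst (w i) = fst (w j)))) :: ennreal"
  have comp [measurable]: "(\<lambda>w. w i) \<in> measurable (Pi\<^sub>M {..<n} (\<lambda>_. P)) P" "(\<lambda>w. w j) \<in> measurable (Pi\<^sub>M {..<n} (\<lambda>_. P)) P"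
    using ij by (auto intro!: measurable_component_singleton)
  have [measurable]: "Measurable.pred (Pi\<^sub>M {..<n} (\<lambda>_. P)) (\<lambda>w. event (w i))" "Measurable.pred (Pi\<^sub>M {..<n} (\<lambda>_. P)) (\<lambda>w. event (w j))"
    "(\<lambda>w. fst (w i)) \<in> borel_measurable (Pi\<^sub>M {..<n} (\<lambda>_. P))" "(\<lambda>w. fst (w j)) \<in> borel_measurable (Pi\<^sub>M {..<n} (\<lambda>_. P))"
    using measurable_compose[OF comp(1) P_measurable(2)] measurable_compose[OF comp(2) P_measurable(2)]
      measurable_compose[OF comp(1) P_measurable(1)] measurable_compose[OF comp(2) P_measurable(1)] by simp_all
  have fm: "?f \<in> borel_measurable (Pi\<^sub>M {..<n} (\<lambda>_. P))"
    unfolding of_bool_def by measurable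
  have atom: "(\<integral>\<^sup>+y. of_bool (event y) * of_bool (fst y = c) \<partial>P) = 0" for c
  proof -
    have "(\<lambda>(u, z :: real ^ 'd). of_bool (u = c) :: ennreal) \<in> borel_measurable (borel \<Otimes>\<^sub>M borel)"
      unfolding of_bool_def by measurable
    then have "(\<integral>\<^sup>+y. of_bool (event y) * of_bool (fst y = c) \<partial>P)
        = (\<integral>\<^sup>+u. (\<integral>\<^sup>+w. ennreal (lam u * exp (\<beta> \<bullet> cov w)) * of_bool (u \<le> fst w) * of_bool (u = c) \<partial>P) \<partial>lborel)"
      using compensator[of "\<lambda>(u, z). of_bool (u = c)"] by simp
    also have "\<dots> = (\<integral>\<^sup>+u. 0 \<partial>(lborel :: real measure))"
    proof (rule nn_integral_cong_AE)
      have "AE u in lborel. u \<noteq> c"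
        by (rule AE_lborel_singleton)
      then show "AE u in lborel. (\<integral>\<^sup>+w. ennreal (lam u * exp (\<beta> \<bullet> cov w)) * of_bool (u \<le> fst w) * of_bool (u = c) \<partial>P) = 0"
        by eventually_elim simp
    qed
    finally show ?thesis by simp
  qed
  have "(\<integral>\<^sup>+\<omega>. ?f (\<lambda>i\<in>{..<n}. W i \<omega>) \<partial>M) = (\<integral>\<^sup>+w. ?f w \<partial>Pi\<^sub>M {..<n} (\<lambda>_. P))"
    by (rule nn_integral_sample[symmetric, OF _ fm]) (simp add: n_def)
  also have "\<dots> = (\<integral>\<^sup>+x. (\<integral>\<^sup>+y. ?f (x(i := y)) \<partial>P) \<partial>Pi\<^sub>M ?J (\<lambda>_. P))"
    using product_nn_integral_insert[OF I(2,3), of ?f] fm unfolding I(1) by simp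
  also have "\<dots> \<le> (\<integral>\<^sup>+x. (\<integral>\<^sup>+y. of_bool (event y) * of_bool (fst y = fst (x j)) \<partial>P) \<partial>Pi\<^sub>M ?J (\<lambda>_. P))"
    using assms by (intro nn_integral_mono) auto
  also have "\<dots> = 0"
    by (simp add: atom)
  finally have "(\<integral>\<^sup>+\<omega>. ?f (\<lambda>i\<in>{..<n}. W i \<omega>) \<partial>M) = 0"
    by simp
  moreover have "(\<lambda>\<omega>. ?f (\<lambda>i\<in>{..<n}. W i \<omega>)) \<in> borel_measurable M"
    by (rule measurable_compose[OF _ fm]) measurable
  ultimately have "AE \<omega> in M. ?f (\<lambda>i\<in>{..<n}. W i \<omega>) = 0"
    by (subst (asm) nn_integral_0_iff_AE)
  then show ?thesis
    using ij by (auto elim!: eventually_mono)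
qed

lemma AE_times: "AE \<omega> in M. 0 \<le> fst (W i \<omega>) \<and> fst (W i \<omega>) \<le> \<tau>"
proof -
  have "AE w in distr M P (W i). 0 \<le> fst w \<and> fst w \<le> \<tau>"
    using times by (simp only: distr)
  then show ?thesis
    by (rule AE_distrD[OF W_measurable])
qed

text \<open>The second and third condition hold almost surely.  They are part of the event because the
deterministic estimates need them for every sample point.\<close>
definition good :: "real \<Rightarrow> nat \<Rightarrow> 'a set" where
  "good \<eta> n = {\<omega> \<in> space M. total_dev n \<omega> \<le> \<eta>
     \<and> (\<forall>i\<in>{..<n}. 0 \<le> fst (W i \<omega>) \<and> fst (W i \<omega>) \<le> \<tau>)
     \<and> (\<forall>i\<in>{..<n}. \<forall>j\<in>{..<n}. i \<noteq> j \<longrightarrow> \<not> (event (W i \<omega>) \<and> event (W j \<omega>) \<and> fst (W i \<omega>) = fst (W j \<omega>)))}"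

lemma W_components [measurable]:
  "(\<lambda>\<omega>. fst (W i \<omega>)) \<in> borel_measurable M" "Measurable.pred M (\<lambda>\<omega>. event (W i \<omega>))"
  using measurable_compose[OF W_measurable P_measurable(1)] measurable_compose[OF W_measurable P_measurable(2)] by simp_all

lemma good_measurable [measurable]: "good \<eta> n \<in> sets M"
  unfolding good_def by measurable

lemma prob_good:
  assumes \<eta>: "0 < \<eta>"
  shows "(\<lambda>n. prob (good \<eta> n)) \<longlonglongrightarrow> 1"
proof -
  obtain C where C: "0 \<le> C" "\<And>n. n \<ge> 1 \<Longrightarrow> (\<integral>\<^sup>+\<omega>. ennreal (total_dev n \<omega> ^ (2 * 1)) \<partial>M) \<le> ennreal (C / real n ^ 1)"
    using total_dev_moment[of 1] by auto
  have lower: "1 - C / (n * \<eta>\<^sup>2) \<le> prob (good \<eta> n)" if n: "n \<ge> 1" for n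
  proof -
    let ?E = "{\<omega> \<in> space M. \<eta> < total_dev n \<omega>}"
    have "AE \<omega> in M. (\<forall>i\<in>{..<n}. 0 \<le> fst (W i \<omega>) \<and> fst (W i \<omega>) \<le> \<tau>)"
      by (intro AE_finite_allI AE_times) simp
    moreover have "AE \<omega> in M. (\<forall>i\<in>{..<n}. \<forall>j\<in>{..<n}. i \<noteq> j \<longrightarrow> \<not> (event (W i \<omega>) \<and> event (W j \<omega>) \<and> fst (W i \<omega>) = fst (W j \<omega>)))"
      using AE_no_tie by (intro AE_finite_allI) auto
    ultimately have ae: "AE \<omega> in M. \<omega> \<notin> good \<eta> n \<longleftrightarrow> \<omega> \<in> ?E"
      using AE_space by eventually_elim (auto simp: good_def)
    have "1 - prob (good \<eta> n) = prob (space M - good \<eta> n)"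
      by (simp add: prob_compl)
    also have "\<dots> = prob ?E"
      using ae by (intro finite_measure_eq_AE) (auto elim: eventually_mono)
    also have "\<dots> \<le> C / (n * \<eta>\<^sup>2)"
    proof -
      have "ennreal (\<eta>\<^sup>2) * emeasure M ?E = (\<integral>\<^sup>+\<omega>. ennreal (\<eta>\<^sup>2) * indicator ?E \<omega> \<partial>M)"
        by (subst nn_integral_cmult_indicator) auto
      also have "\<dots> \<le> (\<integral>\<^sup>+\<omega>. ennreal (total_dev n \<omega> ^ (2 * 1)) \<partial>M)"
        using \<eta> by (intro nn_integral_mono) (auto simp: indicator_def intro!: ennreal_leI power_mono)
      also have "\<dots> \<le> ennreal (C / real n ^ 1)"
        by (rule C(2)[OF n])
      finally have "ennreal (\<eta>\<^sup>2 * prob ?E) \<le> ennreal (C / n)"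
        by (simp add: emeasure_eq_measure ennreal_mult)
      then have "\<eta>\<^sup>2 * prob ?E \<le> C / n"
        using C(1) by (subst (asm) ennreal_le_iff) auto
      then show ?thesis
        using \<eta> n by (simp add: field_simps)
    qed
    finally show ?thesis by simp
  qed
  show ?thesis
  proof (rule tendsto_sandwich[of "\<lambda>n. 1 - C / (real n * \<eta>\<^sup>2)" _ _ "\<lambda>_. 1"])
    show "eventually (\<lambda>n. 1 - C / (real n * \<eta>\<^sup>2) \<le> prob (good \<eta> n)) sequentially"
      using lower by (auto simp: eventually_sequentially)
    have "(\<lambda>n. 1 - (C / \<eta>\<^sup>2) * (1 / real n)) \<longlonglongrightarrow> 1 - (C / \<eta>\<^sup>2) * 0"
      by (intro tendsto_intros lim_1_over_n)
    then show "(\<lambda>n. 1 - C / (real n * \<eta>\<^sup>2)) \<longlonglongrightarrow> 1"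
      by (simp add: mult.commute)
  qed (auto intro!: always_eventually)
qed

end

section \<open>The error of the Breslow estimator on the good event\<close>

lemma quotient_perturbation:
  fixes a b a0 b0 :: real
  assumes "\<bar>a - a0\<bar> \<le> D" "\<bar>b - b0\<bar> \<le> D" "\<phi> \<le> b" "0 < \<phi>" "0 < b0" "\<bar>a0 / b0\<bar> \<le> c" 
  shows "\<bar>a / b - a0 / b0\<bar> \<le> (1 + c) / \<phi> * D"
proof -
  have D: "0 \<le> D" using assms(1) by linarith
  have c: "0 \<le> c" using assms(6) by linarith
  have "a / b - a0 / b0 = ((a - a0) - (a0 / b0) * (b - b0)) / b"
    using assms by (simp add: field_simps)
  then have "\<bar>a / b - a0 / b0\<bar> = \<bar>(a - a0) - (a0 / b0) * (b - b0)\<bar> / b"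
    using assms by simp
  also have "\<dots> \<le> (D + c * D) / \<phi>"
  proof (rule frac_le)
    have "\<bar>(a0 / b0) * (b - b0)\<bar> \<le> c * D"
      unfolding abs_mult using assms c by (intro mult_mono) auto
    then show "\<bar>(a - a0) - (a0 / b0) * (b - b0)\<bar> \<le> D + c * D"
      using assms(1) by linarith
  qed (use assms D c in auto)
  finally show ?thesis
    by (simp add: field_simps)
qed

lemma product_perturbation:
  fixes a b a0 b0 :: real
  assumes "\<bar>a - a0\<bar> \<le> e" "\<bar>b - b0\<bar> \<le> e" "\<bar>a0\<bar> \<le> c" "\<bar>b0\<bar> \<le> c"
  shows "\<bar>a * b - a0 * b0\<bar> \<le> e * (2 * c + e)"
proof -
  have e: "0 \<le> e" using assms(1) by linarith
  have "a * b - a0 * b0 = (a - a0) * (b - b0) + (a - a0) * b0 + a0 * (b - b0)"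
    by (simp add: algebra_simps)
  moreover have "\<bar>(a - a0) * (b - b0)\<bar> \<le> e * e" "\<bar>(a - a0) * b0\<bar> \<le> e * c" "\<bar>a0 * (b - b0)\<bar> \<le> c * e"
    unfolding abs_mult using assms e by (intro mult_mono; simp)+
  ultimately have "\<bar>a * b - a0 * b0\<bar> \<le> e * e + e * c + c * e"
    by linarith
  then show ?thesis
    by (simp add: algebra_simps)
qed

lemma mult_le_of_le_divide: "x * D \<le> y" if "0 \<le> x" "0 \<le> D" "D \<le> y / (x + 1)" for x D y :: real
proof -
  have "x * D \<le> (x + 1) * D"
    using that by (intro mult_right_mono) auto
  also have "\<dots> \<le> y"
    using that by (simp add: field_simps)
  finally show ?thesis .
qed

lemma risk_mean_component:
  "risk_mean n t z \<beta> u $ k = (\<Sum>j<n. risk_weight t z \<beta> u j * z j $ k) / (\<Sum>j<n. risk_weight t z \<beta> u j)"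
  by (simp add: risk_mean_def)

text \<open>The weighted variance in direction \<open>d\<close> as a quadratic form in the entries of a weighted covariance
matrix; in this form uniformity in \<open>d\<close> follows from convergence of finitely many entries.\<close>
lemma risk_var_quadratic_form:
  assumes W: "0 < (\<Sum>j<n. risk_weight t z \<beta> u j)"
  shows "risk_var n t z \<beta> u d = (\<Sum>k\<in>UNIV. \<Sum>l\<in>UNIV. d $ k * d $ l *
    ((\<Sum>j<n. risk_weight t z \<beta> u j * (z j $ k * z j $ l)) / (\<Sum>j<n. risk_weight t z \<beta> u j)
      - risk_mean n t z \<beta> u $ k * risk_mean n t z \<beta> u $ l))"
proof -
  let ?w = "risk_weight t z \<beta> u"
  define W where "W = (\<Sum>j<n. ?w j)"
  define m where "m = risk_mean n t z \<beta> u"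
  have W0: "0 < W"
    using assms by (simp add: W_def)
  have m: "(\<Sum>j<n. ?w j * z j $ k) = W * m $ k" for k
    using W0 by (simp add: m_def risk_mean_component W_def)
  have cov: "(\<Sum>j<n. ?w j * ((z j $ k - m $ k) * (z j $ l - m $ l)))
      = (\<Sum>j<n. ?w j * (z j $ k * z j $ l)) - W * (m $ k * m $ l)" for k l
  proof -
    have "(\<Sum>j<n. ?w j * ((z j $ k - m $ k) * (z j $ l - m $ l)))
        = (\<Sum>j<n. ?w j * (z j $ k * z j $ l)) - m $ l * (\<Sum>j<n. ?w j * z j $ k)
          - m $ k * (\<Sum>j<n. ?w j * z j $ l) + m $ k * m $ l * W"
      by (simp add: W_def sum_distrib_left sum.distrib[symmetric] sum_subtractf[symmetric] algebra_simps)
    then show ?thesis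
      by (simp add: m)
  qed
  have sq: "(d \<bullet> (z j - m))\<^sup>2 = (\<Sum>k\<in>UNIV. \<Sum>l\<in>UNIV. d $ k * d $ l * ((z j $ k - m $ k) * (z j $ l - m $ l)))" for j
    by (simp add: inner_vec_def power2_eq_square sum_product mult_ac)
  have "(\<Sum>j<n. ?w j * (d \<bullet> (z j - m))\<^sup>2)
      = (\<Sum>k\<in>UNIV. \<Sum>l\<in>UNIV. d $ k * d $ l * (\<Sum>j<n. ?w j * ((z j $ k - m $ k) * (z j $ l - m $ l))))"
    unfolding sq sum_distrib_left
    by (subst sum.swap, rule sum.cong[OF refl], subst sum.swap, intro sum.cong refl) (simp add: mult_ac)
  also have "\<dots> / W = (\<Sum>k\<in>UNIV. \<Sum>l\<in>UNIV. d $ k * d $ l *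
    ((\<Sum>j<n. ?w j * (z j $ k * z j $ l)) / W - m $ k * m $ l))"
  proof -
    have "x * (S - W * y) / W = x * (S / W - y)" for x S y
      using W0 by (simp add: field_simps)
    then show ?thesis
      unfolding cov
      by (subst sum_divide_distrib, intro sum.cong[OF refl], subst sum_divide_distrib, intro sum.cong[OF refl])
  qed
  finally show ?thesis
    by (simp add: risk_var_def m_def W_def)
qed

context cox_sample
begin

abbreviation "obs_time \<omega> \<equiv> \<lambda>i. fst (W i \<omega>)"
abbreviation "obs_event \<omega> \<equiv> \<lambda>i. event (W i \<omega>)"
abbreviation "obs_cov \<omega> \<equiv> \<lambda>i. cov (W i \<omega>)"

abbreviation "sample_likelihood n \<omega> \<equiv> partial_likelihood n (obs_time \<omega>) (obs_event \<omega>) (obs_cov \<omega>)"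
abbreviation "sample_information n \<omega> \<equiv> observed_information n (obs_time \<omega>) (obs_event \<omega>) (obs_cov \<omega>) \<beta>"
abbreviation "sample_score n \<omega> \<equiv> score n (obs_time \<omega>) (obs_event \<omega>) (obs_cov \<omega>) \<beta>"
abbreviation "sample_breslow n \<omega> \<equiv> breslow n (obs_time \<omega>) (obs_event \<omega>) (obs_cov \<omega>)"
abbreviation "sample_risk_mean n \<omega> \<equiv> risk_mean n (obs_time \<omega>) (obs_cov \<omega>) \<beta>"
abbreviation "sample_Phi n \<omega> \<equiv> Phi_n n (obs_time \<omega>) (obs_cov \<omega>)"
abbreviation "sample_weight \<omega> \<equiv> risk_weight (obs_time \<omega>) (obs_cov \<omega>) \<beta>"
abbreviation "cum_lam s \<equiv> (\<integral>u. lam u * indicator {..s} u \<partial>lborel)"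

lemma emp_w:
  assumes "n \<ge> 1"
  shows "emp fst w0 n u \<omega> = sample_Phi n \<omega> u \<beta>"
    and "(\<Sum>j<n. sample_weight \<omega> u j) = n * emp fst w0 n u \<omega>"
    and "(\<Sum>j<n. sample_weight \<omega> u j * obs_cov \<omega> j $ k) = n * emp fst (w1 k) n u \<omega>"
    and "(\<Sum>j<n. sample_weight \<omega> u j * (obs_cov \<omega> j $ k * obs_cov \<omega> j $ l)) = n * emp fst (w2 k l) n u \<omega>"
  using assms by (simp_all add: emp_def Phi_n_def risk_weight_def w0_def w1_def w2_def mult.assoc)

lemma family_members:
  "(fst, w0) \<in> family" "(key0, env) \<in> family" "((\<lambda>w. - fst w), hazard_term) \<in> family"
  "(fst, w1 k) \<in> family" "(fst, w2 k l) \<in> family" "(key0, score_term k) \<in> family" "(key0, info_term k l) \<in> family"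
proof -
  show "(fst, w0) \<in> family" "(key0, env) \<in> family" "((\<lambda>w. - fst w), hazard_term) \<in> family" "(fst, w1 k) \<in> family"
    unfolding family_def by blast+
  show "(fst, w2 k l) \<in> family"
    unfolding family_def by (rule UnI1, rule UnI1, rule UnI2, rule range_eqI[of _ _ "(k, l)"]) simp
  show "(key0, score_term k) \<in> family"
    using rangeI[of "\<lambda>k. (key0, score_term k)" k] unfolding family_def by (simp only: Un_iff simp_thms)
  show "(key0, info_term k l) \<in> family"
    using rangeI[of "\<lambda>(k, l). (key0, info_term k l)" "(k, l)"] unfolding family_def by (simp only: Un_iff prod.case simp_thms)
qed

context
  fixes n \<omega> D c1 \<phi>
  assumes n: "n \<ge> 1" and D: "D = total_dev n \<omega>" and \<phi>: "\<phi> = R0 \<tau> / 2" and small: "D \<le> \<phi>"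
    and range: "\<And>i. i < n \<Longrightarrow> obs_time \<omega> i \<le> \<tau>" and c1: "c1 = (1 + mean_bound) / \<phi>"
begin

lemma phi_pos: "0 < \<phi>"
  using R0_pos by (simp add: \<phi>)

lemma Phi_n_close: "\<bar>sample_Phi n \<omega> u \<beta> - R0 u\<bar> \<le> D"
  using family_emp[OF family_members(1), of n u \<omega>] unfolding emp_w(1)[OF n] by (simp add: D R0_def)

lemma Phi_n_ge: "u \<le> \<tau> \<Longrightarrow> \<phi> \<le> sample_Phi n \<omega> u \<beta>"
  using Phi_n_close[of u] R0_ge[of u] small by (simp add: \<phi>)

lemma emp_quotient_close:
  assumes "u \<le> \<tau>" "(fst, h) \<in> family" "\<bar>tail fst h u\<bar> \<le> EH"
  shows "\<bar>emp fst h n u \<omega> / emp fst w0 n u \<omega> - tail fst h u / R0 u\<bar> \<le> c1 * D"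
  unfolding c1
proof (rule quotient_perturbation)
  show "\<bar>emp fst h n u \<omega> - tail fst h u\<bar> \<le> D"
    using family_emp[OF assms(2)] by (simp add: D)
  show "\<bar>emp fst w0 n u \<omega> - R0 u\<bar> \<le> D" "\<phi> \<le> emp fst w0 n u \<omega>"
    using Phi_n_close[of u] Phi_n_ge[OF assms(1)] by (simp_all add: emp_w(1)[OF n])
  show "\<bar>tail fst h u / R0 u\<bar> \<le> mean_bound"
    by (rule quotient_le[OF assms(1,3)])
qed (use phi_pos R0_pos'[OF assms(1)] in auto)

lemma risk_mean_close:
  assumes u: "u \<le> \<tau>"
  shows "\<bar>sample_risk_mean n \<omega> u $ k - risk_mean_lim k u\<bar> \<le> c1 * D"
proof -
  have "sample_risk_mean n \<omega> u $ k = emp fst (w1 k) n u \<omega> / emp fst w0 n u \<omega>"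
    unfolding risk_mean_component emp_w(2,3)[OF n] using n by simp
  then show ?thesis
    using emp_quotient_close[OF u family_members(4) R_le(2)[unfolded R1_def]] u
    by (simp add: risk_mean_lim_def R1_def)
qed

lemma risk_cov_close:
  assumes u: "u \<le> \<tau>" and D1: "D \<le> 1"
  shows "\<bar>emp fst (w2 k l) n u \<omega> / emp fst w0 n u \<omega>
      - sample_risk_mean n \<omega> u $ k * sample_risk_mean n \<omega> u $ l - risk_cov_lim k l u\<bar>
    \<le> c1 * (1 + 2 * mean_bound + c1) * D"
proof -
  have c10: "0 \<le> c1"
    using mean_bound_nonneg phi_pos by (simp add: c1)
  have D0: "0 \<le> D"
    by (simp add: D total_dev_nonneg)
  have "\<bar>emp fst (w2 k l) n u \<omega> / emp fst w0 n u \<omega> - R2 k l u / R0 u\<bar> \<le> c1 * D"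
    using emp_quotient_close[OF u family_members(5) R_le(3)[unfolded R2_def]] by (simp add: R2_def)
  moreover have "\<bar>sample_risk_mean n \<omega> u $ k * sample_risk_mean n \<omega> u $ l
      - risk_mean_lim k u * risk_mean_lim l u\<bar> \<le> c1 * D * (2 * mean_bound + c1 * D)"
    by (intro product_perturbation risk_mean_close u risk_mean_lim_le)
  moreover have "c1 * D * (2 * mean_bound + c1 * D) \<le> c1 * D * (2 * mean_bound + c1)"
    using c10 D0 D1 mult_left_mono[OF D1 c10] by (intro mult_left_mono add_left_mono) simp_all
  ultimately have "\<bar>emp fst (w2 k l) n u \<omega> / emp fst w0 n u \<omega>
      - sample_risk_mean n \<omega> u $ k * sample_risk_mean n \<omega> u $ l - risk_cov_lim k l u\<bar>
    \<le> c1 * D + c1 * D * (2 * mean_bound + c1)"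
    using u unfolding risk_cov_lim_def by (simp only: if_True)
  then show ?thesis
    by (simp add: algebra_simps)
qed

lemma mean_of_bool_le:
  fixes x :: "nat \<Rightarrow> real"
  assumes "\<And>i. i < n \<Longrightarrow> \<bar>x i\<bar> \<le> e" "0 \<le> e"
  shows "\<bar>(\<Sum>i<n. of_bool (q i) * x i) / n\<bar> \<le> e"
proof -
  have "\<bar>\<Sum>i<n. of_bool (q i) * x i\<bar> \<le> (\<Sum>i<n. e)"
    using assms by (intro order_trans[OF sum_abs] sum_mono) auto
  then show ?thesis
    using n by (simp add: field_simps)
qed

text \<open>The limiting means make the summands of the score independent and centred; replacing the risk set
means by them costs one more multiple of the total deviation.\<close>
lemma score_close: "norm (sample_score n \<omega>) \<le> real CARD('d) * (1 + c1) * D"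
proof -
  have D0: "0 \<le> D"
    by (simp add: D total_dev_nonneg)
  have c10: "0 \<le> c1"
    using mean_bound_nonneg phi_pos by (simp add: c1)
  have comp: "\<bar>sample_score n \<omega> $ k\<bar> \<le> (1 + c1) * D" for k
  proof -
    have "sample_score n \<omega> $ k
        = emp key0 (score_term k) n 0 \<omega>
          - (\<Sum>i<n. of_bool (obs_event \<omega> i) * (sample_risk_mean n \<omega> (obs_time \<omega> i) $ k - risk_mean_lim k (obs_time \<omega> i))) / n"
      by (simp add: score_def emp_def score_term_def diff_divide_distrib[symmetric] sum_subtractf[symmetric] right_diff_distrib[symmetric])
    moreover have "\<bar>emp key0 (score_term k) n 0 \<omega>\<bar> \<le> D"
      using family_emp[OF family_members(6), of k n 0 \<omega>] score_term_mean[of k] by (simp add: D tail_def)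
    moreover have "\<bar>(\<Sum>i<n. of_bool (obs_event \<omega> i) * (sample_risk_mean n \<omega> (obs_time \<omega> i) $ k - risk_mean_lim k (obs_time \<omega> i))) / n\<bar> \<le> c1 * D"
      using D0 c10 by (intro mean_of_bool_le risk_mean_close range) auto
    ultimately show ?thesis
      unfolding distrib_right by linarith
  qed
  have "norm (sample_score n \<omega>) \<le> (\<Sum>k\<in>UNIV. \<bar>sample_score n \<omega> $ k\<bar>)"
    by (rule norm_le_l1_cart)
  also have "\<dots> \<le> (\<Sum>k\<in>(UNIV :: 'd set). (1 + c1) * D)"
    by (intro sum_mono comp)
  finally show ?thesis by simp
qed

lemma information_close:
  assumes D1: "D \<le> 1"
  shows "\<bar>sample_information n \<omega> d - (\<Sum>k\<in>UNIV. \<Sum>l\<in>UNIV. d $ k * d $ l * info_lim k l)\<bar>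
    \<le> (real CARD('d))\<^sup>2 * (c1 * (1 + 2 * mean_bound + c1) + 1) * D * (norm d)\<^sup>2"
proof -
  let ?c2 = "c1 * (1 + 2 * mean_bound + c1)"
  have D0: "0 \<le> D"
    by (simp add: D total_dev_nonneg)
  have c10: "0 \<le> c1"
    using mean_bound_nonneg phi_pos by (simp add: c1)
  define V where "V u k l = emp fst (w2 k l) n u \<omega> / emp fst w0 n u \<omega>
      - sample_risk_mean n \<omega> u $ k * sample_risk_mean n \<omega> u $ l" for u k l
  define J where "J k l = (\<Sum>i<n. of_bool (obs_event \<omega> i) * V (obs_time \<omega> i) k l) / n" for k l
  have var: "risk_var n (obs_time \<omega>) (obs_cov \<omega>) \<beta> (obs_time \<omega> i) d = (\<Sum>k\<in>UNIV. \<Sum>l\<in>UNIV. d $ k * d $ l * V (obs_time \<omega> i) k l)" if i: "i < n" for i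
  proof -
    have "0 < (\<Sum>j<n. sample_weight \<omega> (obs_time \<omega> i) j)"
      using Phi_n_pos[of i n "obs_time \<omega>" "obs_cov \<omega>" \<beta>] i n by (simp add: Phi_n_risk_weight zero_less_divide_iff)
    then show ?thesis
      using n by (subst risk_var_quadratic_form) (simp_all add: emp_w[OF n] V_def)
  qed
  have "sample_information n \<omega> d
      = (1 / n) * (\<Sum>i<n. of_bool (obs_event \<omega> i) * (\<Sum>k\<in>UNIV. \<Sum>l\<in>UNIV. d $ k * d $ l * V (obs_time \<omega> i) k l))"
    unfolding observed_information_def by (intro arg_cong2[where f = "(*)"] refl sum.cong) (simp add: var)
  also have "\<dots> = (\<Sum>k\<in>UNIV. \<Sum>l\<in>UNIV. d $ k * d $ l * J k l)"
    unfolding J_def sum_distrib_left sum_divide_distrib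
    by (subst sum.swap, rule sum.cong[OF refl], subst sum.swap, intro sum.cong refl) (simp add: mult_ac)
  finally have "sample_information n \<omega> d - (\<Sum>k\<in>UNIV. \<Sum>l\<in>UNIV. d $ k * d $ l * info_lim k l)
      = (\<Sum>k\<in>UNIV. \<Sum>l\<in>UNIV. d $ k * d $ l * (J k l - info_lim k l))"
    by (simp add: sum_subtractf right_diff_distrib)
  also have "\<bar>\<dots>\<bar> \<le> (\<Sum>k\<in>(UNIV::'d set). \<Sum>l\<in>(UNIV::'d set). (norm d)\<^sup>2 * ((?c2 + 1) * D))"
  proof (intro order_trans[OF sum_abs] sum_mono)
    fix k l
    have "J k l - emp key0 (info_term k l) n 0 \<omega> = (\<Sum>i<n. of_bool (obs_event \<omega> i) * (V (obs_time \<omega> i) k l - risk_cov_lim k l (obs_time \<omega> i))) / n"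
      by (simp add: J_def emp_def info_term_def diff_divide_distrib[symmetric] sum_subtractf[symmetric] right_diff_distrib[symmetric])
    also have "\<bar>\<dots>\<bar> \<le> ?c2 * D"
      unfolding V_def using D0 c10 mean_bound_nonneg by (intro mean_of_bool_le risk_cov_close range D1) auto
    finally have "\<bar>J k l - emp key0 (info_term k l) n 0 \<omega>\<bar> \<le> ?c2 * D" .
    moreover have "\<bar>emp key0 (info_term k l) n 0 \<omega> - info_lim k l\<bar> \<le> D"
      using family_emp[OF family_members(7), of k l n 0 \<omega>] info_term_mean[of k l] by (simp add: D tail_def)
    ultimately have "\<bar>J k l - info_lim k l\<bar> \<le> (?c2 + 1) * D"
      unfolding distrib_right by linarith
    moreover have "\<bar>d $ k * d $ l\<bar> \<le> (norm d)\<^sup>2"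
      unfolding abs_mult power2_eq_square by (intro mult_mono component_le_norm_cart) auto
    ultimately show "\<bar>d $ k * d $ l * (J k l - info_lim k l)\<bar> \<le> (norm d)\<^sup>2 * ((?c2 + 1) * D)"
      unfolding abs_mult[of "d $ k * d $ l"] by (intro mult_mono) auto
  qed
  also have "\<dots> = (real CARD('d))\<^sup>2 * (?c2 + 1) * D * (norm d)\<^sup>2"
    by (simp add: power2_eq_square)
  finally show ?thesis .
qed

lemma envelope_close: "(\<Sum>j<n. exp (\<beta> \<bullet> obs_cov \<omega> j + \<rho> * norm (obs_cov \<omega> j)) * (1 + norm (obs_cov \<omega> j)) ^ 3) / n \<le> EH + D"
  using family_emp[OF family_members(2), of n 0 \<omega>] by (simp add: D emp_def env_def tail_def EH_def)

lemma hazard_close: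
  "\<bar>(\<Sum>i<n. of_bool (obs_event \<omega> i \<and> obs_time \<omega> i \<le> s) / R0 (obs_time \<omega> i)) / n - cum_lam s\<bar> \<le> D"
proof -
  have "emp (\<lambda>w. - fst w) hazard_term n (- s) \<omega> = (\<Sum>i<n. of_bool (obs_event \<omega> i \<and> obs_time \<omega> i \<le> s) / R0 (obs_time \<omega> i)) / n"
    unfolding emp_def using range
    by (intro arg_cong2[where f = "(/)"] sum.cong refl) (auto simp: hazard_term_def inverse_R0_def)
  then show ?thesis
    using family_emp[OF family_members(3), of n "- s" \<omega>] by (simp add: D hazard_term_tail)
qed

end

text \<open>The constants are chosen in the order \<open>\<phi>\<close>, \<open>H\<close>, \<open>B\<close> (bounds for the risk set averages), \<open>r\<close> (radius of the
quadratic bound), \<open>c1\<close> to \<open>c4\<close> (errors of the means, the covariances, the score and the estimator, in units of the total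
deviation), and finally \<open>\<eta>\<close>, small enough for the good event to satisfy the conditions of the likelihood
analysis.\<close>
lemma breslow_error_bound:
  assumes l: "0 < l" "\<And>d. 2 * l * (norm d)\<^sup>2 \<le> (\<Sum>k\<in>UNIV. \<Sum>j\<in>UNIV. d $ k * d $ j * info_lim k j)"
  shows "\<exists>\<eta>>0. \<exists>K\<ge>0. \<forall>n\<ge>1. \<forall>\<omega>\<in>good \<eta> n. \<forall>b s.
    ((\<exists>\<beta>'. is_maximizer (sample_likelihood n \<omega>) \<beta>')
      \<longrightarrow> is_maximizer (sample_likelihood n \<omega>) b) \<longrightarrow>
    \<bar>sample_breslow n \<omega> b s - cum_lam s\<bar> \<le> K * total_dev n \<omega>"
proof -
  define \<phi> where "\<phi> = R0 \<tau> / 2"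
  define H where "H = EH + 1"
  define B where "B = (1 + H / \<phi>) ^ 3 * (H / \<phi>)"
  define N where "N = real CARD('d)"
  define c1 where "c1 = (1 + mean_bound) / \<phi>"
  define c2 where "c2 = c1 * (1 + 2 * mean_bound + c1)"
  define c3 where "c3 = N * (1 + c1)"
  define c4 where "c4 = 4 * c3 / l"
  \<comment> \<open>the three bounds give \<open>r \<le> 1\<close>, \<open>B * r\<^sup>2 \<le> 1 / 2\<close> and \<open>(B\<^sup>2 + B) * r \<le> l / 4\<close>\<close>
  define r where "r = min 1 (min (1 / (2 * (B + 1))) (l / (4 * (B\<^sup>2 + B + 1))))"
  have \<phi>: "0 < \<phi>"
    using R0_pos by (simp add: \<phi>_def)
  have H: "0 \<le> H"
    using EH_nonneg by (simp add: H_def)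
  have B: "0 \<le> B"
    using H \<phi> by (simp add: B_def)
  have c: "0 \<le> c1" "0 \<le> c2" "0 \<le> c3" "0 \<le> c4"
    using mean_bound_nonneg \<phi> l(1) by (simp_all add: c1_def c2_def c3_def c4_def N_def)
  have BB: "0 < B\<^sup>2 + B + 1"
    using B by (intro add_nonneg_pos add_nonneg_nonneg) auto
  have r: "0 < r" "r \<le> 1" "r \<le> 1 / (2 * (B + 1))" "r \<le> l / (4 * (B\<^sup>2 + B + 1))"
    using B BB l(1) by (auto simp: r_def)
  have Br: "B * r\<^sup>2 \<le> 1 / 2"
  proof -
    have "r * r \<le> r * 1"
      using r by (intro mult_left_mono) auto
    then have "B * r\<^sup>2 \<le> B * r"
      using B by (simp add: power2_eq_square mult_left_mono)
    also have "\<dots> \<le> (B + 1) * r"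
      using r by (intro mult_right_mono) auto
    also have "\<dots> \<le> 1 / 2"
      using r(3) B by (simp add: field_simps)
    finally show ?thesis .
  qed
  have Br2: "(B\<^sup>2 + B) * r \<le> l / 4"
  proof -
    have "(B\<^sup>2 + B) * r \<le> (B\<^sup>2 + B + 1) * r"
      using r by (intro mult_right_mono) auto
    also have "\<dots> \<le> (B\<^sup>2 + B + 1) * (l / (4 * (B\<^sup>2 + B + 1)))"
      using r(4) BB by (intro mult_left_mono) auto
    also have "\<dots> = l / 4"
    proof -
      have "x * (l / (4 * x)) = l / 4" if "0 < x" for x
        using that by simp
      then show ?thesis
        using BB .
    qed
    finally show ?thesis .
  qed
  \<comment> \<open>one entry for each smallness condition on the total deviation below\<close>
  define \<eta> where "\<eta> = Min {1, \<phi>, l / (N\<^sup>2 * (c2 + 1) + 1), (l * r / 8) / (c3 + 1), \<rho> / (c4 + 1), (\<phi> / 2) / (H * c4 + 1)}"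
  have \<eta>: "0 < \<eta>"
    unfolding \<eta>_def using \<phi> l(1) r(1) c H \<rho> by (auto simp: N_def intro!: divide_pos_pos mult_pos_pos add_nonneg_pos)
  have \<eta>_le: "\<eta> \<le> 1" "\<eta> \<le> \<phi>" "\<eta> \<le> l / (N\<^sup>2 * (c2 + 1) + 1)" "\<eta> \<le> (l * r / 8) / (c3 + 1)" "\<eta> \<le> \<rho> / (c4 + 1)" "\<eta> \<le> (\<phi> / 2) / (H * c4 + 1)"
    unfolding \<eta>_def by (auto intro!: Min_le)
  define K where "K = 2 / \<phi>\<^sup>2 * (H * c4 + 1) + 1"
  have K: "0 \<le> K"
    using \<phi> H c by (simp add: K_def)
  have "\<bar>sample_breslow n \<omega> b s - cum_lam s\<bar> \<le> K * total_dev n \<omega>"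
    if n: "n \<ge> 1" and good: "\<omega> \<in> good \<eta> n"
      and b: "(\<exists>\<beta>'. is_maximizer (sample_likelihood n \<omega>) \<beta>')
        \<longrightarrow> is_maximizer (sample_likelihood n \<omega>) b" for n \<omega> b s
  proof -
    define D where "D = total_dev n \<omega>"
    have D: "0 \<le> D" "D \<le> \<eta>"
      using total_dev_nonneg good by (simp_all add: D_def good_def)
    have range: "obs_time \<omega> i \<le> \<tau>" if "i < n" for i
      using good that by (simp add: good_def)
    have inj: "inj_on (obs_time \<omega>) {i. i < n \<and> obs_event \<omega> i}"
      using good by (auto simp: good_def intro!: inj_onI)
    have D\<phi>: "D \<le> \<phi>" and D1: "D \<le> 1"
      using D \<eta>_le by linarith+
    have D_small: "N\<^sup>2 * (c2 + 1) * D \<le> l" "c3 * D \<le> l * r / 8" "c4 * D \<le> \<rho>" "H * c4 * D \<le> \<phi> / 2"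
    proof -
      have "0 \<le> N\<^sup>2 * (c2 + 1)" "0 \<le> H * c4"
        using c H by (simp_all add: N_def)
      then show "N\<^sup>2 * (c2 + 1) * D \<le> l" "c3 * D \<le> l * r / 8" "c4 * D \<le> \<rho>" "H * c4 * D \<le> \<phi> / 2"
        using mult_le_of_le_divide[OF _ D(1) order_trans[OF D(2) \<eta>_le(3)]]
          mult_le_of_le_divide[OF c(3) D(1) order_trans[OF D(2) \<eta>_le(4)]]
          mult_le_of_le_divide[OF c(4) D(1) order_trans[OF D(2) \<eta>_le(5)]]
          mult_le_of_le_divide[OF _ D(1) order_trans[OF D(2) \<eta>_le(6)]] by blast+
    qed
    note ctx = n D_def \<phi>_def D\<phi> range c1_def
    let ?U = "sample_score n \<omega>"
    have U: "norm ?U \<le> c3 * D"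
      using score_close[OF ctx] by (simp add: c3_def N_def)
    have info: "l * (norm d)\<^sup>2 \<le> sample_information n \<omega> d" for d
    proof -
      have "\<bar>sample_information n \<omega> d - (\<Sum>k\<in>UNIV. \<Sum>l\<in>UNIV. d $ k * d $ l * info_lim k l)\<bar>
          \<le> N\<^sup>2 * (c2 + 1) * D * (norm d)\<^sup>2"
        using information_close[OF ctx D1, of d] by (simp add: N_def c2_def)
      moreover have "N\<^sup>2 * (c2 + 1) * D * (norm d)\<^sup>2 \<le> l * (norm d)\<^sup>2"
        using D_small(1) by (intro mult_right_mono) auto
      ultimately show ?thesis
        using l(2)[of d] by linarith
    qed
    have env: "(\<Sum>j<n. exp (\<beta> \<bullet> obs_cov \<omega> j + \<rho> * norm (obs_cov \<omega> j)) * (1 + norm (obs_cov \<omega> j)) ^ 3) / n \<le> H"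
      using envelope_close[OF ctx] D1 by (simp add: H_def)
    have env0: "(\<Sum>j<n. exp (\<beta> \<bullet> obs_cov \<omega> j) * (1 + norm (obs_cov \<omega> j)) ^ 3) / n \<le> H"
    proof (rule order_trans[OF _ env])
      show "(\<Sum>j<n. exp (\<beta> \<bullet> obs_cov \<omega> j) * (1 + norm (obs_cov \<omega> j)) ^ 3) / n
          \<le> (\<Sum>j<n. exp (\<beta> \<bullet> obs_cov \<omega> j + \<rho> * norm (obs_cov \<omega> j)) * (1 + norm (obs_cov \<omega> j)) ^ 3) / n"
        using \<rho> by (intro divide_right_mono sum_mono mult_right_mono) auto
    qed
    have Phi_ge: "\<phi> \<le> sample_Phi n \<omega> (obs_time \<omega> i) \<beta>" if "i < n" for i
      using Phi_n_ge[OF ctx range[OF that]] .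
    have "norm (b - \<beta>) \<le> 4 * norm ?U / l"
    proof (rule estimator_near_truth[OF n inj \<phi> _ env0 B_def l(1) info r(1,2) Br Br2])
      have "0 < l * r"
        using l(1) r(1) by simp
      then show "norm ?U < l * r / 4"
        using U D_small(2) by linarith
    qed (use Phi_ge b in auto)
    also have "\<dots> \<le> 4 * (c3 * D) / l"
      using U l(1) by (intro divide_right_mono mult_left_mono) auto
    finally have bD: "norm (b - \<beta>) \<le> c4 * D"
      by (simp add: c4_def)
    have HbD: "H * norm (b - \<beta>) \<le> H * c4 * D"
      using mult_left_mono[OF bD H] by (simp add: mult.assoc)
    have "\<bar>sample_breslow n \<omega> b s - (\<Sum>i<n. of_bool (obs_event \<omega> i \<and> obs_time \<omega> i \<le> s) / R0 (obs_time \<omega> i)) / n\<bar>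
        \<le> 2 / \<phi>\<^sup>2 * (H * norm (b - \<beta>) + D)"
    proof (rule breslow_perturbation[OF n env _ _ \<phi> _ _ _ D(1)])
      show "norm (b - \<beta>) \<le> \<rho>" "H * norm (b - \<beta>) \<le> \<phi> / 2"
        using bD HbD D_small by linarith+
      show "\<phi> \<le> R0 (obs_time \<omega> i)" if "i < n" for i
        using R0_ge[OF range[OF that]] R0_pos by (simp add: \<phi>_def)
      show "\<bar>sample_Phi n \<omega> (obs_time \<omega> i) \<beta> - R0 (obs_time \<omega> i)\<bar> \<le> D" for i
        by (rule Phi_n_close[OF ctx])
    qed (use Phi_ge in auto)
    also have "\<dots> \<le> 2 / \<phi>\<^sup>2 * (H * c4 * D + D)"
      using HbD by (intro mult_left_mono) auto
    finally have "\<bar>sample_breslow n \<omega> b s - cum_lam s\<bar>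
        \<le> 2 / \<phi>\<^sup>2 * (H * c4 * D + D) + D"
      using hazard_close[OF ctx, of s] by linarith
    also have "\<dots> = K * D"
      by (simp add: K_def algebra_simps)
    finally show ?thesis
      by (simp add: D_def)
  qed
  then show ?thesis
    using \<eta> K by blast
qed

text \<open>The \<open>p\<close>-th power is bounded by 1 plus an even power of an integer order, for which the moments of the
total deviation are known.\<close>
lemma breslow_moment_bound:
  fixes b :: "nat \<Rightarrow> 'a \<Rightarrow> real ^ 'd" and p :: real
  assumes l: "0 < l" "\<And>d. 2 * l * (norm d)\<^sup>2 \<le> (\<Sum>k\<in>UNIV. \<Sum>j\<in>UNIV. d $ k * d $ j * info_lim k j)"
    and b: "\<And>n \<omega>. n \<ge> 1 \<Longrightarrow> \<omega> \<in> space M \<Longrightarrow>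
      (\<exists>\<beta>'. is_maximizer (sample_likelihood n \<omega>) \<beta>')
        \<longrightarrow> is_maximizer (sample_likelihood n \<omega>) (b n \<omega>)"
    and p: "p \<ge> 1"
  shows "\<exists>A C. (\<forall>n. A n \<in> sets M) \<and> (\<lambda>n. prob (A n)) \<longlonglongrightarrow> 1 \<and> C > 0 \<and>
    (\<forall>n\<ge>1. (\<integral>\<^sup>+\<omega>. indicator (A n) \<omega> * ennreal (real n powr (p / 2)) *
      (SUP s. ennreal (\<bar>sample_breslow n \<omega> (b n \<omega>) s - cum_lam s\<bar> powr p)) \<partial>M)
      \<le> ennreal C)"
proof -
  obtain \<eta> K where \<eta>: "0 < \<eta>" and K: "0 \<le> K" and err: "\<And>n \<omega> c s. n \<ge> 1 \<Longrightarrow> \<omega> \<in> good \<eta> n \<Longrightarrow>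
    ((\<exists>\<beta>'. is_maximizer (sample_likelihood n \<omega>) \<beta>')
      \<longrightarrow> is_maximizer (sample_likelihood n \<omega>) c) \<Longrightarrow>
    \<bar>sample_breslow n \<omega> c s - cum_lam s\<bar> \<le> K * total_dev n \<omega>"
    using breslow_error_bound[OF l] by blast
  define m where "m = nat \<lceil>p\<rceil>"
  have m: "m \<ge> 1" "p \<le> real (2 * m)"
    using p by (simp_all add: m_def) linarith+
  obtain C where C: "0 \<le> C" "\<And>n. n \<ge> 1 \<Longrightarrow> (\<integral>\<^sup>+\<omega>. ennreal (total_dev n \<omega> ^ (2 * m)) \<partial>M) \<le> ennreal (C / real n ^ m)"
    using total_dev_moment[OF m(1)] by blast
  define C' where "C' = K powr p * (1 + C) + 1"
  have powr_le: "x powr p \<le> 1 + x ^ (2 * m)" if x: "0 \<le> x" for x :: real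
  proof (cases "x \<le> 1")
    case True
    have "x powr p \<le> 1 powr p"
      using True x p by (intro powr_mono2) auto
    moreover have "0 \<le> x ^ (2 * m)"
      using x by (rule zero_le_power)
    ultimately show ?thesis
      unfolding powr_one_eq_one by linarith
  next
    case False
    then have "x powr p \<le> x powr real (2 * m)"
      using m by (intro powr_mono) auto
    also have "\<dots> = x ^ (2 * m)"
      using False by (intro powr_realpow) auto
    finally show ?thesis by simp
  qed
  have bound: "(\<integral>\<^sup>+\<omega>. indicator (good \<eta> n) \<omega> * ennreal (real n powr (p / 2)) *
      (SUP s. ennreal (\<bar>sample_breslow n \<omega> (b n \<omega>) s - cum_lam s\<bar> powr p)) \<partial>M)
      \<le> ennreal C'" if n: "n \<ge> 1" for n
  proof -
    have "(\<integral>\<^sup>+\<omega>. indicator (good \<eta> n) \<omega> * ennreal (real n powr (p / 2)) *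
      (SUP s. ennreal (\<bar>sample_breslow n \<omega> (b n \<omega>) s - cum_lam s\<bar> powr p)) \<partial>M)
      \<le> (\<integral>\<^sup>+\<omega>. ennreal (K powr p) * (1 + ennreal (real n ^ m) * ennreal (total_dev n \<omega> ^ (2 * m))) \<partial>M)"
    proof (rule nn_integral_mono)
      fix \<omega> assume \<omega>: "\<omega> \<in> space M"
      show "indicator (good \<eta> n) \<omega> * ennreal (real n powr (p / 2)) *
      (SUP s. ennreal (\<bar>sample_breslow n \<omega> (b n \<omega>) s - cum_lam s\<bar> powr p))
        \<le> ennreal (K powr p) * (1 + ennreal (real n ^ m) * ennreal (total_dev n \<omega> ^ (2 * m)))"
      proof (cases "\<omega> \<in> good \<eta> n")
        case True
        define D where "D = total_dev n \<omega>"
        have D: "0 \<le> D"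
          by (simp add: D_def total_dev_nonneg)
        have "(SUP s. ennreal (\<bar>sample_breslow n \<omega> (b n \<omega>) s - cum_lam s\<bar> powr p))
            \<le> ennreal ((K * D) powr p)"
          unfolding D_def using err[OF n True b[OF n \<omega>]] p
          by (intro SUP_least ennreal_leI powr_mono2) auto
        then have "indicator (good \<eta> n) \<omega> * ennreal (real n powr (p / 2)) *
      (SUP s. ennreal (\<bar>sample_breslow n \<omega> (b n \<omega>) s - cum_lam s\<bar> powr p))
          \<le> ennreal (real n powr (p / 2)) * ennreal ((K * D) powr p)"
          using True by (simp add: mult_left_mono)
        also have "\<dots> = ennreal (K powr p * ((sqrt n * D) powr p))"
          using K D by (simp add: ennreal_mult[symmetric] powr_mult powr_powr powr_half_sqrt[symmetric] mult_ac)
        also have "\<dots> \<le> ennreal (K powr p * (1 + (sqrt n * D) ^ (2 * m)))"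
          using D by (intro ennreal_leI mult_left_mono powr_le) auto
        also have "(sqrt n * D) ^ (2 * m) = real n ^ m * D ^ (2 * m)"
          by (simp add: power_mult_distrib power_mult)
        also have "ennreal (K powr p * (1 + real n ^ m * D ^ (2 * m))) = ennreal (K powr p) * (1 + ennreal (real n ^ m) * ennreal (D ^ (2 * m)))"
          using D by (simp add: ennreal_mult)
        finally show ?thesis
          by (simp add: D_def)
      qed simp
    qed
    also have "\<dots> = ennreal (K powr p) * (1 + ennreal (real n ^ m) * (\<integral>\<^sup>+\<omega>. ennreal (total_dev n \<omega> ^ (2 * m)) \<partial>M))"
      by (simp add: nn_integral_cmult nn_integral_add emeasure_space_1)
    also have "\<dots> \<le> ennreal (K powr p) * (1 + ennreal (real n ^ m) * ennreal (C / real n ^ m))"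
      by (intro mult_left_mono add_left_mono C(2) n) auto
    also have "ennreal (real n ^ m) * ennreal (C / real n ^ m) = ennreal C"
      using n C(1) by (simp add: ennreal_mult[symmetric])
    also have "ennreal (K powr p) * (1 + ennreal C) = ennreal (K powr p * (1 + C))"
      using C(1) by (simp add: ennreal_mult ennreal_plus)
    also have "\<dots> \<le> ennreal C'"
      by (intro ennreal_leI) (simp add: C'_def)
    finally show ?thesis .
  qed
  moreover have "0 < C'"
    using C(1) by (simp add: C'_def add_nonneg_pos)
  ultimately show ?thesis
    using good_measurable prob_good[OF \<eta>] by blast
qed

end

section \<open>From the Cox model to the sample\<close>

text \<open>With \<open>k\<close> the largest coordinate, the norm is at most \<open>CARD('d) * \<bar>z $ k\<bar>\<close>.  If this coordinate is at most 1
in absolute value, the exponential factor is bounded; otherwise its square is at least 1 and may be inserted for free.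
Such products of a squared coordinate and an exponential are what the moment assumptions control.\<close>
lemma exp_norm_le_coordinates:
  fixes z \<beta> :: "real ^ 'd::finite"
  assumes \<epsilon>: "0 < \<epsilon>"
  shows "exp (\<beta> \<bullet> z + \<epsilon> / real CARD('d) * norm z) \<le> exp \<epsilon> * exp (\<beta> \<bullet> z)
    + (\<Sum>(k, s)\<in>UNIV \<times> {-1, 1}. (z $ k)\<^sup>2 * exp ((\<beta> + (s * \<epsilon>) *\<^sub>R axis k 1) \<bullet> z))"
proof -
  let ?m = "Max (range (\<lambda>k. \<bar>z $ k\<bar>))"
  have le: "\<bar>z $ k\<bar> \<le> ?m" for k
    by (intro Max_ge) auto
  have "?m \<in> range (\<lambda>k. \<bar>z $ k\<bar>)"
    by (intro Max_in) auto
  then obtain k where k: "?m = \<bar>z $ k\<bar>"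
    by (rule rangeE)
  have "norm z \<le> (\<Sum>j\<in>UNIV. \<bar>z $ j\<bar>)"
    by (rule norm_le_l1_cart)
  also have "\<dots> \<le> (\<Sum>j\<in>(UNIV::'d set). \<bar>z $ k\<bar>)"
    using le unfolding k by (intro sum_mono) auto
  finally have "norm z \<le> real CARD('d) * \<bar>z $ k\<bar>"
    by simp
  then have "\<epsilon> / real CARD('d) * norm z \<le> \<epsilon> / real CARD('d) * (real CARD('d) * \<bar>z $ k\<bar>)"
    using \<epsilon> by (intro mult_left_mono) auto
  then have n: "\<epsilon> / real CARD('d) * norm z \<le> \<epsilon> * \<bar>z $ k\<bar>"
    by simp
  have nonneg: "0 \<le> (\<Sum>(k, s)\<in>UNIV \<times> {-1, 1}. (z $ k)\<^sup>2 * exp ((\<beta> + (s * \<epsilon>) *\<^sub>R axis k 1) \<bullet> z))"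
    by (intro sum_nonneg) auto
  show ?thesis
  proof (cases "\<bar>z $ k\<bar> \<le> 1")
    case True
    then have "\<epsilon> * \<bar>z $ k\<bar> \<le> \<epsilon>"
      using \<epsilon> by simp
    then have "exp (\<beta> \<bullet> z + \<epsilon> / real CARD('d) * norm z) \<le> exp (\<epsilon> + \<beta> \<bullet> z)"
      using n by simp
    also have "\<dots> = exp \<epsilon> * exp (\<beta> \<bullet> z)"
      by (rule exp_add)
    finally show ?thesis
      using nonneg by linarith
  next
    case False
    define s where "s = sgn (z $ k)"
    have s: "s \<in> {-1, 1}" "s * z $ k = \<bar>z $ k\<bar>"
      using False by (auto simp: s_def sgn_if)
    have e: "(\<beta> + (s * \<epsilon>) *\<^sub>R axis k 1) \<bullet> z = \<beta> \<bullet> z + \<epsilon> * \<bar>z $ k\<bar>"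
      using s(2) by (simp add: inner_add_left inner_axis' mult.assoc mult.left_commute)
    have "1 \<le> (z $ k)\<^sup>2"
      using False one_le_power[of "\<bar>z $ k\<bar>" 2] by simp
    then have "exp (\<beta> \<bullet> z + \<epsilon> / real CARD('d) * norm z) \<le> (z $ k)\<^sup>2 * exp ((\<beta> + (s * \<epsilon>) *\<^sub>R axis k 1) \<bullet> z)"
      unfolding e using n mult_mono[of 1 "(z $ k)\<^sup>2" "exp (\<beta> \<bullet> z + \<epsilon> / real CARD('d) * norm z)" "exp (\<beta> \<bullet> z + \<epsilon> * \<bar>z $ k\<bar>)"] by simp
    also have "\<dots> \<le> (\<Sum>(k, s)\<in>UNIV \<times> {-1, 1}. (z $ k)\<^sup>2 * exp ((\<beta> + (s * \<epsilon>) *\<^sub>R axis k 1) \<bullet> z))"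
      using s(1) member_le_sum[of "(k, s)" "UNIV \<times> {-1, 1}" "\<lambda>(k, s). (z $ k)\<^sup>2 * exp ((\<beta> + (s * \<epsilon>) *\<^sub>R axis k 1) \<bullet> z)"] by auto
    finally show ?thesis
      by (simp add: add_increasing)
  qed
qed

lemma (in prob_space) envelope_moment:
  fixes Z :: "'a \<Rightarrow> real ^ 'd::finite"
  assumes [measurable]: "Z \<in> borel_measurable M" and \<epsilon>: "0 < \<epsilon>" and q: "q \<ge> 1"
    and exp_moment: "\<And>q::real. q \<ge> 1 \<Longrightarrow> (\<integral>\<^sup>+\<omega>. ennreal (exp (q * (\<beta> \<bullet> Z \<omega>))) \<partial>M) < \<infinity>"
    and weighted_moment: "\<And>(q::real) k b. q \<ge> 1 \<Longrightarrow> b \<in> cball \<beta> \<epsilon> \<Longrightarrow>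
      (\<integral>\<^sup>+\<omega>. ennreal (((Z \<omega> $ k)\<^sup>2) powr q * exp (q * (b \<bullet> Z \<omega>))) \<partial>M) < \<infinity>"
  shows "integrable M (\<lambda>\<omega>. exp (\<beta> \<bullet> Z \<omega> + \<epsilon> / real CARD('d) * norm (Z \<omega>)) ^ q)"
proof -
  define I where "I = insert None (Some ` ((UNIV :: 'd set) \<times> {-1, 1 :: real}))"
  define a where "a i \<omega> = (case i of None \<Rightarrow> exp \<epsilon> * exp (\<beta> \<bullet> Z \<omega>)
     | Some (k, s) \<Rightarrow> (Z \<omega> $ k)\<^sup>2 * exp ((\<beta> + (s * \<epsilon>) *\<^sub>R axis k 1) \<bullet> Z \<omega>))" for i \<omega>
  have fin: "finite I"
    by (simp add: I_def)
  have a0: "0 \<le> a i \<omega>" for i \<omega>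
    by (auto simp: a_def split: option.splits)
  have am [measurable]: "a i \<in> borel_measurable M" for i
    unfolding a_def by (cases i) (auto split: prod.splits)
  have a_int: "integrable M (\<lambda>\<omega>. a i \<omega> ^ q)" if i: "i \<in> I" for i
  proof (cases i)
    case None
    have "(\<integral>\<^sup>+\<omega>. ennreal (exp (real q * (\<beta> \<bullet> Z \<omega>))) \<partial>M) < \<infinity>"
      using q by (intro exp_moment) simp
    then have "integrable M (\<lambda>\<omega>. exp (real q * (\<beta> \<bullet> Z \<omega>)))"
      by (intro integrableI_nonneg) auto
    then have "integrable M (\<lambda>\<omega>. exp \<epsilon> ^ q * exp (real q * (\<beta> \<bullet> Z \<omega>)))"
      by (rule integrable_mult_right)
    then show ?thesis
      by (simp add: None a_def power_mult_distrib exp_of_nat_mult)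
  next
    case (Some ks)
    obtain k s where ks: "ks = (k, s)" by (cases ks)
    have s: "\<bar>s\<bar> = 1"
      using i Some ks by (auto simp: I_def)
    let ?b = "\<beta> + (s * \<epsilon>) *\<^sub>R axis k 1"
    have "dist \<beta> ?b = \<epsilon>"
      using s \<epsilon> by (simp add: dist_norm abs_mult)
    then have "(\<integral>\<^sup>+\<omega>. ennreal (((Z \<omega> $ k)\<^sup>2) powr real q * exp (real q * (?b \<bullet> Z \<omega>))) \<partial>M) < \<infinity>"
      using q by (intro weighted_moment) simp_all
    then have "integrable M (\<lambda>\<omega>. ((Z \<omega> $ k)\<^sup>2) powr real q * exp (real q * (?b \<bullet> Z \<omega>)))"
      by (intro integrableI_nonneg) auto
    moreover have "((Z \<omega> $ k)\<^sup>2) powr real q = ((Z \<omega> $ k)\<^sup>2) ^ q" for \<omega>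
      using q by (cases "Z \<omega> $ k = 0") (simp_all add: powr_realpow)
    ultimately show ?thesis
      by (simp add: Some ks a_def power_mult_distrib exp_of_nat_mult)
  qed
  show ?thesis
  proof (rule integrable_dominated)
    show "integrable M (\<lambda>\<omega>. real (card I) ^ (q - 1) * (\<Sum>i\<in>I. a i \<omega> ^ q))"
      by (intro integrable_mult_right Bochner_Integration.integrable_sum a_int)
    fix \<omega>
    have "exp (\<beta> \<bullet> Z \<omega> + \<epsilon> / real CARD('d) * norm (Z \<omega>)) \<le> (\<Sum>i\<in>I. a i \<omega>)"
    proof -
      have "(\<Sum>i\<in>I. a i \<omega>) = a None \<omega> + (\<Sum>x\<in>UNIV \<times> {-1, 1}. a (Some x) \<omega>)"
        unfolding I_def by (subst sum.insert) (auto simp: sum.reindex)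
      then show ?thesis
        using exp_norm_le_coordinates[OF \<epsilon>, of \<beta> "Z \<omega>"] by (simp add: a_def split_beta')
    qed
    then have "exp (\<beta> \<bullet> Z \<omega> + \<epsilon> / real CARD('d) * norm (Z \<omega>)) ^ q \<le> (\<Sum>i\<in>I. a i \<omega>) ^ q"
      by (intro power_mono) auto
    also have "\<dots> \<le> real (card I) ^ (q - 1) * (\<Sum>i\<in>I. a i \<omega> ^ q)"
      using fin a0 q by (intro sum_power_le) auto
    finally show "\<bar>exp (\<beta> \<bullet> Z \<omega> + \<epsilon> / real CARD('d) * norm (Z \<omega>)) ^ q\<bar> \<le> real (card I) ^ (q - 1) * (\<Sum>i\<in>I. a i \<omega> ^ q)"
      by simp
  qed measurable
qed

text \<open>The quadratic form attains a positive minimum on the unit sphere.\<close>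
lemma positive_definite_coercive:
  fixes A :: "real ^ 'd ^ 'd::finite"
  assumes "positive_definite A"
  shows "\<exists>l>0. \<forall>v. 2 * l * (norm v)\<^sup>2 \<le> v \<bullet> (A *v v)"
proof -
  have cont: "continuous_on (sphere 0 1) (\<lambda>v. v \<bullet> (A *v v))"
    by (intro continuous_intros linear_continuous_on matrix_vector_mul_bounded_linear)
  have "axis undefined 1 \<in> (sphere 0 1 :: (real ^ 'd) set)"
    by simp
  then obtain v0 where v0: "v0 \<in> sphere 0 1" "\<And>v. v \<in> sphere 0 1 \<Longrightarrow> v0 \<bullet> (A *v v0) \<le> v \<bullet> (A *v v)"
    using continuous_attains_inf[OF compact_sphere _ cont] by blast
  define l where "l = v0 \<bullet> (A *v v0) / 2"
  have "v0 \<noteq> 0"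
    using v0(1) by auto
  then have l: "0 < l"
    using assms by (simp add: l_def positive_definite_def)
  have "2 * l * (norm v)\<^sup>2 \<le> v \<bullet> (A *v v)" for v
  proof (cases "v = 0")
    case False
    define w where "w = (1 / norm v) *\<^sub>R v"
    have w: "w \<in> sphere 0 1" "v = norm v *\<^sub>R w"
      using False by (simp_all add: w_def)
    have "2 * l \<le> w \<bullet> (A *v w)"
      using v0(2)[OF w(1)] by (simp add: l_def)
    then have "2 * l * (norm v)\<^sup>2 \<le> (w \<bullet> (A *v w)) * (norm v)\<^sup>2"
      by (rule mult_right_mono) simp
    also have "\<dots> = (norm v *\<^sub>R w) \<bullet> (A *v (norm v *\<^sub>R w))"
      by (simp add: matrix_vector_mult_scaleR power2_eq_square)
    finally show ?thesis
      using w(2) by simp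
  qed simp
  with l show ?thesis by blast
qed

lemma inner_matrix_vector: "v \<bullet> (A *v v) = (\<Sum>k\<in>UNIV. \<Sum>j\<in>UNIV. v $ k * v $ j * A $ k $ j)"
  for A :: "real ^ 'd ^ 'd::finite"
  by (simp add: inner_vec_def matrix_vector_mult_def sum_distrib_left mult_ac)

lemma integrable_vec:
  fixes f :: "'a \<Rightarrow> 'b::euclidean_space ^ 'd::finite"
  assumes "\<And>k. integrable M (\<lambda>\<omega>. f \<omega> $ k)"
  shows "integrable M f"
proof -
  have bl: "bounded_linear (axis k :: 'b \<Rightarrow> 'b ^ 'd)" for k
    by (rule linear_conv_bounded_linear[THEN iffD1], rule linearI) (simp_all add: vec_eq_iff axis_def)
  have f: "f = (\<lambda>\<omega>. \<Sum>k\<in>UNIV. axis k (f \<omega> $ k))"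
    by (simp add: fun_eq_iff vec_eq_iff axis_def)
  have "integrable M (\<lambda>\<omega>. \<Sum>k\<in>UNIV. axis k (f \<omega> $ k))"
    by (intro Bochner_Integration.integrable_sum integrable_bounded_linear[OF bl] assms)
  then show ?thesis
    by (subst f)
qed

lemma bounded_linear_entry: "bounded_linear (\<lambda>A :: real ^ 'd ^ 'd::finite. A $ k $ l)"
  using bounded_linear_compose[OF bounded_linear_vec_nth bounded_linear_vec_nth] by blast

theorem theorem2:
  fixes M :: "'a measure"
    and X C T :: "'a \<Rightarrow> real"
    and Z :: "'a \<Rightarrow> real ^ 'd::finite"
    and F f G :: "real \<Rightarrow> real ^ 'd \<Rightarrow> real"
    and lambda0 :: "real \<Rightarrow> real"
    and \<beta>\<^sub>0 :: "real ^ 'd"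
    and T\<^sub>i :: "nat \<Rightarrow> 'a \<Rightarrow> real"
    and \<Delta>\<^sub>i :: "nat \<Rightarrow> 'a \<Rightarrow> bool"
    and Z\<^sub>i :: "nat \<Rightarrow> 'a \<Rightarrow> real ^ 'd"
    and \<beta>\<^sub>n :: "nat \<Rightarrow> 'a \<Rightarrow> real ^ 'd"
    and \<tau>\<^sub>F \<tau>\<^sub>G :: ereal
    and p :: real
  assumes model: "cox_model M X C Z F f G lambda0 \<beta>\<^sub>0"
    and T_eq: "T = (\<lambda>\<omega>. min (X \<omega>) (C \<omega>))"
    and sample: "iid_copies M (\<lambda>i \<omega>. (T\<^sub>i i \<omega>, \<Delta>\<^sub>i i \<omega>, Z\<^sub>i i \<omega>)) (\<lambda>\<omega>. (T \<omega>, X \<omega> \<le> C \<omega>, Z \<omega>))"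
    and estimator: "\<And>n. n \<ge> 1 \<Longrightarrow> max_partial_likelihood_estimator M n T\<^sub>i \<Delta>\<^sub>i Z\<^sub>i (\<beta>\<^sub>n n)"
    and tau_F: "\<tau>\<^sub>F = right_endpoint M X"
    and tau_G: "\<tau>\<^sub>G = right_endpoint M C"
    and nondegenerate: "positive_definite (information_matrix M T Z lambda0 \<beta>\<^sub>0 \<tau>\<^sub>G)"
    and i_endpoints: "\<tau>\<^sub>G < \<tau>\<^sub>F"
    and i_atom: "measure M {\<omega> \<in> space M. ereal (T \<omega>) = \<tau>\<^sub>G} > 0"
    and ii: "\<exists>\<epsilon>>0. (SUP \<beta>\<in>cball \<beta>\<^sub>0 \<epsilon>. \<integral>\<^sup>+\<omega>. ennreal ((norm (Z \<omega>))\<^sup>2 * exp (2 * (\<beta> \<bullet> Z \<omega>))) \<partial>M) < \<infinity>"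
    and iii: "\<forall>q::real. q \<ge> 1 \<longrightarrow> (\<integral>\<^sup>+\<omega>. ennreal (exp (q * (\<beta>\<^sub>0 \<bullet> Z \<omega>))) \<partial>M) < \<infinity>"
    and iv: "\<exists>\<epsilon>>0. \<forall>q::real. \<forall>k. q \<ge> 1 \<longrightarrow>
               (SUP \<beta>\<in>cball \<beta>\<^sub>0 \<epsilon>. \<integral>\<^sup>+\<omega>. ennreal (((Z \<omega> $ k)\<^sup>2) powr q * exp (q * (\<beta> \<bullet> Z \<omega>))) \<partial>M) < \<infinity>"
    and v: "continuous_on {t. 0 \<le> t \<and> ereal t < \<tau>\<^sub>F} lambda0"
    and p: "p \<ge> 1"
  shows "\<exists>(A :: nat \<Rightarrow> 'a set) (K :: real).
           (\<forall>n. A n \<in> sets M) \<and>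
           (\<lambda>n. measure M (A n)) \<longlonglongrightarrow> 1 \<and>
           K > 0 \<and>
           limsup (\<lambda>n. \<integral>\<^sup>+\<omega>. indicator (A n) \<omega> * ennreal (real n powr (p / 2)) *
                      (SUP t\<in>{t. 0 \<le> t \<and> ereal t < \<tau>\<^sub>G}.
                         ennreal (\<bar>breslow n (\<lambda>i. T\<^sub>i i \<omega>) (\<lambda>i. \<Delta>\<^sub>i i \<omega>) (\<lambda>i. Z\<^sub>i i \<omega>) (\<beta>\<^sub>n n \<omega>) t
                                   - cum_hazard lambda0 t\<bar> powr p)) \<partial>M)
             \<le> ennreal K"
proof -
  interpret cox_model M X C Z F f G lambda0 \<beta>\<^sub>0
    by (rule model)
  have T_meas [measurable]: "T \<in> borel_measurable M"
    unfolding T_eq by measurable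
  define W0 where "W0 \<omega> = (T \<omega>, X \<omega> \<le> C \<omega>, Z \<omega>)" for \<omega>
  define W where "W i \<omega> = (T\<^sub>i i \<omega>, \<Delta>\<^sub>i i \<omega>, Z\<^sub>i i \<omega>)" for i \<omega>
  define P where "P = distr M obs_algebra W0"
  have W0_meas [measurable]: "W0 \<in> measurable M obs_algebra"
    unfolding W0_def[abs_def] by measurable
  have sets_P: "sets P = sets obs_algebra"
    by (simp add: P_def)
  have nn_P: "(\<integral>\<^sup>+w. h w \<partial>P) = (\<integral>\<^sup>+\<omega>. h (W0 \<omega>) \<partial>M)" if "h \<in> borel_measurable obs_algebra" for h
    unfolding P_def using that by (intro nn_integral_distr) auto

  have pos_T: "AE \<omega> in M. 0 \<le> T \<omega>"
    using X_nonneg C_nonneg by eventually_elim (simp add: T_eq)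
  obtain \<tau> where \<tau>: "\<tau>\<^sub>G = ereal \<tau>" "0 \<le> \<tau>"
  proof -
    have "\<exists>\<omega>. ereal (T \<omega>) = \<tau>\<^sub>G \<and> 0 \<le> T \<omega>"
    proof (rule ccontr)
      assume none: "\<nexists>\<omega>. ereal (T \<omega>) = \<tau>\<^sub>G \<and> 0 \<le> T \<omega>"
      have "AE \<omega> in M. \<omega> \<notin> {\<omega> \<in> space M. ereal (T \<omega>) = \<tau>\<^sub>G}"
        using pos_T by eventually_elim (use none in auto)
      then have "prob {\<omega> \<in> space M. ereal (T \<omega>) = \<tau>\<^sub>G} = 0"
        by (subst prob_eq_0) simp_all
      with i_atom show False by simp
    qed
    then show ?thesis
      using that by metis
  qed
  have \<tau>_end: "ereal \<tau> < right_endpoint M X"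
    using i_endpoints by (simp add: \<tau> tau_F)
  have C_le: "AE \<omega> in M. C \<omega> \<le> \<tau>"
    using tau_G \<tau> by (intro C_le_endpoint) simp

  have cont: "continuous_on {0..\<tau>} lambda0"
  proof (rule continuous_on_subset[OF v])
    show "{0..\<tau>} \<subseteq> {t. 0 \<le> t \<and> ereal t < \<tau>\<^sub>F}"
      using \<tau>_end by (auto simp: tau_F intro: le_less_trans[of _ "ereal \<tau>"])
  qed
  obtain u0 where u0: "\<forall>u\<in>{0..\<tau>}. lambda0 u \<le> lambda0 u0"
    using continuous_attains_sup[OF compact_Icc _ cont] \<tau>(2) by auto
  define L where "L = lambda0 u0"
  have L: "lambda0 u \<le> L" if "u \<in> {0..\<tau>}" for u
    using u0 that by (simp add: L_def)
  have L0: "0 \<le> L"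
    using L[of 0] baseline_nonneg[of 0] \<tau>(2) by simp
  \<comment> \<open>Only the values on \<open>{0..\<tau>}\<close> matter; outside, \<open>lambda0\<close> need not be measurable.\<close>
  define lam where "lam u = indicator {0<..\<tau>} u * lambda0 u" for u
  have lam_meas [measurable]: "lam \<in> borel_measurable borel"
  proof -
    have "continuous_on {0<..\<tau>} lambda0"
      by (rule continuous_on_subset[OF cont]) auto
    then show ?thesis
      using borel_measurable_continuous_on_indicator[of "{0<..\<tau>}" lambda0] by (simp add: lam_def[abs_def])
  qed
  have lam_eq: "lam u = lambda0 u" if "0 < u" "u \<le> \<tau>" for u
    using that by (simp add: lam_def)

  obtain \<epsilon> where \<epsilon>: "0 < \<epsilon>" and iv': "\<And>(q::real) k. q \<ge> 1 \<Longrightarrow>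
      (SUP \<beta>\<in>cball \<beta>\<^sub>0 \<epsilon>. \<integral>\<^sup>+\<omega>. ennreal (((Z \<omega> $ k)\<^sup>2) powr q * exp (q * (\<beta> \<bullet> Z \<omega>))) \<partial>M) < \<infinity>"
    using iv by blast
  define \<rho> where "\<rho> = \<epsilon> / real CARD('d) / 2"
  have env: "integrable M (\<lambda>\<omega>. exp (\<beta>\<^sub>0 \<bullet> Z \<omega> + 2 * \<rho> * norm (Z \<omega>)) ^ q)" for q :: nat
  proof (cases "q = 0")
    case False
    have "integrable M (\<lambda>\<omega>. exp (\<beta>\<^sub>0 \<bullet> Z \<omega> + \<epsilon> / real CARD('d) * norm (Z \<omega>)) ^ q)"
    proof (rule envelope_moment[OF Z_rv \<epsilon>])
      show "(\<integral>\<^sup>+\<omega>. ennreal (((Z \<omega> $ k)\<^sup>2) powr r * exp (r * (b \<bullet> Z \<omega>))) \<partial>M) < \<infinity>"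
        if "r \<ge> 1" "b \<in> cball \<beta>\<^sub>0 \<epsilon>" for r :: real and k b
        using SUP_upper[OF that(2)] iv'[OF that(1)] by (rule le_less_trans)
    qed (use False iii in auto)
    then show ?thesis
      by (simp add: \<rho>_def)
  qed simp

  have iid: "iid_sample M W P"
  proof (intro iid_sample.intro iid_sample_axioms.intro)
    show "prob_space M"
      by (rule prob_space_axioms)
    show "prob_space P"
      unfolding P_def by (rule prob_space_distr) measurable
    show "indep_vars (\<lambda>_. P) W UNIV"
      using sample unfolding iid_copies_def indep_vars_def2 W_def[abs_def, symmetric] by (simp add: P_def)
    show "distr M P (W i) = P" for i
    proof -
      have "distr M P (W i) = distr M obs_algebra (W i)"
        by (rule distr_cong) (simp_all add: sets_P)
      also have "\<dots> = P"
        using sample unfolding iid_copies_def W_def[abs_def] P_def W0_def[abs_def] by simp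
      finally show ?thesis .
    qed
  qed
  interpret cox_sample M W P \<beta>\<^sub>0 \<tau> \<rho> L lam
  proof (intro cox_sample.intro iid cox_sample_axioms.intro)
    show "AE w in P. 0 \<le> fst w \<and> fst w \<le> \<tau>"
      unfolding P_def
    proof (subst AE_distr_iff)
      show "AE \<omega> in M. 0 \<le> fst (W0 \<omega>) \<and> fst (W0 \<omega>) \<le> \<tau>"
        using pos_T C_le by eventually_elim (simp add: W0_def T_eq)
    qed measurable
    show "(\<integral>\<^sup>+w. of_bool (fst (snd w)) * k (fst w, snd (snd w)) \<partial>P)
      = (\<integral>\<^sup>+u. (\<integral>\<^sup>+w. ennreal (lam u * exp (\<beta>\<^sub>0 \<bullet> snd (snd w))) * of_bool (u \<le> fst w) * k (u, snd (snd w)) \<partial>P) \<partial>lborel)"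
      if [measurable]: "k \<in> borel_measurable (borel \<Otimes>\<^sub>M borel)" for k
    proof -
      have "(\<lambda>w. of_bool (fst (snd w)) * k (fst w, snd (snd w))) \<in> borel_measurable obs_algebra"
        unfolding of_bool_def by measurable
      then have "(\<integral>\<^sup>+w. of_bool (fst (snd w)) * k (fst w, snd (snd w)) \<partial>P)
          = (\<integral>\<^sup>+\<omega>. of_bool (X \<omega> \<le> C \<omega>) * k (min (X \<omega>) (C \<omega>), Z \<omega>) \<partial>M)"
        using nn_P[of "\<lambda>w. of_bool (fst (snd w)) * k (fst w, snd (snd w))"] by (simp add: W0_def T_eq)
      also have "\<dots> = (\<integral>\<^sup>+u. (\<integral>\<^sup>+\<omega>. ennreal (lam u * exp (\<beta>\<^sub>0 \<bullet> Z \<omega>)) * indicator {0<..\<tau>} u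
          * of_bool (u \<le> min (X \<omega>) (C \<omega>)) * k (u, Z \<omega>) \<partial>M) \<partial>lborel)"
        by (rule observed_event_law[OF \<tau>(2) \<tau>_end lam_meas lam_eq C_le that])
      also have "\<dots> = (\<integral>\<^sup>+u. (\<integral>\<^sup>+w. ennreal (lam u * exp (\<beta>\<^sub>0 \<bullet> snd (snd w))) * of_bool (u \<le> fst w) * k (u, snd (snd w)) \<partial>P) \<partial>lborel)"
      proof (intro nn_integral_cong)
        fix u :: real
        have "(\<lambda>w. ennreal (lam u * exp (\<beta>\<^sub>0 \<bullet> snd (snd w))) * of_bool (u \<le> fst w) * k (u, snd (snd w))) \<in> borel_measurable obs_algebra"
          unfolding of_bool_def by measurable
        then have "(\<integral>\<^sup>+w. ennreal (lam u * exp (\<beta>\<^sub>0 \<bullet> snd (snd w))) * of_bool (u \<le> fst w) * k (u, snd (snd w)) \<partial>P)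
            = (\<integral>\<^sup>+\<omega>. ennreal (lam u * exp (\<beta>\<^sub>0 \<bullet> Z \<omega>)) * of_bool (u \<le> min (X \<omega>) (C \<omega>)) * k (u, Z \<omega>) \<partial>M)"
          using nn_P[of "\<lambda>w. ennreal (lam u * exp (\<beta>\<^sub>0 \<bullet> snd (snd w))) * of_bool (u \<le> fst w) * k (u, snd (snd w))"]
          by (simp add: W0_def T_eq)
        moreover have "ennreal (lam u * c) * indicator {0<..\<tau>} u = ennreal (lam u * c)" for c
          by (simp add: lam_def indicator_def)
        ultimately show "(\<integral>\<^sup>+\<omega>. ennreal (lam u * exp (\<beta>\<^sub>0 \<bullet> Z \<omega>)) * indicator {0<..\<tau>} u
          * of_bool (u \<le> min (X \<omega>) (C \<omega>)) * k (u, Z \<omega>) \<partial>M)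
          = (\<integral>\<^sup>+w. ennreal (lam u * exp (\<beta>\<^sub>0 \<bullet> snd (snd w))) * of_bool (u \<le> fst w) * k (u, snd (snd w)) \<partial>P)"
          by simp
      qed
      finally show ?thesis .
    qed
    show "integrable P (\<lambda>w. exp (\<beta>\<^sub>0 \<bullet> snd (snd w) + 2 * \<rho> * norm (snd (snd w))) ^ q)" for q
    proof -
      have "integrable M (\<lambda>\<omega>. (\<lambda>w. exp (\<beta>\<^sub>0 \<bullet> snd (snd w) + 2 * \<rho> * norm (snd (snd w))) ^ q) (W0 \<omega>))"
        using env[of q] by (simp add: W0_def)
      then show ?thesis
        unfolding P_def by (subst integrable_distr_eq) measurable
    qed
    show "0 < measure P {w \<in> space P. \<tau> \<le> fst w}"
    proof -
      have "{w \<in> space P. \<tau> \<le> fst w} \<in> sets obs_algebra"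
        unfolding P_def space_distr by measurable
      then have "measure P {w \<in> space P. \<tau> \<le> fst w} = prob (W0 -` {w \<in> space P. \<tau> \<le> fst w} \<inter> space M)"
        unfolding P_def by (intro measure_distr) auto
      also have "W0 -` {w \<in> space P. \<tau> \<le> fst w} \<inter> space M = {\<omega> \<in> space M. \<tau> \<le> T \<omega>}"
        by (auto simp: W0_def P_def space_pair_measure)
      also have "prob \<dots> \<ge> measure M {\<omega> \<in> space M. ereal (T \<omega>) = \<tau>\<^sub>G}"
        by (intro finite_measure_mono) (auto simp: \<tau>)
      finally show ?thesis
        using i_atom by linarith
    qed
    show "lam u \<le> L" for u
      using L[of u] L0 by (simp add: lam_def indicator_def)
    show "0 \<le> lam u" for u
      using baseline_nonneg[of u] by (simp add: lam_def indicator_def)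
    show "0 < \<rho>"
      using \<epsilon> by (simp add: \<rho>_def)
    show "lam u = 0" if "u \<notin> {0<..\<tau>}" for u
      using that by (simp add: lam_def)
  qed (simp_all add: sets_P)

  have int_P: "(\<integral>w. h w \<partial>P) = (\<integral>\<omega>. h (W0 \<omega>) \<partial>M)" if "h \<in> borel_measurable obs_algebra" for h :: "_ \<Rightarrow> real"
    unfolding P_def using that by (intro integral_distr) auto
  have int_M: "integrable M (\<lambda>\<omega>. h (W0 \<omega>))" if "integrable P h" for h :: "_ \<Rightarrow> real"
    using that unfolding P_def by (rule integrable_distr[OF W0_meas])
  have tail_M: "tail fst h u = (\<integral>\<omega>. of_bool (u \<le> T \<omega>) * h (W0 \<omega>) \<partial>M)" if "h \<in> borel_measurable P" for h u
  proof -
    have [measurable]: "h \<in> borel_measurable obs_algebra"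
      using that by (simp add: P_def)
    show ?thesis
      unfolding tail_def by (subst int_P) (auto simp: W0_def)
  qed
  have Phi_eq: "Phi M T Z \<beta>\<^sub>0 u = R0 u" for u
    unfolding R0_def by (subst tail_M) (auto simp: Phi_def w0_def W0_def)
  have D1_eq: "D1 M T Z \<beta>\<^sub>0 u $ k = R1 k u" for u k
  proof -
    have int: "integrable M (\<lambda>\<omega>. (of_bool (u \<le> T \<omega>) * exp (\<beta>\<^sub>0 \<bullet> Z \<omega>)) *\<^sub>R Z \<omega>)"
    proof (rule integrable_vec)
      show "integrable M (\<lambda>\<omega>. ((of_bool (u \<le> T \<omega>) * exp (\<beta>\<^sub>0 \<bullet> Z \<omega>)) *\<^sub>R Z \<omega>) $ k)" for k
        using int_M[OF tail_integrable[OF P_measurable(1) w_integrable(2)], of u k]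
        by (simp add: w1_def w0_def W0_def mult.assoc)
    qed
    show ?thesis
      unfolding D1_def R1_def using integral_bounded_linear[OF bounded_linear_vec_nth int, of k]
      by (subst tail_M) (auto simp: w1_def w0_def W0_def mult.assoc)
  qed
  have D2_eq: "D2 M T Z \<beta>\<^sub>0 u $ k $ l = R2 k l u" for u k l
  proof -
    have int: "integrable M (\<lambda>\<omega>. (of_bool (u \<le> T \<omega>) * exp (\<beta>\<^sub>0 \<bullet> Z \<omega>)) *\<^sub>R outer (Z \<omega>) (Z \<omega>))"
    proof (intro integrable_vec)
      show "integrable M (\<lambda>\<omega>. ((of_bool (u \<le> T \<omega>) * exp (\<beta>\<^sub>0 \<bullet> Z \<omega>)) *\<^sub>R outer (Z \<omega>) (Z \<omega>)) $ k $ l)" for k l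
        using int_M[OF tail_integrable[OF P_measurable(1) w_integrable(3)], of u k l]
        by (simp add: w2_def w0_def W0_def outer_def mult.assoc)
    qed
    show ?thesis
      unfolding D2_def R2_def using integral_bounded_linear[OF bounded_linear_entry int, of k l]
      by (subst tail_M) (auto simp: w2_def w0_def W0_def outer_def mult.assoc)
  qed
  have info_eq: "information_matrix M T Z lambda0 \<beta>\<^sub>0 \<tau>\<^sub>G $ k $ l = info_lim k l" for k l
  proof -
    let ?J = "{u. 0 \<le> u \<and> ereal u \<le> \<tau>\<^sub>G}"
    define g where "g u = indicator ?J u *\<^sub>R ((Phi M T Z \<beta>\<^sub>0 u * lambda0 u) *\<^sub>R
        ((1 / Phi M T Z \<beta>\<^sub>0 u) *\<^sub>R D2 M T Z \<beta>\<^sub>0 u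
         - (1 / (Phi M T Z \<beta>\<^sub>0 u)\<^sup>2) *\<^sub>R outer (D1 M T Z \<beta>\<^sub>0 u) (D1 M T Z \<beta>\<^sub>0 u)))" for u
    have I: "information_matrix M T Z lambda0 \<beta>\<^sub>0 \<tau>\<^sub>G = (\<integral>u. g u \<partial>lborel)"
      unfolding information_matrix_def set_lebesgue_integral_def g_def ..
    \<comment> \<open>A positive definite matrix is not 0, which is the value of the integral of a non-integrable function.\<close>
    have int: "integrable lborel g"
    proof (rule ccontr)
      assume "\<not> integrable lborel g"
      then have zero: "information_matrix M T Z lambda0 \<beta>\<^sub>0 \<tau>\<^sub>G = 0"
        unfolding I by (rule not_integrable_integral_eq)
      have "(axis undefined 1 :: real ^ 'd) \<noteq> 0"
        by simp
      then have "0 < (axis undefined 1 :: real ^ 'd) \<bullet> (information_matrix M T Z lambda0 \<beta>\<^sub>0 \<tau>\<^sub>G *v axis undefined 1)"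
        using nondegenerate unfolding positive_definite_def by blast
      then show False
        unfolding zero by simp
    qed
    have "information_matrix M T Z lambda0 \<beta>\<^sub>0 \<tau>\<^sub>G $ k $ l = (\<integral>u. g u $ k $ l \<partial>lborel)"
      unfolding I by (rule integral_bounded_linear[OF bounded_linear_entry int, symmetric])
    also have "\<dots> = (\<integral>u. lam u * (risk_cov_lim k l u * R0 u) \<partial>lborel)"
    proof (rule integral_cong_AE)
      show "(\<lambda>u. g u $ k $ l) \<in> borel_measurable lborel"
        using integrable_bounded_linear[OF bounded_linear_entry int] by auto
      have "AE u in lborel. u \<noteq> (0::real)"
        by (rule AE_lborel_singleton)
      then show "AE u in lborel. g u $ k $ l = lam u * (risk_cov_lim k l u * R0 u)"
      proof eventually_elim
        case (elim u)
        show ?case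
        proof (cases "0 < u \<and> u \<le> \<tau>")
          case True
          then have "0 < R0 u"
            by (intro R0_pos') simp
          then show ?thesis
            using True by (simp add: g_def \<tau> lam_eq risk_cov_lim_def risk_mean_lim_def Phi_eq D1_eq D2_eq outer_def
                field_simps power2_eq_square)
        next
          case False
          then show ?thesis
            using elim by (auto simp: g_def \<tau> lam_def indicator_def)
        qed
      qed
    qed measurable
    finally show ?thesis
      by (simp add: info_lim_def)
  qed
  obtain l where l: "0 < l" "\<And>d. 2 * l * (norm d)\<^sup>2 \<le> (\<Sum>k\<in>UNIV. \<Sum>j\<in>UNIV. d $ k * d $ j * info_lim k j)"
    using positive_definite_coercive[OF nondegenerate] unfolding inner_matrix_vector info_eq by blast

  have hazard: "cum_lam t = cum_hazard lambda0 t" if "0 \<le> t" "ereal t < \<tau>\<^sub>G" for t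
    unfolding cum_hazard_def set_lebesgue_integral_def
  proof (rule integral_cong_AE)
    show "(\<lambda>u. indicator {0..t} u *\<^sub>R lambda0 u) \<in> borel_measurable lborel"
      using borel_measurable_continuous_on_indicator[of "{0..t}" lambda0] continuous_on_subset[OF cont, of "{0..t}"] that
      by (auto simp: \<tau>)
    have "AE u in lborel. u \<noteq> (0::real)"
      by (rule AE_lborel_singleton)
    then show "AE u in lborel. lam u * indicator {..t} u = indicator {0..t} u *\<^sub>R lambda0 u"
      by eventually_elim (use that \<tau> in \<open>auto simp: lam_def indicator_def\<close>)
  qed measurable

  obtain A K where A: "\<And>n. A n \<in> sets M" "(\<lambda>n. prob (A n)) \<longlonglongrightarrow> 1" and K: "K > 0"
    and bound: "\<And>n. n \<ge> 1 \<Longrightarrow> (\<integral>\<^sup>+\<omega>. indicator (A n) \<omega> * ennreal (real n powr (p / 2)) *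
      (SUP s. ennreal (\<bar>sample_breslow n \<omega> (\<beta>\<^sub>n n \<omega>) s
        - cum_lam s\<bar> powr p)) \<partial>M) \<le> ennreal K"
  proof -
    have "(\<exists>\<beta>'. is_maximizer (sample_likelihood n \<omega>) \<beta>')
        \<longrightarrow> is_maximizer (sample_likelihood n \<omega>) (\<beta>\<^sub>n n \<omega>)"
      if "n \<ge> 1" "\<omega> \<in> space M" for n \<omega>
      using estimator[OF that(1)] that(2) by (simp add: max_partial_likelihood_estimator_def W_def Let_def)
    from breslow_moment_bound[OF l this p] show ?thesis
      using that by blast
  qed
  let ?S = "\<lambda>n \<omega>. SUP t\<in>{t. 0 \<le> t \<and> ereal t < \<tau>\<^sub>G}.
    ennreal (\<bar>breslow n (\<lambda>i. T\<^sub>i i \<omega>) (\<lambda>i. \<Delta>\<^sub>i i \<omega>) (\<lambda>i. Z\<^sub>i i \<omega>) (\<beta>\<^sub>n n \<omega>) t - cum_hazard lambda0 t\<bar> powr p)"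
  have "limsup (\<lambda>n. \<integral>\<^sup>+\<omega>. indicator (A n) \<omega> * ennreal (real n powr (p / 2)) * ?S n \<omega> \<partial>M) \<le> ennreal K"
  proof (rule Limsup_bounded)
    show "eventually (\<lambda>n. (\<integral>\<^sup>+\<omega>. indicator (A n) \<omega> * ennreal (real n powr (p / 2)) * ?S n \<omega> \<partial>M) \<le> ennreal K) sequentially"
      using eventually_ge_at_top[of 1]
    proof eventually_elim
      case (elim n)
      show ?case
      proof (rule order_trans[OF nn_integral_mono bound[OF elim]])
        fix \<omega>
        show "indicator (A n) \<omega> * ennreal (real n powr (p / 2)) * ?S n \<omega>
          \<le> indicator (A n) \<omega> * ennreal (real n powr (p / 2)) *
            (SUP s. ennreal (\<bar>sample_breslow n \<omega> (\<beta>\<^sub>n n \<omega>) s - cum_lam s\<bar> powr p))"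
        proof (intro mult_left_mono SUP_mono)
          fix t assume t: "t \<in> {t. 0 \<le> t \<and> ereal t < \<tau>\<^sub>G}"
          show "\<exists>s\<in>UNIV. ennreal (\<bar>breslow n (\<lambda>i. T\<^sub>i i \<omega>) (\<lambda>i. \<Delta>\<^sub>i i \<omega>) (\<lambda>i. Z\<^sub>i i \<omega>) (\<beta>\<^sub>n n \<omega>) t - cum_hazard lambda0 t\<bar> powr p)
            \<le> ennreal (\<bar>sample_breslow n \<omega> (\<beta>\<^sub>n n \<omega>) s - cum_lam s\<bar> powr p)"
            using t by (intro bexI[of _ t]) (simp_all add: W_def hazard)
        qed simp
      qed
    qed
  qed
  with A K show ?thesis
    by blast
qed

end
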